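(* Let $k$ be an algebraically closed field of characteristic zero, $R=k[x_1,\dots,x_n]$, $S=k[y_1,\dots,y_n]$ with $R$ acting on $S$ by differentiation. Let $A=R/I$ be a graded artin level quotient of $R$ of type $t$ and socle degree $d$, with Hilbert function $\underline h$, and let $\Lambda=(I^{-1})_d\subseteq S_d$. Restriction to degree $d$ gives injections $$\mathrm{Hom}_R(I,R/I)_0\hookrightarrow \mathrm{Hom}_k(I_d,R_d/I_d),\qquad \mathrm{Hom}_R(I^{-1},S/I^{-1})_0\hookrightarrow \mathrm{Hom}_k(\Lambda,S_d/\Lambda),$$ where the subscript $0$ denotes morphisms of graded modules of degree zero. With respect to these injections, and the canonical identifications $T_{G(t,S_d),\Lambda}=\mathrm{Hom}_k(\Lambda,S_d/\Lambda)$ and $T_{G(\dim R_d-t,R_d),I_d}=\mathrm{Hom}_k(I_d,R_d/I_d)$: (A) Regarding $\mathcal L^\circ(\underline h)$ as a subscheme of $G(t,S_d)$, there is a canonical isomorphism $$T_{\mathcal L^\circ(\underline h),\Lambda}=\mathrm{Hom}_R(I^{-1},S/I^{-1})_0=\mathrm{Hom}_R(I^{-1},(I^2)^{-1}/I^{-1})_0 .$$ (B) Regarding $\mathcal L^\circ(\underline h)$ as a subscheme of $G(\dim R_d-t,R_d)$, there is a canonical isomorphism $$T_{\mathcal L^\circ(\underline h),I_d}=\mathrm{Hom}_R(I,R/I)_0=\mathrm{Hom}_R(I/I^2,R/I)_0 .$$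
   Context: $R=k[x_1,\dots,x_n]$ acts on $S=k[y_1,\dots,y_n]$ by $u.F=u(\partial/\partial y_1,\dots,\partial/\partial y_n)F$, so $R_j\otimes S_i\to S_{i-j}$. For a homogeneous ideal $I\subseteq R$, the inverse system is $I^{-1}=\{F\in S: u.F=0 \text{ for all } u\in I\}$, a graded $R$-submodule of $S$; degree zero morphisms preserve the grading inherited from $S$. A graded artin quotient $A=R/I=k\oplus A_1\oplus\dots\oplus A_d$ with $A_d\ne0$, $A_i=0$ for $i>d$, is level if $\mathrm{socle}(A)=\{u\in A: u x_i=0\ \forall i\}$ equals $A_d$; then $d$ is the socle degree and $t=\dim_k A_d$ is the type. Level quotients of type $t$ and socle degree $d$ are in bijection with points of the Grassmannian $G(t,S_d)$ of $t$-dimensional subspaces of $S_d$, via $A=R/I\mapsto \Lambda=(I^{-1})_d$, with inverse $\Lambda\mapsto R/\mathrm{ann}(\Lambda)$, where $\mathrm{ann}(\Lambda)$ is the ideal of all $u\in R$ annihilating $\Lambda$. There is a canonical isomorphism $G(t,S_d)\simeq G(\dim R_d-t,R_d)$ taking $\Lambda$ to $I_d$ (its annihilator in $R_d$). Let $G=G(t,S_d)$ and let $\mathcal B\subseteq S_d\otimes\mathcal O_G$ be the tautological rank $t$ subbundle. The action gives bundle maps $\varphi_i: R_{d-i}\otimes\mathcal B\to S_i\otimes\mathcal O_G$ for $1\le i\le d$. Let $\mathcal L(i,r)\subseteq G$ be the closed subscheme $\{\mathrm{rank}(\varphi_i)\le r\}$ (locally defined by the $(r+1)$-minors of a matrix of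 $\varphi_i$), and $\mathcal L^\circ(i,r)=\mathcal L(i,r)\setminus\mathcal L(i,r-1)$, a locally closed subscheme. For $\underline h=(h_0,h_1,\dots)$ with $h_0=1$, $h_d=t$, $h_i=0$ for $i>d$, define the scheme-theoretic intersection $\mathcal L^\circ(\underline h)=\bigcap_{i=1}^{d-1}\mathcal L^\circ(i,h_i)$. Its closed points are the level quotients $A$ with $\dim_k A_i=h_i$ for all $i$. *)

theory Defs
  imports
    "Jordan_Normal_Form.Determinant"
    "HOL-Library.Poly_Mapping"
begin

section \<open>Polynomials in finitely many variables\<close>

text \<open>
  Polynomials over a commutative ring in variables indexed by a finite type.  The same type is
  used for the ring \<open>R\<close> of operators and for the module \<open>S\<close> on which it acts.
\<close>

type_synonym ('n, 'a) mpol = "('n \<Rightarrow>\<^sub>0 nat) \<Rightarrow>\<^sub>0 'a"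

definition mdeg :: "('n::finite \<Rightarrow>\<^sub>0 nat) \<Rightarrow> nat"
  where "mdeg m = (\<Sum>i\<in>UNIV. Poly_Mapping.lookup m i)"

definition monoms :: "nat \<Rightarrow> ('n::finite \<Rightarrow>\<^sub>0 nat) set"
  where "monoms j = {m. mdeg m = j}"

definition hcomp :: "nat \<Rightarrow> ('n::finite, 'a::comm_ring_1) mpol set"
  where "hcomp j = {F. Poly_Mapping.keys F \<subseteq> monoms j}"

definition const :: "'a::comm_ring_1 \<Rightarrow> ('n::finite, 'a) mpol"
  where "const c = Poly_Mapping.single 0 c"

definition cscale :: "'a::comm_ring_1 \<Rightarrow> ('n::finite, 'a) mpol \<Rightarrow> ('n, 'a) mpol"
  where "cscale c F = const c * F"

definition var :: "'n::finite \<Rightarrow> ('n, 'a::comm_ring_1) mpol"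
  where "var i = Poly_Mapping.single (Poly_Mapping.single i 1) 1"

text \<open>
  The differential operator \<open>u(\<partial>/\<partial>y)\<close> applied to \<open>F\<close>, expanded in monomials:
  \<open>\<partial>\<^sup>a y\<^sup>b = (\<Prod>i. b\<^sub>i (b\<^sub>i - 1) \<dots> (b\<^sub>i - a\<^sub>i + 1)) y\<^bsup>b - a\<^esup>\<close>.  The subtractions are
  truncated, but if \<open>b\<^sub>i < a\<^sub>i\<close> for some \<open>i\<close> then one of the factors is zero.
\<close>

definition act :: "('n::finite, 'a::comm_ring_1) mpol \<Rightarrow> ('n, 'a) mpol \<Rightarrow> ('n, 'a) mpol"
  where "act u F =
    (\<Sum>a\<in>Poly_Mapping.keys u. \<Sum>b\<in>Poly_Mapping.keys F.
      Poly_Mapping.single (b - a)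
        (Poly_Mapping.lookup u a * Poly_Mapping.lookup F b *
         of_nat (\<Prod>i\<in>UNIV. \<Prod>j<Poly_Mapping.lookup a i. Poly_Mapping.lookup b i - j)))"

text \<open>Submodules, spans and independence over the ring of scalars.\<close>

interpretation smod: Modules.module "cscale :: 'a::comm_ring_1 \<Rightarrow> ('n::finite, 'a) mpol \<Rightarrow> _"
proof
  fix a b :: 'a and x y :: "('n, 'a) mpol"
  show "cscale a (x + y) = cscale a x + cscale a y"
    by (simp add: cscale_def distrib_left)
  show "cscale (a + b) x = cscale a x + cscale b x"
    by (simp add: cscale_def const_def single_add distrib_right)
  show "cscale a (cscale b x) = cscale (a * b) x"
    by (simp add: cscale_def const_def mult_single flip: mult.assoc)
  show "cscale 1 x = x"
    by (simp add: cscale_def const_def)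
qed

text \<open>
  The ideal generated by a set: the span in a commutative ring as a module over itself.  An
  interpretation of the locale is avoided here because it would turn associativity of
  multiplication into a simp rule.
\<close>

lemma module_mult: "Modules.module ((*) :: 'a::comm_ring_1 \<Rightarrow> 'a \<Rightarrow> 'a)"
  by standard (simp_all add: distrib_left distrib_right mult.assoc)

abbreviation ideal_span :: "'a::comm_ring_1 set \<Rightarrow> 'a set"
  where "ideal_span \<equiv> Modules.module.span (*)"

section \<open>Modules, quotient modules, homomorphisms\<close>

record ('r, 'm) modl =
  carr :: "'m set"
  padd :: "'m \<Rightarrow> 'm \<Rightarrow> 'm"
  sact :: "'r \<Rightarrow> 'm \<Rightarrow> 'm"

record ('r, 'm) gmodl = "('r, 'm) modl" +
  gr :: "nat \<Rightarrow> 'm set"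

text \<open>
  In what follows \<open>s\<close> is one of the three actions: multiplication (\<open>R\<close> on \<open>R\<close>), \<^const>\<open>act\<close>
  (\<open>R\<close> on \<open>S\<close>) and \<^const>\<open>cscale\<close> (scalars on \<open>R\<close> or \<open>S\<close>).
\<close>

definition submod ::
    "('r \<Rightarrow> ('n::finite, 'a::comm_ring_1) mpol \<Rightarrow> ('n, 'a) mpol) \<Rightarrow> ('n, 'a) mpol set
      \<Rightarrow> ('r, ('n, 'a) mpol) gmodl"
  where "submod s V = \<lparr>carr = V, padd = (+), sact = s, gr = (\<lambda>j. V \<inter> hcomp j)\<rparr>"

definition coset :: "'b::ab_group_add set \<Rightarrow> 'b \<Rightarrow> 'b set"
  where "coset U x = {x + w |w. w \<in> U}"

text \<open>
  The quotient \<open>V/U\<close>: elements are cosets of \<open>U\<close>; the operations are those induced on cosets.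
\<close>

definition quot ::
    "('r \<Rightarrow> ('n::finite, 'a::comm_ring_1) mpol \<Rightarrow> ('n, 'a) mpol) \<Rightarrow> ('n, 'a) mpol set
      \<Rightarrow> ('n, 'a) mpol set \<Rightarrow> ('r, ('n, 'a) mpol set) gmodl"
  where "quot s V U =
    \<lparr>carr = coset U ` V,
     padd = (\<lambda>X Y. {x + y |x y. x \<in> X \<and> y \<in> Y}),
     sact = (\<lambda>c X. \<Union>x\<in>X. coset U (s c x)),
     gr = (\<lambda>j. coset U ` (V \<inter> hcomp j))\<rparr>"

definition mod_hom :: "('r, 'm, 'x) modl_scheme \<Rightarrow> ('r, 'p, 'y) modl_scheme \<Rightarrow> ('m \<Rightarrow> 'p) set"
  where "mod_hom M N =
    {f \<in> carr M \<rightarrow>\<^sub>E carr N.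
      (\<forall>x\<in>carr M. \<forall>y\<in>carr M. f (padd M x y) = padd N (f x) (f y)) \<and>
      (\<forall>c. \<forall>x\<in>carr M. f (sact M c x) = sact N c (f x))}"

definition mod_hom0 :: "('r, 'm, 'x) gmodl_scheme \<Rightarrow> ('r, 'p, 'y) gmodl_scheme \<Rightarrow> ('m \<Rightarrow> 'p) set"
  where "mod_hom0 M N = {f \<in> mod_hom M N. \<forall>j. f ` gr M j \<subseteq> gr N j}"

definition mod_mono :: "('m \<Rightarrow> 'p) \<Rightarrow> ('r, 'm, 'x) modl_scheme \<Rightarrow> ('r, 'p, 'y) modl_scheme \<Rightarrow> bool"
  where "mod_mono f M N \<longleftrightarrow> f \<in> mod_hom M N \<and> inj_on f (carr M)"

definition mod_iso :: "('m \<Rightarrow> 'p) \<Rightarrow> ('r, 'm, 'x) modl_scheme \<Rightarrow> ('r, 'p, 'y) modl_scheme \<Rightarrow> bool"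
  where "mod_iso f M N \<longleftrightarrow> f \<in> mod_hom M N \<and> bij_betw f (carr M) (carr N)"

text \<open>
  The vector spaces \<open>Hom\<^sub>k(M, N)\<close> of linear maps and \<open>Hom\<^sub>R(M, N)\<^sub>0\<close> of graded homomorphisms of
  degree zero, with pointwise operations.
\<close>

definition Homk ::
    "('k, 'm, 'x) modl_scheme \<Rightarrow> ('k, 'p, 'y) modl_scheme \<Rightarrow> ('k, 'm \<Rightarrow> 'p) modl"
  where "Homk M N =
    \<lparr>carr = mod_hom M N,
     padd = (\<lambda>f g. \<lambda>x\<in>carr M. padd N (f x) (g x)),
     sact = (\<lambda>c f. \<lambda>x\<in>carr M. sact N c (f x))\<rparr>"

definition HomR0 ::
    "(('n::finite, 'k::comm_ring_1) mpol, 'm, 'x) gmodl_scheme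
      \<Rightarrow> (('n, 'k) mpol, 'p, 'y) gmodl_scheme \<Rightarrow> ('k, 'm \<Rightarrow> 'p) modl"
  where "HomR0 M N =
    \<lparr>carr = mod_hom0 M N,
     padd = (\<lambda>f g. \<lambda>x\<in>carr M. padd N (f x) (g x)),
     sact = (\<lambda>c f. \<lambda>x\<in>carr M. sact N (const c) (f x))\<rparr>"

text \<open>The dimension of a vector space \<open>M\<close> is the \<open>n\<close> with \<open>k\<^sup>n \<cong> M\<close>.\<close>

definition coord_space :: "nat \<Rightarrow> ('k::comm_ring_1, nat \<Rightarrow> 'k) modl"
  where "coord_space n =
    \<lparr>carr = {..<n} \<rightarrow>\<^sub>E UNIV,
     padd = (\<lambda>x y. \<lambda>i\<in>{..<n}. x i + y i),
     sact = (\<lambda>c x. \<lambda>i\<in>{..<n}. c * x i)\<rparr>"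

definition kdim :: "('k::field, 'm, 'x) modl_scheme \<Rightarrow> nat"
  where "kdim M = (THE n. \<exists>f. mod_iso f (coord_space n) M)"

definition deg_part :: "nat \<Rightarrow> ('r, 'm, 'x) gmodl_scheme \<Rightarrow> ('r, 'm) modl"
  where "deg_part j M = \<lparr>carr = gr M j, padd = padd M, sact = sact M\<rparr>"

section \<open>Level quotients and inverse systems\<close>

definition homogeneous_ideal :: "('n::finite, 'a::comm_ring_1) mpol set \<Rightarrow> bool"
  where "homogeneous_ideal I \<longleftrightarrow> (\<exists>G \<subseteq> (\<Union>j. hcomp j). I = ideal_span G)"

definition ideal_square :: "('n::finite, 'a::comm_ring_1) mpol set \<Rightarrow> ('n, 'a) mpol set"
  where "ideal_square I = ideal_span {u * v |u v. u \<in> I \<and> v \<in> I}"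

definition inverse_system :: "('n::finite, 'a::comm_ring_1) mpol set \<Rightarrow> ('n, 'a) mpol set"
  where "inverse_system I = {F. \<forall>u\<in>I. act u F = 0}"

definition hilbert_fun :: "('n::finite, 'k::field) mpol set \<Rightarrow> nat \<Rightarrow> nat"
  where "hilbert_fun I j = kdim (deg_part j (quot cscale UNIV I))"

text \<open>The zero element of \<open>R/I\<close> is the coset \<open>I\<close>.\<close>

definition socle :: "('n::finite, 'a::comm_ring_1) mpol set \<Rightarrow> ('n, 'a) mpol set set"
  where "socle I =
    {X \<in> carr (quot (*) UNIV I). \<forall>i. sact (quot (*) UNIV I) (var i) X = I}"

definition level_quotient :: "('n::finite, 'k::field) mpol set \<Rightarrow> nat \<Rightarrow> nat \<Rightarrow> bool"
  where "level_quotient I d t \<longleftrightarrow>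
    homogeneous_ideal I \<and>
    gr (quot (*) UNIV I) d \<noteq> {I} \<and>
    (\<forall>j>d. gr (quot (*) UNIV I) j = {I}) \<and>
    socle I = gr (quot (*) UNIV I) d \<and>
    hilbert_fun I d = t"

section \<open>Points of the Grassmannian and of the rank loci\<close>

text \<open>
  The schemes are given by their functors of points.  For a commutative ring \<open>A\<close> (the type
  \<open>'a\<close> of coefficients), an \<open>A\<close>-point of \<open>G(t, S\<^sub>d)\<close> is a rank \<open>t\<close> direct summand of
  \<open>S\<^sub>d \<otimes> A\<close>.  Only local rings \<open>A\<close> will be used (the field \<open>k\<close> and its dual numbers), so that
  every such summand is free.
\<close>

definition is_basis :: "nat \<Rightarrow> ('n::finite, 'a::comm_ring_1) mpol set \<Rightarrow> ('n, 'a) mpol set \<Rightarrow> bool"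
  where "is_basis t B M \<longleftrightarrow> finite B \<and> card B = t \<and> smod.independent B \<and> smod.span B = M"

definition grass :: "nat \<Rightarrow> nat \<Rightarrow> ('n::finite, 'a::comm_ring_1) mpol set set"
  where "grass d t =
    {M. (\<exists>B. is_basis t B M) \<and>
        (\<exists>N. smod.subspace N \<and> M \<inter> N = {0} \<and> {x + y |x y. x \<in> M \<and> y \<in> N} = hcomp d)}"

text \<open>
  The \<open>r\<close>-minors of the matrix of \<open>\<phi>\<^sub>i : R\<^bsub>d-i\<^esub> \<otimes> M \<rightarrow> S\<^sub>i \<otimes> A\<close> with respect to the monomial
  bases of \<open>R\<^bsub>d-i\<^esub>\<close> and \<open>S\<^sub>i\<close> and the basis \<open>B\<close> of \<open>M\<close>.  The ideal they generate does
  not depend on \<open>B\<close>.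
\<close>

definition minors :: "nat \<Rightarrow> nat \<Rightarrow> nat \<Rightarrow> ('n::finite, 'a::comm_ring_1) mpol set \<Rightarrow> 'a set"
  where "minors d i r B =
    {det (mat r r (\<lambda>(p, q).
        Poly_Mapping.lookup (act (Poly_Mapping.single (fst (cols q)) 1) (snd (cols q))) (rows p)))
     |rows cols.
        inj_on rows {..<r} \<and> rows ` {..<r} \<subseteq> monoms i \<and>
        inj_on cols {..<r} \<and> cols ` {..<r} \<subseteq> monoms (d - i) \<times> B}"

definition rank_locus :: "nat \<Rightarrow> nat \<Rightarrow> nat \<Rightarrow> nat \<Rightarrow> ('n::finite, 'a::comm_ring_1) mpol set set"
  where "rank_locus d t i r =
    {M \<in> grass d t. \<exists>B. is_basis t B M \<and> minors d i (r + 1) B \<subseteq> {0}}"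

text \<open>
  An \<open>A\<close>-point factors through the open complement of the locus \<open>rank \<le> r - 1\<close> iff the
  equations of that locus, the \<open>r\<close>-minors, generate the unit ideal of \<open>A\<close>.  (For \<open>r = 0\<close> the
  only minor is \<open>1\<close>, in accordance with \<open>rank \<le> -1\<close> being empty.)
\<close>

definition rank_stratum :: "nat \<Rightarrow> nat \<Rightarrow> nat \<Rightarrow> nat \<Rightarrow> ('n::finite, 'a::comm_ring_1) mpol set set"
  where "rank_stratum d t i r =
    {M \<in> rank_locus d t i r. \<exists>B. is_basis t B M \<and> 1 \<in> ideal_span (minors d i r B)}"

definition level_stratum ::
    "nat \<Rightarrow> nat \<Rightarrow> (nat \<Rightarrow> nat) \<Rightarrow> ('n::finite, 'a::comm_ring_1) mpol set set"
  where "level_stratum d t h = {M \<in> grass d t. \<forall>i\<in>{1..<d}. M \<in> rank_stratum d t i (h i)}"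

text \<open>
  The canonical isomorphism \<open>G(t, S\<^sub>d) \<simeq> G(dim R\<^sub>d - t, R\<^sub>d)\<close> on points.
\<close>

definition perp :: "nat \<Rightarrow> ('n::finite, 'a::comm_ring_1) mpol set \<Rightarrow> ('n, 'a) mpol set"
  where "perp d M = {u \<in> hcomp d. \<forall>F\<in>M. act u F = 0}"

section \<open>Dual numbers and tangent spaces\<close>

text \<open>\<open>Dual a b\<close> is \<open>a + b \<epsilon>\<close> with \<open>\<epsilon>\<^sup>2 = 0\<close>.\<close>

datatype 'a dual = Dual (dre: 'a) (deps: 'a)

instantiation dual :: (comm_ring_1) comm_ring_1
begin

definition "0 = Dual 0 0"
definition "1 = Dual 1 0"
definition "x + y = Dual (dre x + dre y) (deps x + deps y)"
definition "x - y = Dual (dre x - dre y) (deps x - deps y)"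
definition "- x = Dual (- dre x) (- deps x)"
definition "x * y = Dual (dre x * dre y) (dre x * deps y + deps x * dre y)"

instance
proof
  fix a b c :: "'a dual"
  show "a * b * c = a * (b * c)"
    by (simp add: times_dual_def distrib_left distrib_right mult.assoc add.assoc)
  show "a * b = b * a"
    by (simp add: times_dual_def mult.commute add.commute)
  show "1 * a = a"
    by (simp add: times_dual_def one_dual_def)
  show "(a + b) * c = a * c + b * c"
    by (simp add: times_dual_def plus_dual_def distrib_right distrib_left add_ac)
  show "a + b + c = a + (b + c)"
    by (simp add: plus_dual_def add.assoc)
  show "a + b = b + a"
    by (simp add: plus_dual_def add.commute)
  show "0 + a = a"
    by (simp add: plus_dual_def zero_dual_def)
  show "- a + a = 0"
    by (simp add: plus_dual_def uminus_dual_def zero_dual_def)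
  show "a - b = a + - b"
    by (simp add: plus_dual_def uminus_dual_def minus_dual_def)
  show "(0 :: 'a dual) \<noteq> 1"
    by (simp add: zero_dual_def one_dual_def)
qed

end

definition re_part :: "('n::finite, 'k::comm_ring_1 dual) mpol \<Rightarrow> ('n, 'k) mpol"
  where "re_part P = Poly_Mapping.map dre P"

definition eps_part :: "('n::finite, 'k::comm_ring_1 dual) mpol \<Rightarrow> ('n, 'k) mpol"
  where "eps_part P = Poly_Mapping.map deps P"

text \<open>
  Tangent vectors at \<open>V\<close> of a subscheme of the Grassmannian: the points over the dual numbers
  that reduce to \<open>V\<close> modulo \<open>\<epsilon>\<close>.
\<close>

definition tangent_vectors ::
    "('n::finite, 'k::comm_ring_1 dual) mpol set set \<Rightarrow> ('n, 'k) mpol set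
      \<Rightarrow> ('n, 'k dual) mpol set set"
  where "tangent_vectors X V = {M \<in> X. re_part ` M = V}"

text \<open>
  The canonical identification of \<open>Hom\<^sub>k(V, S\<^sub>d/V)\<close> with the tangent space of the Grassmannian
  at \<open>V\<close>: it sends \<open>\<phi>\<close> to \<open>{F + \<epsilon> G | F \<in> V, G mod V = \<phi>(F)}\<close>; recall that \<open>\<phi>(F)\<close> is a
  coset of \<open>V\<close>.
\<close>

definition tangent_graph ::
    "('n::finite, 'k::comm_ring_1) mpol set \<Rightarrow> (('n, 'k) mpol \<Rightarrow> ('n, 'k) mpol set)
      \<Rightarrow> ('n, 'k dual) mpol set"
  where "tangent_graph V \<phi> = {P. re_part P \<in> V \<and> eps_part P \<in> \<phi> (re_part P)}"

definition grass_tangent ::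
    "nat \<Rightarrow> ('n::finite, 'k::comm_ring_1) mpol set
      \<Rightarrow> ('k, ('n, 'k) mpol \<Rightarrow> ('n, 'k) mpol set) modl"
  where "grass_tangent d V = Homk (submod cscale V) (quot cscale (hcomp d) V)"

text \<open>
  The tangent space at \<open>V\<close> of a subscheme \<open>X\<close> of the Grassmannian, as a subspace of
  \<open>Hom\<^sub>k(V, S\<^sub>d/V)\<close>.
\<close>

definition tangent_space ::
    "nat \<Rightarrow> ('n::finite, 'k::comm_ring_1 dual) mpol set set \<Rightarrow> ('n, 'k) mpol set
      \<Rightarrow> ('k, ('n, 'k) mpol \<Rightarrow> ('n, 'k) mpol set) modl"
  where "tangent_space d X V =
    (grass_tangent d V)
      \<lparr>carr := {\<phi> \<in> carr (grass_tangent d V). tangent_graph V \<phi> \<in> tangent_vectors X V}\<rparr>"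

section \<open>The graded homomorphism spaces and the canonical maps\<close>

text \<open>
  \<open>Hom\<^sub>R(I, R/I)\<^sub>0\<close>, \<open>Hom\<^sub>R(I/J, R/I)\<^sub>0\<close>, \<open>Hom\<^sub>R(V, S/V)\<^sub>0\<close> and
  \<open>Hom\<^sub>R(V, W/V)\<^sub>0\<close>, for ideals \<open>I, J\<close> of \<open>R\<close> and \<open>R\<close>-submodules \<open>V, W\<close> of \<open>S\<close>.
\<close>

definition hom_ideal ::
    "('n::finite, 'k::comm_ring_1) mpol set
      \<Rightarrow> ('k, ('n, 'k) mpol \<Rightarrow> ('n, 'k) mpol set) modl"
  where "hom_ideal I = HomR0 (submod (*) I) (quot (*) UNIV I)"

definition hom_conormal ::
    "('n::finite, 'k::comm_ring_1) mpol set \<Rightarrow> ('n, 'k) mpol set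
      \<Rightarrow> ('k, ('n, 'k) mpol set \<Rightarrow> ('n, 'k) mpol set) modl"
  where "hom_conormal I J = HomR0 (quot (*) I J) (quot (*) UNIV I)"

definition hom_inv ::
    "('n::finite, 'k::comm_ring_1) mpol set
      \<Rightarrow> ('k, ('n, 'k) mpol \<Rightarrow> ('n, 'k) mpol set) modl"
  where "hom_inv V = HomR0 (submod act V) (quot act UNIV V)"

definition hom_inv_sub ::
    "('n::finite, 'k::comm_ring_1) mpol set \<Rightarrow> ('n, 'k) mpol set
      \<Rightarrow> ('k, ('n, 'k) mpol \<Rightarrow> ('n, 'k) mpol set) modl"
  where "hom_inv_sub V W = HomR0 (submod act V) (quot act W V)"

text \<open>
  Restriction of \<open>f : V \<rightarrow> W/U\<close> (ranging over \<open>H\<close>) to degree \<open>d\<close>.  For \<open>F\<close> homogeneous of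
  degree \<open>d\<close>, the coset \<open>F + U\<close> in \<open>(W/U)\<^sub>d\<close> is identified with the coset \<open>F + U\<^sub>d\<close>, which is
  the degree \<open>d\<close> part of the set \<open>F + U\<close>.
\<close>

definition restr_deg ::
    "nat \<Rightarrow> ('n::finite, 'a::comm_ring_1) mpol set
      \<Rightarrow> (('n, 'a) mpol \<Rightarrow> ('n, 'a) mpol set) set
      \<Rightarrow> (('n, 'a) mpol \<Rightarrow> ('n, 'a) mpol set) \<Rightarrow> (('n, 'a) mpol \<Rightarrow> ('n, 'a) mpol set)"
  where "restr_deg d V H = (\<lambda>f\<in>H. \<lambda>v\<in>V \<inter> hcomp d. f v \<inter> hcomp d)"

text \<open>Composition with the projection \<open>V \<rightarrow> V/U\<close> of maps \<open>f\<close> (ranging over \<open>H\<close>) on \<open>V/U\<close>.\<close>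

definition pull_quot ::
    "'b::ab_group_add set \<Rightarrow> 'b set \<Rightarrow> ('b set \<Rightarrow> 'c) set \<Rightarrow> ('b set \<Rightarrow> 'c) \<Rightarrow> ('b \<Rightarrow> 'c)"
  where "pull_quot V U H = (\<lambda>f\<in>H. \<lambda>v\<in>V. f (coset U v))"

end

(*
  Write V for the inverse system of I and L for its degree d part.  Since A is level, V is generated
  by L, and dually u in I_j as soon as R_{d-j} u is contained in I_d; hence homomorphisms out of V and
  out of I are determined in degree d.

  For (A), let M be the deformation of L over the dual numbers given by p : L -> S_d / L.  Given a
  matrix over the dual numbers whose reduction has rank r, all its (r+1)-minors vanish iff every
  combination of its columns that vanishes modulo epsilon has its epsilon-part in the image of the
  reduction.  For the matrix of phi_i this says: if sum u_b F_b = 0 with u_b in R_{d-i} and F_b in L,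
  then sum u_b p(F_b) lies in V_i.  For all i together, this is exactly the condition that p extends
  to an R-linear map V -> S/V.

  For (B), the pairing <u, F> = (u.F)(0) makes V and I annihilators of each other, and
  <g(u), F> = - <u, f(F)> turns graded homomorphisms f : V -> S/V into graded homomorphisms
  g : I -> R/I and back; on the level of dual numbers this is the passage from M to its annihilator.
*)
theory Submission
  imports Defs
begin

text \<open>The polynomial ring is infinite dimensional, so a linear functional on it need not be
  the pairing with a polynomial. Distinct degrees are orthogonal, however, and in each degree the
  pairing is perfect (x^a and y^a pair to a!, invertible in characteristic zero); so functionals are
  represented one degree at a time and transposes are assembled from homogeneous pieces. The sign in
  the transpose is forced by the dual numbers: <u + eps w, F + eps G> has eps-part <u, G> + <w, F>,
  which has to vanish. The stratum imposes conditions for 0 < i < d only, whereas an extension of p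
  is needed in all degrees; degree d holds because M is a graph over L, degree 0 because every
  constant lies in V. The extension is not defined by formulas on generators: the submodule
  generated by M over the dual numbers is read as a graph, and the rank conditions say that this
  graph is single-valued modulo V. Values in a quotient are sets, so homomorphisms are handled
  through membership of representatives.\<close>

abbreviation "lookup \<equiv> Poly_Mapping.lookup"
abbreviation "single \<equiv> Poly_Mapping.single"
abbreviation "keys \<equiv> Poly_Mapping.keys"

section \<open>Coefficients, graded pieces and the differentiation action\<close>

lemma lookup_const_mult: "lookup (const c * F) m = c * lookup F m"
proof -
  have "Poly_Mapping.map ((*) c) F = const c * F"
    unfolding const_def by (rule mult_map_scale_conv_mult)
  then show ?thesis
    by (auto simp: map.rep_eq when_def simp flip: \<open>Poly_Mapping.map ((*) c) F = const c * F\<close>)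
qed

lemma lookup_cscale [simp]: "lookup (cscale c F) m = c * lookup F m"
  by (simp add: cscale_def lookup_const_mult)

lemma cscale_minus_one: "cscale (- 1) F = - F"
  by (rule poly_mapping_eqI) simp

lemma mdeg_add [simp]: "mdeg (a + b) = mdeg a + mdeg b"
  by (simp add: mdeg_def lookup_add sum.distrib)

lemma mdeg_eq_0_iff [simp]: "mdeg m = 0 \<longleftrightarrow> m = 0"
  by (auto simp: mdeg_def poly_mapping_eq_iff fun_eq_iff)

lemma mdeg_single [simp]: "mdeg (single i n) = n"
  by (simp add: mdeg_def lookup_single when_def)

lemma finite_monoms [simp]: "finite (monoms j :: ('n::finite \<Rightarrow>\<^sub>0 nat) set)"
proof -
  have "lookup ` monoms j \<subseteq> ((UNIV :: 'n set) \<rightarrow>\<^sub>E {..j})"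
    by (auto simp: monoms_def mdeg_def intro: member_le_sum)
  moreover have "finite ((UNIV :: 'n set) \<rightarrow>\<^sub>E {..j})"
    by (intro finite_PiE) auto
  ultimately have "finite (lookup ` (monoms j :: ('n \<Rightarrow>\<^sub>0 nat) set))"
    by (rule finite_subset)
  then show ?thesis
    by (rule finite_imageD) (simp add: inj_on_def poly_mapping.lookup_inject)
qed

lemma hcomp_iff:
  "F \<in> hcomp j \<longleftrightarrow> (\<forall>m. mdeg m \<noteq> j \<longrightarrow> lookup F m = 0)"
  by (auto simp: hcomp_def monoms_def in_keys_iff)

lemma subspace_hcomp: "smod.subspace (hcomp j)"
  by (auto simp: smod.subspace_def hcomp_iff lookup_add)

lemma zero_hcomp [simp]: "0 \<in> hcomp j"
  by (simp add: hcomp_iff)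

lemma hcomp_add: "F \<in> hcomp j \<Longrightarrow> G \<in> hcomp j \<Longrightarrow> F + G \<in> hcomp j"
  by (simp add: hcomp_iff lookup_add)

lemma hcomp_diff: "F \<in> hcomp j \<Longrightarrow> G \<in> hcomp j \<Longrightarrow> F - G \<in> hcomp j"
  by (simp add: hcomp_iff lookup_minus)

lemma hcomp_cscale: "F \<in> hcomp j \<Longrightarrow> cscale c F \<in> hcomp j"
  by (simp add: hcomp_iff)

lemma hcomp_sum:
  "(\<And>x. x \<in> X \<Longrightarrow> f x \<in> hcomp j) \<Longrightarrow> sum f X \<in> hcomp j"
  by (simp add: hcomp_iff lookup_sum)

lemma single_hcomp: "mdeg m = j \<Longrightarrow> single m c \<in> hcomp j"
  by (auto simp: hcomp_iff lookup_single when_def)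

lemma poly_sum_monoms:
  assumes "finite K" "keys F \<subseteq> K"
  shows "F = (\<Sum>m\<in>K. single m (lookup F m))"
proof (rule poly_mapping_eqI)
  fix m
  have "(\<Sum>x\<in>K. lookup F x when x = m) = lookup F m"
    using assms by (auto simp: when_def sum.delta in_keys_iff)
  then show "lookup F m
      = lookup (\<Sum>m\<in>K. single m (lookup F m)) m"
    by (simp add: lookup_sum lookup_single)
qed

lemma hcomp_sum_monoms:
  "F \<in> hcomp j \<Longrightarrow> F = (\<Sum>m\<in>monoms j. single m (lookup F m))"
  by (rule poly_sum_monoms) (auto simp: hcomp_def)

lemma single_eq_cscale: "single m c = cscale c (single m 1)"
  by (rule poly_mapping_eqI) (simp add: lookup_single when_def)

lemma mult_hcomp:
  assumes "u \<in> hcomp i" "v \<in> hcomp j"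
  shows "u * v \<in> hcomp (i + j)"
proof -
  have "keys (u * v) \<subseteq> {a + b |a b. a \<in> keys u \<and> b \<in> keys v}"
    by (rule keys_mult)
  with assms show ?thesis
    by (fastforce simp: hcomp_def monoms_def)
qed

section \<open>Homogeneous components\<close>

definition hpart :: "nat \<Rightarrow> ('n::finite, 'a::comm_ring_1) mpol \<Rightarrow> ('n, 'a) mpol"
  where "hpart j F = (\<Sum>m\<in>keys F \<inter> monoms j. single m (lookup F m))"

lemma lookup_hpart: "lookup (hpart j F) m = (if mdeg m = j then lookup F m else 0)"
proof -
  have "(\<Sum>x\<in>keys F \<inter> monoms j. lookup F x when x = m)
      = (if mdeg m = j then lookup F m else 0)"
    by (auto simp: when_def sum.delta in_keys_iff monoms_def)
  then show ?thesis
    by (simp add: hpart_def lookup_sum lookup_single)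
qed

lemma hpart_hcomp [simp]: "hpart j F \<in> hcomp j"
  by (simp add: hcomp_iff lookup_hpart)

lemma hpart_of_hcomp: "F \<in> hcomp i \<Longrightarrow> hpart j F = (if i = j then F else 0)"
  by (rule poly_mapping_eqI) (auto simp: lookup_hpart hcomp_iff)

lemma hpart_add: "hpart j (F + G) = hpart j F + hpart j G"
  by (rule poly_mapping_eqI) (simp add: lookup_hpart lookup_add)

lemma hpart_diff: "hpart j (F - G) = hpart j F - hpart j G"
  by (rule poly_mapping_eqI) (simp add: lookup_hpart lookup_minus)

lemma hpart_zero [simp]: "hpart j 0 = 0"
  by (rule poly_mapping_eqI) (simp add: lookup_hpart)

lemma hpart_sum: "hpart j (sum f X) = (\<Sum>x\<in>X. hpart j (f x))"
  by (rule poly_mapping_eqI) (simp add: lookup_hpart lookup_sum)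

lemma sum_hpart:
  assumes "\<And>m. m \<in> keys F \<Longrightarrow> mdeg m \<le> N"
  shows "(\<Sum>j\<le>N. hpart j F) = F"
proof (rule poly_mapping_eqI)
  fix m
  have "(\<Sum>j\<le>N. if mdeg m = j then lookup F m else 0) = lookup F m"
    using assms by (auto simp: in_keys_iff)
  then show "lookup (\<Sum>j\<le>N. hpart j F) m = lookup F m"
    by (simp add: lookup_sum lookup_hpart)
qed

lemma degree_bound:
  obtains N where "\<And>m. m \<in> keys F \<Longrightarrow> mdeg m \<le> N"
  by (metis finite_keys finite_imageI imageI Max_ge)

lemma decompose_hparts:
  obtains N where "(\<Sum>j\<le>N. hpart j F) = F" and "\<And>j. j > N \<Longrightarrow> hpart j F = 0"
proof -
  obtain N where N: "\<And>m. m \<in> keys F \<Longrightarrow> mdeg m \<le> N"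
    using degree_bound by blast
  have "hpart j F = 0" if "j > N" for j
    using N that by (intro poly_mapping_eqI) (force simp: lookup_hpart in_keys_iff)
  with that sum_hpart[OF N] show thesis
    by blast
qed

text \<open>The coefficient of \<open>y\<^bsup>b - a\<^esup>\<close> in \<open>\<partial>\<^sup>a y\<^sup>b\<close>; it vanishes unless \<open>a \<le> b\<close>.\<close>

definition dcoeff :: "('n::finite \<Rightarrow>\<^sub>0 nat) \<Rightarrow> ('n \<Rightarrow>\<^sub>0 nat) \<Rightarrow> nat"
  where "dcoeff a b = (\<Prod>i\<in>UNIV. \<Prod>j<lookup a i. lookup b i - j)"

text \<open>If \<open>a\<close> exceeds \<open>b\<close> in some variable, one of the factors is
  zero. Hence the truncated subtraction \<open>b - a\<close> in \<open>act\<close> is a genuine one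
  wherever the coefficient survives.\<close>

lemma dcoeff_nonzero_imp: "dcoeff a b \<noteq> 0 \<Longrightarrow> (b - a) + a = b"
proof (rule poly_mapping_eqI)
  fix i
  assume "dcoeff a b \<noteq> 0"
  then have "\<forall>j<lookup a i. lookup b i - j \<noteq> 0"
    by (simp add: dcoeff_def)
  then have "lookup a i \<le> lookup b i"
    by (metis diff_self_eq_0 linorder_not_less)
  then show "lookup ((b - a) + a) i = lookup b i"
    by (simp add: lookup_add lookup_minus)
qed

lemma dcoeff_add_self_nonzero: "dcoeff a (m + a) \<noteq> 0"
  by (simp add: dcoeff_def lookup_add)

text \<open>The falling factorial (r+p+q) ... (r+1) splits into its q largest and its p smallest
  factors. This is the coefficient form of composing derivatives, on which \<open>act_mult\<close>
  rests.\<close>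

lemma dcoeff_add: "dcoeff (a + b) (m + (a + b)) = dcoeff a (m + a) * dcoeff b (m + (a + b))"
proof -
  have "(\<Prod>j<p + q. (r + (p + q)) - j) = (\<Prod>j<p. (r + p) - j) * (\<Prod>j<q. (r + (p + q)) - j)" for p q r :: nat
  proof -
    have split: "(\<Prod>j<q + p. N - j) = (\<Prod>j<q. N - j) * (\<Prod>j<p. (N - q) - j)" for N
      by (induction p) (simp_all add: mult.assoc)
    show ?thesis
      using split[of "r + (p + q)"] by (simp add: add.commute[of q p] mult.commute add.assoc[symmetric])
  qed
  then show ?thesis
    by (simp add: dcoeff_def lookup_add prod.distrib)
qed

text \<open>For each \<open>a\<close> only the exponent \<open>b = m + a\<close> contributes to the
  coefficient of \<open>m\<close>. The index set \<open>K\<close> is left free so that operators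
  with different supports can be compared over a common set.\<close>

lemma lookup_act:
  assumes "finite K" "keys u \<subseteq> K"
  shows "lookup (act u F) m =
    (\<Sum>a\<in>K. lookup u a * lookup F (m + a) * of_nat (dcoeff a (m + a)))"
proof -
  have inner: "(\<Sum>b\<in>keys F.
      (lookup u a * lookup F b * of_nat (dcoeff a b) when b - a = m))
      = lookup u a * lookup F (m + a) * of_nat (dcoeff a (m + a))" for a
  proof -
    have "(lookup u a * lookup F b * of_nat (dcoeff a b) when b - a = m)
        = (if b = m + a then lookup u a * lookup F (m + a) * of_nat (dcoeff a (m + a)) else 0)"
      for b
      using dcoeff_nonzero_imp[of a b] by (cases "dcoeff a b = 0") (auto simp: when_def)
    then show ?thesis
      by (auto simp: sum.delta in_keys_iff)
  qed
  have "lookup (act u F) m =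
    (\<Sum>a\<in>keys u. \<Sum>b\<in>keys F.
      (lookup u a * lookup F b * of_nat (dcoeff a b) when b - a = m))"
    by (simp only: act_def dcoeff_def[symmetric] lookup_sum lookup_single)
  also have "\<dots> = (\<Sum>a\<in>keys u. lookup u a * lookup F (m + a) * of_nat (dcoeff a (m + a)))"
    by (simp add: inner)
  also have "\<dots> = (\<Sum>a\<in>K. lookup u a * lookup F (m + a) * of_nat (dcoeff a (m + a)))"
    using assms by (intro sum.mono_neutral_left) (auto simp: in_keys_iff)
  finally show ?thesis .
qed

lemma act_add_right: "act u (F + G) = act u F + act u G"
  by (rule poly_mapping_eqI)
    (simp add: lookup_act[OF finite_keys subset_refl] lookup_add distrib_left distrib_right sum.distrib)

lemma act_add_left: "act (u + v) F = act u F + act v F"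
proof (rule poly_mapping_eqI)
  fix m
  let ?K = "keys u \<union> keys v"
  have "finite ?K" "keys (u + v) \<subseteq> ?K" "keys u \<subseteq> ?K" "keys v \<subseteq> ?K"
    using keys_add[of u v] by auto
  then show "lookup (act (u + v) F) m = lookup (act u F + act v F) m"
    by (simp add: lookup_act[of ?K] lookup_add distrib_right sum.distrib)
qed

lemma act_zero_right [simp]: "act u 0 = 0"
  by (simp add: act_def)

lemma act_zero_left [simp]: "act 0 F = 0"
  by (simp add: act_def)

lemma act_cscale_right: "act u (cscale c F) = cscale c (act u F)"
  by (rule poly_mapping_eqI)
    (simp add: lookup_act[OF finite_keys subset_refl] sum_distrib_left mult_ac)

lemma act_cscale_left: "act (cscale c u) F = cscale c (act u F)"
proof (rule poly_mapping_eqI)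
  fix m
  have "keys (cscale c u) \<subseteq> keys u"
    by (auto simp: in_keys_iff)
  then show "lookup (act (cscale c u) F) m = lookup (cscale c (act u F)) m"
    by (simp add: lookup_act[of "keys u"] sum_distrib_left mult.assoc)
qed

lemma act_uminus_right: "act u (- F) = - act u F"
  by (metis act_cscale_right cscale_minus_one)

lemma act_uminus_left: "act (- u) F = - act u F"
  by (metis act_cscale_left cscale_minus_one)

lemma act_diff_right: "act u (F - G) = act u F - act u G"
  using act_add_right[of u F "- G"] by (simp add: act_uminus_right)

lemma act_diff_left: "act (u - v) F = act u F - act v F"
  using act_add_left[of u "- v" F] by (simp add: act_uminus_left)

lemma act_sum_right: "act u (sum f X) = (\<Sum>x\<in>X. act u (f x))"
  by (induction X rule: infinite_finite_induct) (simp_all add: act_add_right)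

lemma act_sum_left: "act (sum f X) F = (\<Sum>x\<in>X. act (f x) F)"
  by (induction X rule: infinite_finite_induct) (simp_all add: act_add_left)

lemma lookup_act_single:
  "lookup (act (single a c) F) m
    = c * lookup F (m + a) * of_nat (dcoeff a (m + a))"
  by (subst lookup_act[of "{a}"]) simp_all

lemma act_const: "act (const c) F = cscale c F"
  by (rule poly_mapping_eqI) (simp add: const_def lookup_act_single dcoeff_def)

lemma act_single_mult:
  "act (single a c * single b e) F
    = act (single a c) (act (single b e) F)"
  by (rule poly_mapping_eqI)
    (simp add: mult_single lookup_act_single dcoeff_add ac_simps)

lemma act_mult: "act (u * v) F = act u (act v F)"
proof -
  let ?s = "\<lambda>u. \<lambda>a. single a (lookup u a)"
  have u: "u = sum (?s u) (keys u)" and v: "v = sum (?s v) (keys v)"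
    by (rule poly_sum_monoms; simp)+
  have "act (sum (?s u) (keys u) * sum (?s v) (keys v)) F
      = act (sum (?s u) (keys u)) (act (sum (?s v) (keys v)) F)"
    by (simp add: sum_product act_sum_left act_sum_right act_single_mult)
      (rule sum.swap)
  then show ?thesis
    by (simp flip: u v)
qed

text \<open>The second claim is separate because \<open>j - i\<close> is truncated: for
  \<open>i > j\<close> the first one would only put the result among the constants.\<close>

lemma act_hcomp:
  assumes "u \<in> hcomp i" "F \<in> hcomp j"
  shows "act u F \<in> hcomp (j - i)" and "i > j \<Longrightarrow> act u F = 0"
proof -
  have nz: "\<exists>a. mdeg a = i \<and> mdeg (m + a) = j" if "lookup (act u F) m \<noteq> 0" for m
  proof -
    from that obtain a where "lookup u a * lookup F (m + a) * of_nat (dcoeff a (m + a)) \<noteq> 0"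
      by (metis (no_types, lifting) lookup_act[OF finite_keys subset_refl] sum.neutral)
    then have "lookup u a \<noteq> 0" "lookup F (m + a) \<noteq> 0"
      by auto
    with assms have "mdeg a = i \<and> mdeg (m + a) = j"
      unfolding hcomp_iff by blast
    then show ?thesis ..
  qed
  show "act u F \<in> hcomp (j - i)"
    using nz by (fastforce simp: hcomp_iff)
  show "act u F = 0" if "i > j"
    using nz that by (intro poly_mapping_eqI) fastforce
qed

section \<open>The apolarity pairing\<close>

text \<open>Monomials are orthogonal for this form, and x^a pairs with y^a to a!.\<close>

definition pair :: "('n::finite, 'a::comm_ring_1) mpol \<Rightarrow> ('n, 'a) mpol \<Rightarrow> 'a"
  where "pair u F = lookup (act u F) 0"

lemma pair_altdef:
  assumes "finite K" "keys u \<subseteq> K"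
  shows "pair u F = (\<Sum>a\<in>K. lookup u a * lookup F a * of_nat (dcoeff a a))"
  using assms by (simp add: pair_def lookup_act)

text \<open>In coordinates the form is the sum of u_a F_a a!, and operators and polynomials share
  one type. The symmetry later lets the ideal and its inverse system exchange roles.\<close>

lemma pair_commute: "pair u F = pair F u"
  by (simp add: pair_altdef[of "keys u \<union> keys F"] mult_ac)

lemma pair_mult: "pair (u * v) F = pair u (act v F)"
  by (simp add: pair_def act_mult)

lemma pair_add_left: "pair (u + v) F = pair u F + pair v F"
  by (simp add: pair_def act_add_left lookup_add)

lemma pair_add_right: "pair u (F + G) = pair u F + pair u G"
  by (simp add: pair_def act_add_right lookup_add)

lemma pair_diff_left: "pair (u - v) F = pair u F - pair v F"
  by (simp add: pair_def act_diff_left lookup_minus)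

lemma pair_diff_right: "pair u (F - G) = pair u F - pair u G"
  by (simp add: pair_def act_diff_right lookup_minus)

lemma pair_uminus_left: "pair (- u) F = - pair u F"
  by (simp add: pair_def act_uminus_left)

lemma pair_cscale_left: "pair (cscale c u) F = c * pair u F"
  by (simp add: pair_def act_cscale_left)

lemma pair_cscale_right: "pair u (cscale c F) = c * pair u F"
  by (simp add: pair_def act_cscale_right)

lemma pair_zero_left [simp]: "pair 0 F = 0"
  by (simp add: pair_def)

lemma pair_zero_right [simp]: "pair u 0 = 0"
  by (simp add: pair_def)

lemma pair_sum_left: "pair (sum f X) F = (\<Sum>x\<in>X. pair (f x) F)"
  by (simp add: pair_def act_sum_left lookup_sum)

lemma pair_sum_right: "pair u (sum f X) = (\<Sum>x\<in>X. pair u (f x))"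
  by (simp add: pair_def act_sum_right lookup_sum)

lemma pair_hcomp_neq:
  assumes "u \<in> hcomp i" "F \<in> hcomp j" "i \<noteq> j"
  shows "pair u F = 0"
proof -
  have "lookup u a * lookup F a = 0" for a
    using assms by (cases "mdeg a = i") (auto simp: hcomp_iff)
  then show ?thesis
    by (simp add: pair_altdef[OF finite_keys subset_refl])
qed

lemma pair_hpart_left:
  assumes "F \<in> hcomp j"
  shows "pair (hpart j u) F = pair u F"
proof -
  have "lookup (u - hpart j u) a * lookup F a = 0" for a
    using assms by (cases "mdeg a = j") (auto simp: hcomp_iff lookup_minus lookup_hpart)
  then have "pair (u - hpart j u) F = 0"
    by (simp add: pair_altdef[OF finite_keys subset_refl])
  then show ?thesis
    by (simp add: pair_diff_left)
qed

lemma pair_hpart_right: "u \<in> hcomp j \<Longrightarrow> pair u (hpart j F) = pair u F"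
  by (metis pair_commute pair_hpart_left)

lemma pair_single_left:
  "pair (single a c) F = c * lookup F a * of_nat (dcoeff a a)"
  by (simp add: pair_def lookup_act_single)

lemma dcoeff_self_nonzero: "dcoeff a a \<noteq> 0"
  using dcoeff_add_self_nonzero[of a 0] by simp

text \<open>Testing against x^m returns m! times the coefficient of \<open>F\<close>, and m! is
  invertible in characteristic zero.\<close>

lemma pair_nondegenerate:
  fixes F :: "('n::finite, 'k::field_char_0) mpol"
  assumes "\<And>m. pair (single m 1) F = 0"
  shows "F = 0"
  using assms by (intro poly_mapping_eqI) (simp add: pair_single_left dcoeff_self_nonzero)

lemma act_hcomp_same:
  assumes "u \<in> hcomp j" "F \<in> hcomp j"
  shows "act u F = const (pair u F)"
proof -
  have "act u F \<in> hcomp 0"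
    using act_hcomp(1)[OF assms] by simp
  then show ?thesis
    by (intro poly_mapping_eqI) (auto simp: hcomp_iff const_def pair_def lookup_single when_def)
qed

section \<open>Linear algebra over a field\<close>

interpretation kvec: vector_space "cscale :: 'k::field \<Rightarrow> ('n::finite, 'k) mpol \<Rightarrow> _"
  by (rule Vector_Spaces.module_iff_vector_space[THEN iffD1, OF smod.module_axioms])

lemma functional_pair:
  "vector_space_pair (cscale :: 'k::field \<Rightarrow> ('n::finite, 'k) mpol \<Rightarrow> _) ((*) :: 'k \<Rightarrow> 'k \<Rightarrow> 'k)"
  by (simp add: vector_space_pair_def module_mult smod.module_axioms flip: Vector_Spaces.module_iff_vector_space)

abbreviation "lincomb n x b \<equiv> \<Sum>i<n. cscale (x i) (b i)"

section \<open>Linear functionals: extension, separation, representation by the pairing\<close>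

abbreviation functional :: "(('n::finite, 'k::field) mpol \<Rightarrow> 'k) \<Rightarrow> bool"
  where "functional g \<equiv> Vector_Spaces.linear cscale (*) g"

lemma functional_add: "functional g \<Longrightarrow> g (x + y) = g x + g y"
  by (simp add: Vector_Spaces.linear_iff)

lemma functional_cscale: "functional g \<Longrightarrow> g (cscale c x) = c * g x"
  by (simp add: Vector_Spaces.linear_iff)

lemma functional_sum: "functional g \<Longrightarrow> g (sum f X) = (\<Sum>x\<in>X. g (f x))"
  by (rule vector_space_pair.linear_sum[OF functional_pair])

lemma functional_exists:
  assumes "smod.independent B"
  obtains g where "functional g" "\<And>b. b \<in> B \<Longrightarrow> g b = f b"
  using vector_space_pair.linear_independent_extend[OF functional_pair assms] by metis

text \<open>A functional is prescribed on a basis of \<open>V\<close>. Since \<open>l\<close> is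
  linear on \<open>V\<close> only, the induction over the span has to carry membership in
  \<open>V\<close> along.\<close>

lemma functional_extension:
  assumes V: "smod.subspace V"
    and add: "\<And>x y. x \<in> V \<Longrightarrow> y \<in> V \<Longrightarrow> l (x + y) = l x + l y"
    and scale: "\<And>c x. x \<in> V \<Longrightarrow> l (cscale c x) = c * l x"
  obtains g where "functional g" "\<And>x. x \<in> V \<Longrightarrow> g x = l x"
proof -
  obtain B where B: "B \<subseteq> V" "smod.independent B" "V \<subseteq> smod.span B"
    by (rule kvec.maximal_independent_subset)
  obtain g where g: "functional g" and gB: "\<And>b. b \<in> B \<Longrightarrow> g b = l b"
    using functional_exists[OF B(2)] by metis
  have "x \<in> V \<and> g x = l x" if "x \<in> smod.span B" for x
    using that
  proof (induction rule: smod.span_induct_alt)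
    case base
    have "l (cscale 0 0) = 0" "g (cscale 0 0) = 0"
      using scale[of 0 0] V g by (simp_all only: functional_cscale smod.subspace_0 mult_zero_left)
    then show ?case
      using V by (simp add: smod.subspace_0)
  next
    case (step c x y)
    then have "x \<in> V" "cscale c x \<in> V"
      using B V by (auto simp: smod.subspace_scale)
    with step show ?case
      by (simp add: g add scale gB functional_add functional_cscale smod.subspace_add[OF V])
  qed
  with g B(3) that show thesis
    by blast
qed

lemma functional_separates:
  assumes "smod.subspace V" "u \<notin> V"
  obtains g where "functional g" "\<And>x. x \<in> V \<Longrightarrow> g x = 0" "g u = 1"
proof -
  obtain B where B: "B \<subseteq> V" "smod.independent B" "V \<subseteq> smod.span B"
    by (rule kvec.maximal_independent_subset)
  have "smod.span B = V"
    using B assms(1) smod.span_subspace by blast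
  then have "smod.independent (insert u B)"
    using B assms by (simp add: kvec.independent_insertI)
  from functional_exists[OF this, where f = "\<lambda>b. if b = u then 1 else 0"]
  obtain g where g: "functional g" "\<And>b. b \<in> insert u B \<Longrightarrow> g b = (if b = u then 1 else 0)"
    by blast
  have "g x = 0" if "x \<in> V" for x
  proof -
    have "x \<in> smod.span B"
      using that B by blast
    then show ?thesis
    proof (induction rule: smod.span_induct_alt)
      case base
      show ?case
        using functional_cscale[OF g(1), of 0 0] by simp
    next
      case (step c x y)
      with B assms(2) g show ?case
        by (auto simp: functional_add functional_cscale)
    qed
  qed
  with g that show thesis
    by simp
qed

text \<open>The Riesz vector of \<open>g\<close> in degree \<open>j\<close>: dividing by
  \<open>dcoeff m m\<close> = m! compensates the norms of the monomials. The degree is fixed because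
  \<open>g\<close> may be nonzero on infinitely many monomials.\<close>

definition represent :: "nat \<Rightarrow> (('n::finite, 'k::field) mpol \<Rightarrow> 'k) \<Rightarrow> ('n, 'k) mpol"
  where "represent j g = (\<Sum>m\<in>monoms j. single m (g (single m 1) / of_nat (dcoeff m m)))"

lemma represent_hcomp: "represent j g \<in> hcomp j"
  unfolding represent_def by (rule hcomp_sum) (simp add: single_hcomp monoms_def)

lemma lookup_represent:
  "lookup (represent j g) m
    = (if mdeg m = j then g (single m 1) / of_nat (dcoeff m m) else 0)"
proof -
  have "(\<Sum>x\<in>monoms j. g (single x 1) / of_nat (dcoeff x x) when x = m)
      = (if mdeg m = j then g (single m 1) / of_nat (dcoeff m m) else 0)"
    by (simp add: when_def sum.delta) (simp add: monoms_def)
  then show ?thesis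
    by (simp add: represent_def lookup_sum lookup_single)
qed

lemma pair_represent:
  fixes g :: "('n::finite, 'k::field_char_0) mpol \<Rightarrow> 'k"
  assumes g: "functional g" and u: "u \<in> hcomp j"
  shows "pair u (represent j g) = g u"
proof -
  have m: "pair (single m c) (represent j g) = g (single m c)"
    if "m \<in> monoms j" for m c
    using that by (subst (2) single_eq_cscale)
      (simp add: pair_single_left lookup_represent monoms_def dcoeff_self_nonzero functional_cscale[OF g])
  have "pair u (represent j g)
      = pair (\<Sum>m\<in>monoms j. single m (lookup u m)) (represent j g)"
    using hcomp_sum_monoms[OF u] by simp
  also have "\<dots> = g (\<Sum>m\<in>monoms j. single m (lookup u m))"
    by (simp add: pair_sum_left m functional_sum[OF g])
  also have "\<dots> = g u"
    using hcomp_sum_monoms[OF u] by simp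
  finally show ?thesis .
qed

section \<open>Bases and dimensions inside one degree\<close>

lemma hcomp_span:
  "(hcomp j :: ('n::finite, 'a::comm_ring_1) mpol set)
    = smod.span ((\<lambda>m. single m 1) ` monoms j)" (is "?L = ?R")
proof
  show "?L \<subseteq> ?R"
  proof
    fix F assume F: "F \<in> ?L"
    have "(\<Sum>m\<in>monoms j. single m (lookup F m)) \<in> ?R"
      by (subst single_eq_cscale) (intro smod.span_sum smod.span_scale smod.span_base imageI)
    then show "F \<in> ?R"
      using hcomp_sum_monoms[OF F] by simp
  qed
  show "?R \<subseteq> ?L"
    by (rule smod.span_minimal) (auto simp: subspace_hcomp single_hcomp monoms_def)
qed

lemma independent_hcomp_finite:
  fixes B :: "('n::finite, 'k::field) mpol set"
  assumes "smod.independent B" "B \<subseteq> hcomp j"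
  shows "finite B"
  using kvec.independent_span_bound[OF _ assms(1), of "(\<lambda>m. single m 1) ` monoms j"] assms(2)
  by (auto simp flip: hcomp_span)

lemma basis_pair_exists:
  fixes U V :: "('n::finite, 'k::field) mpol set"
  assumes "smod.subspace U" "smod.subspace V" "U \<subseteq> V" "V \<subseteq> hcomp j"
  obtains BU B where "finite BU" "finite B" "BU \<inter> B = {}" "smod.independent (BU \<union> B)"
    "smod.span BU = U" "smod.span (BU \<union> B) = V" "card BU = kvec.dim U" "card BU + card B = kvec.dim V"
proof -
  obtain BU where BU: "BU \<subseteq> U" "smod.independent BU" "U \<subseteq> smod.span BU"
    "card BU = kvec.dim U"
    by (rule kvec.basis_exists)
  have "BU \<subseteq> V"
    using BU assms by auto
  from kvec.maximal_independent_subset_extend[OF this BU(2)] obtain BV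
    where BV: "BU \<subseteq> BV" "BV \<subseteq> V" "smod.independent BV" "V \<subseteq> smod.span BV" .
  have fin: "finite BV"
    using BV assms independent_hcomp_finite by blast
  have dim: "card BV = kvec.dim V"
    using BV by (simp add: kvec.basis_card_eq_dim)
  have U: "BU \<union> (BV - BU) = BV"
    using BV by auto
  have span: "smod.span BU = U" "smod.span BV = V"
    using BU BV assms smod.span_subspace by blast+
  show thesis
  proof (rule that[of BU "BV - BU"])
    show "card BU + card (BV - BU) = kvec.dim V"
      using fin BV(1) dim by (metis card_Diff_subset card_mono finite_subset le_add_diff_inverse)
  qed (use fin BV(3) BU(4) span finite_subset[OF BV(1) fin] Un_absorb1[OF BV(1)] in auto)
qed

lemma subspace_eq_if_dim_eq:
  fixes V W :: "('n::finite, 'k::field) mpol set"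
  assumes "smod.subspace V" "smod.subspace W" "V \<subseteq> W" "W \<subseteq> hcomp j"
    "kvec.dim V = kvec.dim W"
  shows "V = W"
  by (rule basis_pair_exists[OF assms(1-4)]) (use assms(5) in auto)

text \<open>The \<open>b i\<close> form a basis of \<open>V\<close> modulo \<open>U\<close>, so
  together with a basis of \<open>U\<close> they give one of \<open>V\<close>. They come as an
  indexed family, like the coordinates in \<open>kdim\<close>, so injectivity of \<open>b\<close>
  has to be derived.\<close>

lemma dim_by_complement:
  fixes U V :: "('n::finite, 'k::field) mpol set" and b :: "nat \<Rightarrow> ('n, 'k) mpol"
  assumes U: "smod.subspace U" and V: "smod.subspace V" and "U \<subseteq> V" "V \<subseteq> hcomp j"
    and bV: "\<And>i. i < n \<Longrightarrow> b i \<in> V"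
    and indep: "\<And>x. lincomb n x b \<in> U \<Longrightarrow> \<forall>i<n. x i = 0"
    and gen: "\<And>v. v \<in> V \<Longrightarrow> \<exists>x. v - lincomb n x b \<in> U"
  shows "kvec.dim V = n + kvec.dim U"
proof -
  obtain BU where BU: "BU \<subseteq> U" "smod.independent BU" "U \<subseteq> smod.span BU"
    "card BU = kvec.dim U"
    by (rule kvec.basis_exists)
  have fin: "finite BU"
    using BU assms independent_hcomp_finite by blast
  have delta: "(\<Sum>i<n. cscale (if i = p then c else 0) (b i)) = cscale c (b p)" if "p < n" for p c
    using that by (simp add: if_distrib[of "\<lambda>c. cscale c _"] sum.delta cong: if_cong)
  have notin: "b i \<notin> U" if "i < n" for i
    using indep[of "\<lambda>p. if p = i then 1 else 0"] that by (fastforce simp: delta)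
  have inj: "inj_on b {..<n}"
  proof (rule inj_onI, rule ccontr)
    fix p q assume pq: "p \<in> {..<n}" "q \<in> {..<n}" "b p = b q" "p \<noteq> q"
    \<comment> \<open>A repeated vector would give the nontrivial combination b p - b q = 0, which
      lies in \<open>U\<close>.\<close>
    let ?x = "\<lambda>i. (if i = p then 1 else 0) + (if i = q then - 1 else 0 :: 'k)"
    have "(\<Sum>i<n. cscale (?x i) (b i)) = 0"
      using pq by (simp only: smod.scale_left_distrib sum.distrib) (simp add: delta)
    with indep[of ?x] U pq show False
      by (auto simp: smod.subspace_0)
  qed
  have disj: "b ` {..<n} \<inter> BU = {}"
    using notin BU by auto
  have split: "(\<Sum>v\<in>b ` {..<n} \<union> BU. cscale (f v) v) = (\<Sum>i<n. cscale (f (b i)) (b i)) + (\<Sum>v\<in>BU. cscale (f v) v)" for f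
    using fin disj inj by (simp add: sum.union_disjoint sum.reindex)
  have ind: "smod.independent (b ` {..<n} \<union> BU)"
  proof (rule kvec.independent_if_scalars_zero)
    fix f v assume 0: "(\<Sum>x\<in>b ` {..<n} \<union> BU. cscale (f x) x) = 0"
      and v: "v \<in> b ` {..<n} \<union> BU"
    have inU: "(\<Sum>v\<in>BU. cscale (f v) v) \<in> U"
      using BU U by (intro smod.subspace_sum smod.subspace_scale) auto
    from 0 have "(\<Sum>i<n. cscale (f (b i)) (b i)) = - (\<Sum>v\<in>BU. cscale (f v) v)"
      unfolding split by (simp add: eq_neg_iff_add_eq_0)
    then have "(\<Sum>i<n. cscale (f (b i)) (b i)) \<in> U"
      using inU U by (simp add: smod.subspace_neg)
    then have z: "\<forall>i<n. f (b i) = 0"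
      using indep[of "\<lambda>i. f (b i)"] by simp
    with 0 have "(\<Sum>v\<in>BU. cscale (f v) v) = 0"
      by (simp add: split)
    with BU(2) fin have "\<forall>v\<in>BU. f v = 0"
      using smod.dependent_finite by blast
    with z v show "f v = 0"
      by auto
  qed (use fin in auto)
  have "V \<subseteq> smod.span (b ` {..<n} \<union> BU)"
  proof
    fix v assume "v \<in> V"
    then obtain x where x: "v - lincomb n x b \<in> U"
      using gen by blast
    have "lincomb n x b \<in> smod.span (b ` {..<n} \<union> BU)"
      by (intro smod.span_sum smod.span_scale smod.span_base) auto
    moreover have "v - lincomb n x b \<in> smod.span (b ` {..<n} \<union> BU)"
      using x BU(3) smod.span_mono[of BU "b ` {..<n} \<union> BU"] by blast
    ultimately show "v \<in> smod.span (b ` {..<n} \<union> BU)"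
      by (metis smod.span_add diff_add_cancel)
  qed
  moreover have "b ` {..<n} \<union> BU \<subseteq> V"
    using bV BU assms(3) by auto
  ultimately have "kvec.dim V = card (b ` {..<n} \<union> BU)"
    using ind by (simp add: kvec.basis_card_eq_dim)
  also have "\<dots> = n + kvec.dim U"
    using fin disj inj BU(4) by (simp add: card_Un_disjoint card_image)
  finally show ?thesis .
qed

lemma span_Int_zero:
  fixes A B :: "('n::finite, 'k::field) mpol set"
  assumes fin: "finite A" "finite B" and disj: "A \<inter> B = {}" and ind: "smod.independent (A \<union> B)"
    and F: "F \<in> smod.span A" "F \<in> smod.span B"
  shows "F = 0"
proof -
  obtain a b where a: "F = (\<Sum>v\<in>A. cscale (a v) v)" and b: "F = (\<Sum>v\<in>B. cscale (b v) v)"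
    using F unfolding smod.span_finite[OF fin(1)] smod.span_finite[OF fin(2)] by blast
  define c where "c v = (if v \<in> A then a v else - b v)" for v
  have "(\<Sum>v\<in>A \<union> B. cscale (c v) v) = (\<Sum>v\<in>A. cscale (c v) v) + (\<Sum>v\<in>B. cscale (c v) v)"
    using fin disj by (intro sum.union_disjoint) auto
  also have "(\<Sum>v\<in>A. cscale (c v) v) = F"
    unfolding a by (intro sum.cong) (simp_all add: c_def)
  also have "(\<Sum>v\<in>B. cscale (c v) v) = - F"
    unfolding b sum_negf[symmetric] using disj by (intro sum.cong) (auto simp: c_def)
  finally have z: "(\<Sum>v\<in>A \<union> B. cscale (c v) v) = 0"
    by simp
  have "a v = 0" if "v \<in> A" for v
    using smod.independentD[OF ind finite_UnI[OF fin] subset_refl z, of v] that by (simp add: c_def)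
  then show ?thesis
    by (simp add: a)
qed

lemma enumerate_basis:
  fixes B :: "('n::finite, 'k::field) mpol set"
  assumes fin: "finite B" and ind: "smod.independent B" and card: "card B = n"
  obtains b where "b ` {..<n} = B" "inj_on b {..<n}"
    "\<forall>c. lincomb n c b = 0 \<longrightarrow> (\<forall>i<n. c i = 0)"
      "\<forall>F\<in>smod.span B. \<exists>c. F = lincomb n c b"
proof -
  obtain b where b: "bij_betw b {..<n} B"
    using ex_bij_betw_nat_finite[OF fin] by (auto simp: card atLeast0LessThan)
  have inv: "inv_into {..<n} b (b i) = i" if "i < n" for i
    using b that by (simp add: bij_betw_def inv_into_f_f)
  have reindex: "(\<Sum>v\<in>B. cscale (c v) v) = lincomb n (c \<circ> b) b" for c
    using sum.reindex_bij_betw[OF b, of "\<lambda>v. cscale (c v) v"] by simp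
  have "c i = 0" if 0: "lincomb n c b = 0" and i: "i < n" for c i
  proof -
    have "lincomb n ((c \<circ> inv_into {..<n} b) \<circ> b) b = lincomb n c b"
      by (intro sum.cong) (simp_all add: inv)
    then have "(\<Sum>v\<in>B. cscale ((c \<circ> inv_into {..<n} b) v) v) = 0"
      unfolding reindex using 0 by simp
    from smod.independentD[OF ind fin subset_refl this, of "b i"] show ?thesis
      using b i inv[OF i] by (auto simp: bij_betw_def)
  qed
  moreover have "\<exists>c. F = lincomb n c b" if "F \<in> smod.span B" for F
    using that unfolding smod.span_finite[OF fin] reindex by blast
  ultimately show thesis
    using that[of b] b unfolding bij_betw_def by blast
qed

text \<open>\<open>kdim\<close> is a definite description, so besides an isomorphism with a
  coordinate space the uniqueness of its dimension is required. The map \<open>p\<close> plays the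
  projection from \<open>V\<close> with kernel \<open>U\<close>; this covers graded pieces of R/I,
  whose elements are cosets of all of \<open>I\<close>, as well as a full graded piece with
  \<open>U = {0}\<close>.\<close>

lemma kdim_quotient:
  fixes M :: "('k::field, 'm, 'x) modl_scheme" and p :: "('n::finite, 'k) mpol \<Rightarrow> 'm"
  assumes U: "smod.subspace U" and V: "smod.subspace V" and UV: "U \<subseteq> V" "V \<subseteq> hcomp j"
    and padd: "\<And>x y. x \<in> V \<Longrightarrow> y \<in> V \<Longrightarrow> p (x + y) = padd M (p x) (p y)"
    and sact: "\<And>c x. x \<in> V \<Longrightarrow> p (cscale c x) = sact M c (p x)"
    and surj: "p ` V = carr M"
    and ker: "\<And>x y. x \<in> V \<Longrightarrow> y \<in> V \<Longrightarrow> p x = p y \<longleftrightarrow> x - y \<in> U"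
  shows "kdim M = kvec.dim V - kvec.dim U"
proof -
  have comb: "lincomb m x b \<in> V" if "\<And>i. i < m \<Longrightarrow> b i \<in> V" for m x b
    using that V by (intro smod.subspace_sum smod.subspace_scale) auto
  have ex: "\<exists>f. mod_iso f (coord_space (kvec.dim V - kvec.dim U)) M"
  proof -
    obtain BU B where B: "finite BU" "finite B" "BU \<inter> B = {}" "smod.independent (BU \<union> B)"
      "smod.span BU = U" "smod.span (BU \<union> B) = V" "card BU = kvec.dim U" "card BU + card B = kvec.dim V"
      by (rule basis_pair_exists[OF U V UV])
    define n where "n = card B"
    let ?P = "{..<n} \<rightarrow>\<^sub>E (UNIV :: 'k set)"
    have n: "n = kvec.dim V - kvec.dim U"
      using B by (simp add: n_def)
    have "smod.independent B"
      using B(4) by (rule smod.independent_mono) simp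
    note enum = enumerate_basis[OF B(2) this n_def[symmetric]]
    obtain b where b: "b ` {..<n} = B" "inj_on b {..<n}"
      "\<forall>c. lincomb n c b = 0 \<longrightarrow> (\<forall>i<n. c i = 0)"
      "\<forall>F\<in>smod.span B. \<exists>c. F = lincomb n c b"
      by (rule enum)
    have bB: "lincomb n x b \<in> smod.span B" for x
      using b(1) by (intro smod.span_sum smod.span_scale smod.span_base) auto
    have bV: "b i \<in> V" if "i < n" for i
      using b(1) that smod.span_base[of "b i" "BU \<union> B"] B(6) by auto
    have indU: "\<forall>i<n. x i = 0" if "lincomb n x b \<in> U" for x
    proof -
      have "lincomb n x b = 0"
        using span_Int_zero[OF B(1-4) _ bB] that B(5) by simp
      then show ?thesis
        using b(3) by blast
    qed
    define f where "f = (\<lambda>x\<in>?P. p (lincomb n x b))"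
    have lin1: "(\<Sum>i<n. cscale ((\<lambda>i\<in>{..<n}. x i + y i) i) (b i))
        = lincomb n x b + lincomb n y b" for x y
      by (simp add: smod.scale_left_distrib sum.distrib)
    have lin2: "(\<Sum>i<n. cscale ((\<lambda>i\<in>{..<n}. c * x i) i) (b i)) = cscale c (lincomb n x b)" for c x
      by (simp add: smod.scale_sum_right)
    have combn: "lincomb n x b \<in> V" for x
      by (rule comb) (rule bV)
    have feq: "f x = p (lincomb n x b)" if "x \<in> ?P" for x
      using that by (simp add: f_def)
    have "f \<in> ?P \<rightarrow>\<^sub>E carr M"
      using combn surj by (auto simp: f_def)
    moreover have "f (\<lambda>i\<in>{..<n}. x i + y i) = padd M (f x) (f y)"
      if "x \<in> ?P" "y \<in> ?P" for x y
    proof -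
      have "(\<lambda>i\<in>{..<n}. x i + y i) \<in> ?P"
        by simp
      then show ?thesis
        using that by (simp only: feq lin1 padd combn)
    qed
    moreover have "f (\<lambda>i\<in>{..<n}. c * x i) = sact M c (f x)" if "x \<in> ?P" for c x
    proof -
      have "(\<lambda>i\<in>{..<n}. c * x i) \<in> ?P"
        by simp
      then show ?thesis
        using that by (simp only: feq lin2 sact combn)
    qed
    ultimately have "f \<in> mod_hom (coord_space n) M"
      by (simp add: mod_hom_def coord_space_def)
    moreover have "inj_on f ?P"
    proof (rule inj_onI)
      fix x y assume x: "x \<in> ?P" and y: "y \<in> ?P" and eq: "f x = f y"
      define z where "z = (\<lambda>i. x i - y i)"
      have zsum: "lincomb n x b - lincomb n y b = lincomb n z b"
        by (simp add: z_def smod.scale_left_diff_distrib sum_subtractf)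
      from eq have "lincomb n z b \<in> U"
        using ker combn x y by (simp add: f_def flip: zsum)
      from indU[OF this] have "z i = 0" if "i < n" for i
        using that by blast
      then show "x = y"
        using x y by (intro PiE_ext) (auto simp: z_def)
    qed
    moreover have "f ` ?P = carr M"
    proof
      show "f ` ?P \<subseteq> carr M"
        using combn surj by (auto simp: f_def)
      show "carr M \<subseteq> f ` ?P"
      proof
        fix y assume "y \<in> carr M"
        then obtain v where v: "v \<in> V" "y = p v"
          using surj by blast
        obtain u w where uw: "u \<in> U" "w \<in> smod.span B" "v = u + w"
          using v(1) unfolding B(6)[symmetric] smod.span_Un B(5) by blast
        then obtain c where c: "w = lincomb n c b"
          using b(4) by blast
        define x where "x = (\<lambda>i\<in>{..<n}. c i)"
        have "lincomb n x b = lincomb n c b"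
          by (simp add: x_def)
        then have "v - lincomb n x b \<in> U"
          using uw c by simp
        then have "y = f x"
          using ker combn v by (simp add: f_def x_def)
        moreover have "x \<in> ?P"
          by (simp add: x_def)
        ultimately show "y \<in> f ` ?P"
          by blast
      qed
    qed
    ultimately have "mod_iso f (coord_space n) M"
      by (simp add: mod_iso_def bij_betw_def coord_space_def)
    then show ?thesis
      unfolding n by blast
  qed
  \<comment> \<open>Uniqueness: the images of the unit vectors under any coordinate isomorphism are
    lifted along \<open>p\<close> to \<open>V\<close>, and the lifts form a basis of
    \<open>V\<close> modulo \<open>U\<close>.\<close>
  moreover have "n = kvec.dim V - kvec.dim U" if "\<exists>f. mod_iso f (coord_space n) M" for n
  proof -
    from that obtain f where hom: "f \<in> mod_hom (coord_space n) M"
      and bij: "bij_betw f ({..<n} \<rightarrow>\<^sub>E UNIV) (carr M)"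
      by (auto simp: mod_iso_def coord_space_def)
    let ?P = "{..<n} \<rightarrow>\<^sub>E (UNIV :: 'k set)"
    have fadd: "f (\<lambda>i\<in>{..<n}. x i + y i) = padd M (f x) (f y)" if "x \<in> ?P" "y \<in> ?P" for x y
      using hom that by (simp add: mod_hom_def coord_space_def)
    have fscale: "f (\<lambda>i\<in>{..<n}. c * x i) = sact M c (f x)" if "x \<in> ?P" for c x
      using hom that by (simp add: mod_hom_def coord_space_def)
    have fcarr: "f x \<in> p ` V" if "x \<in> ?P" for x
      using bij that by (auto simp: bij_betw_def surj)
    define e :: "nat \<Rightarrow> nat \<Rightarrow> 'k" where
      "e k = (\<lambda>i\<in>{..<n}. if i = k then 1 else 0)" for k
    have eP: "e k \<in> ?P" for k
      by (simp add: e_def)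
    have "\<forall>k. \<exists>v\<in>V. f (e k) = p v"
      using fcarr[OF eP] by blast
    then obtain b where bV: "\<And>k. b k \<in> V" and fe: "\<And>k. f (e k) = p (b k)"
      by metis
    have combn: "lincomb m x b \<in> V" for m x
      by (rule comb) (rule bV)
    \<comment> \<open>Only the binary operation \<open>padd\<close> is respected by
      \<open>f\<close>, so \<open>f x\<close> is computed by an induction that switches on one
      coordinate at a time.\<close>
    define tr :: "nat \<Rightarrow> (nat \<Rightarrow> 'k) \<Rightarrow> nat \<Rightarrow> 'k" where
      "tr m x = (\<lambda>i\<in>{..<n}. if i < m then x i else 0)" for m x
    have trP: "tr m x \<in> ?P" for m x
      by (simp add: tr_def)
    have tr: "f (tr m x) = p (lincomb m x b)" if "m \<le> n" for m x
      using that
    proof (induction m)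
      case 0
      obtain v where v: "v \<in> V" "f (tr 0 x) = p v"
        using fcarr[OF trP] by blast
      \<comment> \<open>\<open>M\<close> is a bare record without module axioms, so the value at the
        zero vector is found by writing this vector as 0 times itself.\<close>
      have "tr 0 x = (\<lambda>i\<in>{..<n}. 0 * tr 0 x i)"
        by (auto simp: tr_def)
      then have "f (tr 0 x) = p (cscale 0 v)"
        using fscale[OF trP, of 0 0 x] v by (simp only: sact)
      then show ?case
        by simp
    next
      case (Suc m)
      have ce: "(\<lambda>i\<in>{..<n}. x m * e m i) \<in> ?P"
        by simp
      have "tr (Suc m) x = (\<lambda>i\<in>{..<n}. tr m x i + (\<lambda>i\<in>{..<n}. x m * e m i) i)"
        by (auto simp: tr_def e_def less_Suc_eq fun_eq_iff)
      then have "f (tr (Suc m) x) = padd M (f (tr m x)) (sact M (x m) (f (e m)))"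
        by (simp only: fadd[OF trP ce] fscale[OF eP])
      also have "\<dots> = p (lincomb m x b + cscale (x m) (b m))"
        using Suc bV combn V by (simp add: fe padd sact smod.subspace_scale)
      finally show ?case
        by (simp add: add.commute)
    qed
    have fx: "f x = p (lincomb n x b)" if "x \<in> ?P" for x
    proof -
      have "tr n x = x"
        using that by (auto simp: tr_def fun_eq_iff restrict_def PiE_iff extensional_def)
      with tr[of n x] show ?thesis
        by simp
    qed
    have "kvec.dim V = n + kvec.dim U"
    proof (rule dim_by_complement[OF U V UV bV])
      fix x assume x: "lincomb n x b \<in> U"
      define y where "y = (\<lambda>i\<in>{..<n}. x i)"
      define z :: "nat \<Rightarrow> 'k" where "z = (\<lambda>i\<in>{..<n}. 0)"
      have yz: "y \<in> ?P" "z \<in> ?P"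
        by (simp_all add: y_def z_def)
      have ys: "lincomb n y b = lincomb n x b"
        and zs: "lincomb n z b = 0"
        by (simp_all add: y_def z_def)
      have "f y = f z"
        unfolding fx[OF yz(1)] fx[OF yz(2)] ys zs
        using ker[OF combn smod.subspace_0[OF V]] x by simp
      with bij yz have "y = z"
        by (auto simp: bij_betw_def inj_on_def)
      then show "\<forall>i<n. x i = 0"
        by (metis y_def z_def lessThan_iff restrict_apply')
    next
      fix v assume v: "v \<in> V"
      then obtain x where x: "x \<in> ?P" "p v = f x"
        using bij surj by (metis bij_betw_def imageE image_eqI)
      then have "v - lincomb n x b \<in> U"
        using ker[OF v combn] fx by simp
      then show "\<exists>x. v - lincomb n x b \<in> U"
        by blast
    qed
    then show ?thesis
      by simp
  qed
  ultimately show ?thesis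
    unfolding kdim_def by (rule the_equality)
qed

text \<open>In a basis of \<open>hcomp j\<close> that extends one of \<open>U\<close>, the vectors
  representing the dual functionals of the added elements form a basis of the annihilator.\<close>

lemma dim_annihilator:
  fixes U :: "('n::finite, 'k::field_char_0) mpol set"
  assumes U: "smod.subspace U" "U \<subseteq> hcomp j"
  shows "kvec.dim {F \<in> hcomp j. \<forall>u\<in>U. pair u F = 0} = kvec.dim (hcomp j :: ('n, 'k) mpol set) - kvec.dim U"
proof -
  let ?A = "{F \<in> hcomp j. \<forall>u\<in>U. pair u F = 0}"
  obtain BU B where B: "finite BU" "finite B" "BU \<inter> B = {}" "smod.independent (BU \<union> B)"
    "smod.span BU = U" "smod.span (BU \<union> B) = hcomp j" "card BU = kvec.dim U"
    "card BU + card B = kvec.dim (hcomp j :: ('n, 'k) mpol set)"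
    by (rule basis_pair_exists[OF U(1) subspace_hcomp U(2) subset_refl])
  have "\<exists>g. functional g \<and> (\<forall>c\<in>BU \<union> B. g c = (if c = b then 1 else 0))" for b
    by (rule functional_exists[OF B(4), of "\<lambda>c. if c = b then 1 else 0"]) blast
  then obtain g where g: "\<And>b. functional (g b)"
    "\<And>b c. c \<in> BU \<union> B \<Longrightarrow> g b c = (if c = b then 1 else 0)"
    by metis
  define F where "F b = represent j (g b)" for b
  have BUB: "BU \<union> B \<subseteq> hcomp j"
    using B(6) smod.span_superset by blast
  have pair: "pair c (F b) = (if c = b then 1 else 0)" if "c \<in> BU \<union> B" for b c
    using that BUB g by (auto simp: F_def pair_represent)
  have span0: "pair u G = 0"
    if "u \<in> smod.span C" "\<And>c. c \<in> C \<Longrightarrow> pair c G = 0" for u G C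
    using that by (induction rule: smod.span_induct_alt) (auto simp: pair_add_left pair_cscale_left)
  have inj: "inj_on F B"
  proof (rule inj_onI)
    fix b c assume "b \<in> B" "c \<in> B" "F b = F c"
    with pair[of b b] pair[of b c] show "b = c"
      by (auto split: if_splits)
  qed
  have FA: "F ` B \<subseteq> ?A"
  proof (clarsimp, intro conjI ballI)
    fix b u assume "b \<in> B"
    show "F b \<in> hcomp j"
      by (simp add: F_def represent_hcomp)
    assume "u \<in> U"
    then show "pair u (F b) = 0"
      unfolding B(5)[symmetric] by (rule span0) (use pair \<open>b \<in> B\<close> B(3) in auto)
  qed
  have ind: "smod.independent (F ` B)"
  proof (rule kvec.independent_if_scalars_zero)
    fix f x assume 0: "(\<Sum>x\<in>F ` B. cscale (f x) x) = 0" and x: "x \<in> F ` B"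
    from x obtain b where b: "b \<in> B" "x = F b"
      by blast
    from 0 have "(\<Sum>c\<in>B. cscale (f (F c)) (F c)) = 0"
      using inj by (simp add: sum.reindex)
    then have "pair b (\<Sum>c\<in>B. cscale (f (F c)) (F c)) = 0"
      by simp
    then show "f x = 0"
      using b B(2) by (simp add: pair_sum_right pair_cscale_right pair
            if_distrib[where f = "\<lambda>y. _ * y"] sum.delta' cong: if_cong)
  qed (use B in simp)
  have span: "?A \<subseteq> smod.span (F ` B)"
  proof
    fix G assume G: "G \<in> ?A"
    \<comment> \<open>What remains of \<open>G\<close> after subtracting its expansion in the dual
      vectors pairs to zero with the whole basis, so it vanishes by nondegeneracy.\<close>
    define H where "H = G - (\<Sum>b\<in>B. cscale (pair b G) (F b))"
    have "pair c H = 0" if "c \<in> BU \<union> B" for c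
    proof (cases "c \<in> B")
      case True
      then show ?thesis
        using B(2) by (simp add: H_def pair_diff_right pair_sum_right pair_cscale_right pair
            if_distrib[where f = "\<lambda>y. _ * y"] sum.delta' cong: if_cong)
    next
      case False
      then have "c \<in> U"
        using that B(5) smod.span_base by auto
      with G False that show ?thesis
        by (auto simp: H_def pair_diff_right pair_sum_right pair_cscale_right pair intro!: sum.neutral)
    qed
    then have z: "pair u H = 0" if "u \<in> hcomp j" for u
      using that span0 unfolding B(6)[symmetric] by blast
    have H: "H \<in> hcomp j"
      using G unfolding H_def by (auto intro!: hcomp_diff hcomp_sum hcomp_cscale simp: F_def represent_hcomp)
    have "H = 0"
    proof (rule pair_nondegenerate)
      fix m
      show "pair (single m 1) H = 0"
        using z[of "single m 1"] pair_hcomp_neq[OF _ H, of "single m 1" "mdeg m"]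
        by (cases "mdeg m = j") (auto simp: single_hcomp)
    qed
    then have "G = (\<Sum>b\<in>B. cscale (pair b G) (F b))"
      by (simp add: H_def)
    then show "G \<in> smod.span (F ` B)"
      by (metis (no_types, lifting) imageI smod.span_base smod.span_scale smod.span_sum)
  qed
  from kvec.basis_card_eq_dim[OF FA span ind] have "kvec.dim ?A = card B"
    using inj by (simp add: card_image)
  then show ?thesis
    using B(7,8) by simp
qed

section \<open>Cosets and homomorphisms into quotients\<close>

text \<open>Only the additive structure enters the coset calculus, so one set of rules serves
  R-modules and k-vector spaces alike.\<close>

definition subgrp :: "'b::ab_group_add set \<Rightarrow> bool"
  where "subgrp U \<longleftrightarrow> 0 \<in> U \<and> (\<forall>x\<in>U. \<forall>y\<in>U. x - y \<in> U)"

lemma subgrp_zero: "subgrp U \<Longrightarrow> 0 \<in> U"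
  by (simp add: subgrp_def)

lemma subgrp_diff:
  "subgrp U \<Longrightarrow> x \<in> U \<Longrightarrow> y \<in> U \<Longrightarrow> x - y \<in> U"
  by (simp add: subgrp_def)

lemma subgrp_uminus: "subgrp U \<Longrightarrow> x \<in> U \<Longrightarrow> - x \<in> U"
  using subgrp_diff[of U 0 x] subgrp_zero[of U] by simp

lemma subgrp_add:
  "subgrp U \<Longrightarrow> x \<in> U \<Longrightarrow> y \<in> U \<Longrightarrow> x + y \<in> U"
  using subgrp_diff[of U x "- y"] subgrp_uminus[of U y] by simp

lemma subgrp_sum:
  "subgrp U \<Longrightarrow> (\<And>i. i \<in> X \<Longrightarrow> f i \<in> U) \<Longrightarrow> sum f X \<in> U"
  by (induction X rule: infinite_finite_induct) (simp_all add: subgrp_zero subgrp_add)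

lemma subgrp_diff_commute: "subgrp U \<Longrightarrow> x - y \<in> U \<Longrightarrow> y - x \<in> U"
  using subgrp_uminus[of U "x - y"] by simp

lemma mem_coset: "z \<in> coset U x \<longleftrightarrow> z - x \<in> U"
proof
  assume "z - x \<in> U"
  then have "x + (z - x) \<in> coset U x"
    unfolding coset_def by blast
  then show "z \<in> coset U x"
    by simp
qed (auto simp: coset_def)

lemma coset_self: "subgrp U \<Longrightarrow> x \<in> coset U x"
  by (simp add: mem_coset subgrp_zero)

lemma coset_eq_iff: "subgrp U \<Longrightarrow> coset U x = coset U y \<longleftrightarrow> x - y \<in> U"
proof
  assume U: "subgrp U" and "x - y \<in> U"
  then have "z - x \<in> U \<longleftrightarrow> z - y \<in> U" for z
    using subgrp_add[OF U, of "z - x" "x - y"] subgrp_diff[OF U, of "z - y" "x - y"] by auto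
  then show "coset U x = coset U y"
    by (auto simp: mem_coset)
qed (use coset_self mem_coset in blast)

lemma coset_eqI: "subgrp U \<Longrightarrow> z \<in> coset U x \<Longrightarrow> coset U x = coset U z"
  by (simp add: coset_eq_iff mem_coset subgrp_diff_commute)

lemma coset_zero: "coset U 0 = U"
  by (auto simp: mem_coset)

lemma coset_of_mem: "subgrp U \<Longrightarrow> x \<in> U \<Longrightarrow> coset U x = U"
  using coset_eq_iff[of U x 0] by (simp add: coset_zero)

lemma coset_add:
  assumes "subgrp U"
  shows "{a + b |a b. a \<in> coset U x \<and> b \<in> coset U y} = coset U (x + y)"
proof (rule subset_antisym; rule subsetI)
  fix z assume "z \<in> {a + b |a b. a \<in> coset U x \<and> b \<in> coset U y}"
  then show "z \<in> coset U (x + y)"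
    using subgrp_add[OF assms] by (fastforce simp: mem_coset algebra_simps)
next
  fix z assume "z \<in> coset U (x + y)"
  then have "(z - y) \<in> coset U x" "y \<in> coset U y"
    using coset_self[OF assms] by (simp_all add: mem_coset algebra_simps)
  then show "z \<in> {a + b |a b. a \<in> coset U x \<and> b \<in> coset U y}"
    by force
qed

text \<open>For homogeneous \<open>w\<close>, an element z has degree \<open>d\<close> iff z - w
  has. This justifies the identification of cosets built into \<open>restr_deg\<close>.\<close>

lemma coset_Int_hcomp:
  assumes "w \<in> hcomp d"
  shows "coset V w \<inter> hcomp d = coset (V \<inter> hcomp d) w"
proof -
  have "z \<in> hcomp d \<longleftrightarrow> z - w \<in> hcomp d" for z
    using assms hcomp_add[of "z - w" d w] hcomp_diff[of z d w] by auto
  then show ?thesis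
    unfolding set_eq_iff Int_iff mem_coset by blast
qed

lemma subgrp_hcomp: "subgrp V \<Longrightarrow> subgrp (V \<inter> hcomp d)"
  by (simp add: subgrp_def hcomp_diff)

locale operation =
  fixes s :: "'r \<Rightarrow> ('n::finite, 'a::comm_ring_1) mpol \<Rightarrow> ('n, 'a) mpol"
  assumes s_add: "s c (x + y) = s c x + s c y"
begin

lemma s_diff: "s c (x - y) = s c x - s c y"
  using s_add[of c "x - y" y] by (simp add: eq_diff_eq)

definition stable :: "('n, 'a) mpol set \<Rightarrow> bool"
  where "stable U \<longleftrightarrow> subgrp U \<and> (\<forall>c. \<forall>x\<in>U. s c x \<in> U)"

lemma stable_subgrp: "stable U \<Longrightarrow> subgrp U"
  by (simp add: stable_def)

lemma stable_s: "stable U \<Longrightarrow> x \<in> U \<Longrightarrow> s c x \<in> U"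
  by (simp add: stable_def)

lemma stable_UNIV: "stable UNIV"
  by (simp add: stable_def subgrp_def)

text \<open>Representatives differ by elements of \<open>U\<close>, and so do their images; every
  member of the union is therefore the same coset.\<close>

lemma sact_coset:
  assumes "stable U"
  shows "(\<Union>a\<in>coset U x. coset U (s c a)) = coset U (s c x)"
proof -
  have "coset U (s c a) = coset U (s c x)" if "a \<in> coset U x" for a
    using that assms by (simp add: mem_coset coset_eq_iff stable_def flip: s_diff)
  moreover have "x \<in> coset U x"
    using assms coset_self stable_subgrp by blast
  ultimately show ?thesis
    by blast
qed

text \<open>Homomorphisms into W/U, with the operations stated on representatives. Membership
  suffices where \<open>mod_hom\<close> has equality of sets, because two cosets of \<open>U\<close>
  with a common element coincide.\<close>

definition coset_hom ::
    "('n, 'a) mpol set \<Rightarrow> ('n, 'a) mpol set \<Rightarrow> ('n, 'a) mpol set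
      \<Rightarrow> (('n, 'a) mpol \<Rightarrow> ('n, 'a) mpol set) \<Rightarrow> bool"
  where "coset_hom V W U f \<longleftrightarrow> f \<in> extensional V \<and> (\<forall>x\<in>V. \<exists>w\<in>W. f x = coset U w) \<and>
    (\<forall>x\<in>V. \<forall>y\<in>V. \<forall>a\<in>f x. \<forall>b\<in>f y. a + b \<in> f (x + y)) \<and>
    (\<forall>c. \<forall>x\<in>V. \<forall>a\<in>f x. s c a \<in> f (s c x))"

lemma coset_hom_coset:
  assumes "coset_hom V W U f" "subgrp U" "x \<in> V" "a \<in> f x"
  shows "f x = coset U a"
proof -
  obtain w where "f x = coset U w"
    using assms by (auto simp: coset_hom_def)
  with assms(2,4) show ?thesis
    using coset_eqI by metis
qed

lemma mod_hom_iff: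
  assumes V: "stable V" and U: "stable U"
  shows "f \<in> mod_hom (submod s V) (quot s W U) \<longleftrightarrow> coset_hom V W U f"
proof
  note sU = stable_subgrp[OF U]
  assume f: "f \<in> mod_hom (submod s V) (quot s W U)"
  have add: "f (x + y) = {a + b |a b. a \<in> f x \<and> b \<in> f y}" if "x \<in> V" "y \<in> V" for x y
    using f that by (simp add: mod_hom_def submod_def quot_def)
  have sc: "f (s c x) = (\<Union>a\<in>f x. coset U (s c a))" if "x \<in> V" for c x
    using f that by (simp add: mod_hom_def submod_def quot_def)
  have "f \<in> V \<rightarrow>\<^sub>E coset U ` W"
    using f by (simp add: mod_hom_def submod_def quot_def)
  moreover have "a + b \<in> f (x + y)" if "x \<in> V" "y \<in> V" "a \<in> f x" "b \<in> f y" for x y a b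
    using that by (auto simp: add)
  moreover have "s c a \<in> f (s c x)" if "x \<in> V" "a \<in> f x" for c x a
    using that coset_self[OF sU] by (auto simp: sc)
  ultimately show "coset_hom V W U f"
    unfolding coset_hom_def PiE_iff by (blast elim: imageE)
next
  note sU = stable_subgrp[OF U] and sV = stable_subgrp[OF V]
  assume f: "coset_hom V W U f"
  have "f (x + y) = {a + b |a b. a \<in> f x \<and> b \<in> f y}" if "x \<in> V" "y \<in> V" for x y
  proof -
    obtain a b where ab: "f x = coset U a" "f y = coset U b"
      using f \<open>x \<in> V\<close> \<open>y \<in> V\<close> by (meson coset_hom_def)
    then have "a + b \<in> f (x + y)"
      using f that coset_self[OF sU] by (simp add: coset_hom_def)
    then have "f (x + y) = coset U (a + b)"
      using coset_hom_coset[OF f sU] that sV subgrp_add by blast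
    then show ?thesis
      unfolding ab by (simp add: coset_add[OF sU])
  qed
  moreover have "f (s c x) = (\<Union>a\<in>f x. coset U (s c a))" if "x \<in> V" for c x
  proof -
    obtain a where a: "f x = coset U a"
      using f \<open>x \<in> V\<close> by (meson coset_hom_def)
    then have "s c a \<in> f (s c x)"
      using f that coset_self[OF sU] by (simp add: coset_hom_def)
    then have "f (s c x) = coset U (s c a)"
      using coset_hom_coset[OF f sU] that stable_s[OF V] by blast
    then show ?thesis
      unfolding a by (simp add: sact_coset[OF U])
  qed
  moreover have "f \<in> V \<rightarrow>\<^sub>E coset U ` W"
    using f by (auto simp: coset_hom_def PiE_iff)
  ultimately show "f \<in> mod_hom (submod s V) (quot s W U)"
    by (simp add: mod_hom_def submod_def quot_def)
qed

lemma mod_hom0_iff: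
  assumes "stable V" "stable U"
  shows "f \<in> mod_hom0 (submod s V) (quot s W U) \<longleftrightarrow>
    coset_hom V W U f \<and> (\<forall>j. \<forall>x\<in>V \<inter> hcomp j. \<exists>w\<in>W \<inter> hcomp j. f x = coset U w)"
proof -
  have "(\<forall>j. f ` gr (submod s V) j \<subseteq> gr (quot s W U) j)
      \<longleftrightarrow> (\<forall>j. \<forall>x\<in>V \<inter> hcomp j. \<exists>w\<in>W \<inter> hcomp j. f x = coset U w)"
    by (simp add: submod_def quot_def image_subset_iff image_iff)
  then show ?thesis
    by (simp add: mod_hom0_def mod_hom_iff[OF assms])
qed

end

locale coset_homomorphism = operation s
  for s :: "'r \<Rightarrow> ('n::finite, 'a::comm_ring_1) mpol \<Rightarrow> ('n, 'a) mpol" +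
  fixes V W U :: "('n, 'a) mpol set" and f :: "('n, 'a) mpol \<Rightarrow> ('n, 'a) mpol set"
  assumes V: "stable V" and U: "stable U" and hom: "coset_hom V W U f"
begin

lemmas sU = stable_subgrp[OF U] and sV = stable_subgrp[OF V]

lemma ex: obtains w where "x \<in> V \<Longrightarrow> w \<in> W" "x \<in> V \<Longrightarrow> w \<in> f x"
  using hom coset_self[OF sU] by (metis coset_hom_def)

lemma mem_iff:
  "x \<in> V \<Longrightarrow> a \<in> f x \<Longrightarrow> b \<in> f x \<longleftrightarrow> b - a \<in> U"
  using coset_hom_coset[OF hom sU] mem_coset by blast

lemma add:
  "x \<in> V \<Longrightarrow> y \<in> V \<Longrightarrow> a \<in> f x \<Longrightarrow> b \<in> f y \<Longrightarrow> a + b \<in> f (x + y)"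
  using hom by (auto simp: coset_hom_def)

lemma act: "x \<in> V \<Longrightarrow> a \<in> f x \<Longrightarrow> s c a \<in> f (s c x)"
  using hom by (auto simp: coset_hom_def)

text \<open>For a in \<open>f 0\<close> also a + a lies in \<open>f 0\<close>, and members of one
  value differ by elements of \<open>U\<close>.\<close>

lemma zero: "f 0 = U"
proof -
  have 0: "0 \<in> V"
    using sV subgrp_zero by blast
  obtain a where a: "a \<in> f 0"
    using ex[of 0] 0 by blast
  then have "a + a \<in> f 0"
    using add[of 0 0 a a] 0 by simp
  then have "a \<in> U"
    using mem_iff[OF 0 a] by simp
  then show ?thesis
    using coset_hom_coset[OF hom sU 0 a] coset_of_mem[OF sU] by simp
qed

text \<open>\<open>coset_hom\<close> speaks of sums only: a member c of \<open>f (x - y)\<close>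
  gives c + b in \<open>f x\<close>, which is then compared with a.\<close>

lemma diff:
  assumes "x \<in> V" "y \<in> V" "a \<in> f x" "b \<in> f y"
  shows "a - b \<in> f (x - y)"
proof -
  have xy: "x - y \<in> V"
    using assms sV subgrp_diff by blast
  obtain c where c: "c \<in> f (x - y)"
    using ex[of "x - y"] xy by blast
  have "c + b \<in> f x"
    using add[OF xy assms(2) c assms(4)] by simp
  then have "(c + b) - a \<in> U"
    using mem_iff assms by blast
  then have "(a - b) - c \<in> U"
    using subgrp_uminus[OF sU, of "(c + b) - a"] by (simp add: algebra_simps)
  then show ?thesis
    using mem_iff[OF xy c] by blast
qed

lemma sum:
  "(\<And>i. i \<in> X \<Longrightarrow> x i \<in> V) \<Longrightarrow> (\<And>i. i \<in> X \<Longrightarrow> a i \<in> f (x i)) \<Longrightarrow> sum a X \<in> f (sum x X)"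
proof (induction X rule: infinite_finite_induct)
  case (insert i X)
  then show ?case
    by (simp add: add subgrp_sum[OF sV])
qed (simp_all add: zero subgrp_zero[OF sU])

end

section \<open>Closure of graded Hom spaces under their operations\<close>

definition closed_gmod :: "(('n::finite, 'a::comm_ring_1) mpol, 'm) gmodl \<Rightarrow> bool"
  where "closed_gmod N \<longleftrightarrow>
    (\<forall>a\<in>carr N. \<forall>b\<in>carr N. padd N a b \<in> carr N) \<and>
    (\<forall>r. \<forall>a\<in>carr N. sact N r a \<in> carr N) \<and>
    (\<forall>j. gr N j \<subseteq> carr N) \<and>
    (\<forall>j. \<forall>a\<in>gr N j. \<forall>b\<in>gr N j. padd N a b \<in> gr N j) \<and>
    (\<forall>j c. \<forall>a\<in>gr N j. sact N (const c) a \<in> gr N j)"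

text \<open>
  What is needed of the target \<open>N\<close> for \<^term>\<open>HomR0 M N\<close> to be closed under its operations.
\<close>

definition regular_gmod :: "(('n::finite, 'a::comm_ring_1) mpol, 'm) gmodl \<Rightarrow> bool"
  where "regular_gmod N \<longleftrightarrow> closed_gmod N \<and>
    (\<forall>a\<in>carr N. \<forall>b\<in>carr N. \<forall>c\<in>carr N. \<forall>e\<in>carr N.
       padd N (padd N a b) (padd N c e) = padd N (padd N a c) (padd N b e)) \<and>
    (\<forall>r. \<forall>a\<in>carr N. \<forall>b\<in>carr N. sact N r (padd N a b) = padd N (sact N r a) (sact N r b)) \<and>
    (\<forall>q r. \<forall>a\<in>carr N. sact N q (sact N r a) = sact N r (sact N q a))"

text \<open>\<open>restr_deg\<close> and \<open>pull_quot\<close> are undefined outside the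
  homomorphisms, so their linearity can be stated only once sums and multiples of homomorphisms are
  homomorphisms. Records carry no axioms, hence the hypotheses on \<open>M\<close> and
  \<open>N\<close>.\<close>

lemma HomR0_closed:
  fixes N :: "(('n::finite, 'a::comm_ring_1) mpol, 'm) gmodl"
  assumes M: "closed_gmod M" and N: "regular_gmod N"
    and f: "f \<in> carr (HomR0 M N)" and g: "g \<in> carr (HomR0 M N)"
  shows "padd (HomR0 M N) f g \<in> carr (HomR0 M N)" and "sact (HomR0 M N) c f \<in> carr (HomR0 M N)"
proof -
  have f': "f \<in> carr M \<rightarrow>\<^sub>E carr N"
    "\<And>x y. x \<in> carr M \<Longrightarrow> y \<in> carr M \<Longrightarrow> f (padd M x y) = padd N (f x) (f y)"
    "\<And>c x. x \<in> carr M \<Longrightarrow> f (sact M c x) = sact N c (f x)"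
      "\<And>j. f ` gr M j \<subseteq> gr N j"
    using f by (auto simp: HomR0_def mod_hom0_def mod_hom_def)
  have g': "g \<in> carr M \<rightarrow>\<^sub>E carr N"
    "\<And>x y. x \<in> carr M \<Longrightarrow> y \<in> carr M \<Longrightarrow> g (padd M x y) = padd N (g x) (g y)"
    "\<And>c x. x \<in> carr M \<Longrightarrow> g (sact M c x) = sact N c (g x)"
      "\<And>j. g ` gr M j \<subseteq> gr N j"
    using g by (auto simp: HomR0_def mod_hom0_def mod_hom_def)
  have fc: "f x \<in> carr N" and gc: "g x \<in> carr N" if "x \<in> carr M" for x
    using f'(1) g'(1) that by auto
  have Mc: "padd M x y \<in> carr M" "sact M r x \<in> carr M" if "x \<in> carr M" "y \<in> carr M" for x y r
    using M that by (simp_all add: closed_gmod_def)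
  have Mg: "gr M j \<subseteq> carr M" for j
    using M by (simp add: closed_gmod_def)
  have Nc: "closed_gmod N"
    using N by (simp add: regular_gmod_def)
  have Npc: "padd N a b \<in> carr N" "sact N r a \<in> carr N" if "a \<in> carr N" "b \<in> carr N" for a b r
    using Nc that by (simp_all add: closed_gmod_def)
  have Ng: "padd N a b \<in> gr N j" "sact N (const e) a \<in> gr N j"
    if "a \<in> gr N j" "b \<in> gr N j" for a b j e
    using Nc that by (simp_all add: closed_gmod_def)
  have Nl: "padd N (padd N a b) (padd N p q) = padd N (padd N a p) (padd N b q)"
    "sact N r (padd N a b) = padd N (sact N r a) (sact N r b)"
    "sact N r (sact N r' a) = sact N r' (sact N r a)"
    if "a \<in> carr N" "b \<in> carr N" "p \<in> carr N" "q \<in> carr N" for a b p q r r'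
    using N that by (auto simp: regular_gmod_def)
  define p where "p = (\<lambda>x\<in>carr M. padd N (f x) (g x))"
  have "p \<in> carr M \<rightarrow>\<^sub>E carr N"
    using fc gc Npc(1) by (auto simp: p_def)
  moreover have "p (padd M x y) = padd N (p x) (p y)" if "x \<in> carr M" "y \<in> carr M" for x y
    using that Mc(1) Nl(1) fc gc by (simp add: p_def f'(2) g'(2))
  moreover have "p (sact M r x) = sact N r (p x)" if "x \<in> carr M" for r x
    using that Mc(2)[of x x] Nl(2)[of "f x" "g x" "f x" "f x"] fc gc by (simp add: p_def f'(3) g'(3))
  moreover have "p ` gr M j \<subseteq> gr N j" for j
  proof (rule image_subsetI)
    fix x assume x: "x \<in> gr M j"
    then have "f x \<in> gr N j" "g x \<in> gr N j" "x \<in> carr M"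
      using f'(4) g'(4) Mg by blast+
    then show "p x \<in> gr N j"
      by (simp add: p_def Ng(1))
  qed
  ultimately show "padd (HomR0 M N) f g \<in> carr (HomR0 M N)"
    by (simp add: HomR0_def mod_hom0_def mod_hom_def p_def)
  define q where "q = (\<lambda>x\<in>carr M. sact N (const c) (f x))"
  have "q \<in> carr M \<rightarrow>\<^sub>E carr N"
    using fc Npc(2) by (auto simp: q_def)
  moreover have "q (padd M x y) = padd N (q x) (q y)" if "x \<in> carr M" "y \<in> carr M" for x y
    using that Mc(1) Nl(2)[of "f x" "f y" "f x" "f x"] fc by (simp add: q_def f'(2))
  moreover have "q (sact M r x) = sact N r (q x)" if "x \<in> carr M" for r x
    using that Mc(2)[of x x] Nl(3)[of "f x" "f x" "f x" "f x"] fc by (simp add: q_def f'(3))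
  moreover have "q ` gr M j \<subseteq> gr N j" for j
  proof (rule image_subsetI)
    fix x assume x: "x \<in> gr M j"
    then have "f x \<in> gr N j" "x \<in> carr M"
      using f'(4) Mg by blast+
    then show "q x \<in> gr N j"
      by (simp add: q_def Ng(2))
  qed
  ultimately show "sact (HomR0 M N) c f \<in> carr (HomR0 M N)"
    by (simp add: HomR0_def mod_hom0_def mod_hom_def q_def)
qed

text \<open>Commutation keeps scalar multiples of homomorphisms linear; the action of constants
  turns R-submodules into k-subspaces.\<close>

locale scalar_operation = operation s
  for s :: "('n::finite, 'a::comm_ring_1) mpol \<Rightarrow> ('n, 'a) mpol \<Rightarrow> ('n, 'a) mpol" +
  assumes s_commute: "s c (s e x) = s e (s c x)" and s_const: "s (const a) x = cscale a x"
begin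

lemma stable_cscale: "stable V \<Longrightarrow> x \<in> V \<Longrightarrow> cscale a x \<in> V"
  using stable_s[of V x "const a"] by (simp add: s_const)

lemma stable_subspace: "stable V \<Longrightarrow> smod.subspace V"
  using stable_subgrp[of V] by (auto simp: smod.subspace_def subgrp_zero subgrp_add stable_cscale)

lemma closed_submod: "stable V \<Longrightarrow> closed_gmod (submod s V)"
  by (auto simp: closed_gmod_def submod_def stable_subgrp stable_s stable_cscale subgrp_add
      hcomp_add s_const hcomp_cscale)

lemma quot_carr: "carr (quot s V U) = coset U ` V"
  by (simp add: quot_def)

lemma quot_gr: "gr (quot s V U) j = coset U ` (V \<inter> hcomp j)"
  by (simp add: quot_def)

lemma quot_padd: "subgrp U \<Longrightarrow> padd (quot s V U) (coset U x) (coset U y) = coset U (x + y)"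
  by (simp add: quot_def coset_add)

lemma quot_sact: "stable U \<Longrightarrow> sact (quot s V U) c (coset U x) = coset U (s c x)"
  by (simp add: quot_def sact_coset)

lemma regular_quot:
  assumes "stable V" "stable U"
  shows "regular_gmod (quot s V U)"
proof -
  note U = stable_subgrp[OF assms(2)] and V = stable_subgrp[OF assms(1)]
  have "V \<inter> hcomp j \<subseteq> V" for j
    by simp
  then have gr: "coset U ` (V \<inter> hcomp j) \<subseteq> coset U ` V" for j
    by (rule image_mono)
  show ?thesis
    unfolding regular_gmod_def closed_gmod_def quot_carr quot_gr
    using gr
    by (auto simp: quot_padd[OF U] quot_sact[OF assms(2)] s_add s_const s_commute add_ac
        stable_s[OF assms(1)] stable_cscale[OF assms(1)] subgrp_add[OF V] hcomp_add hcomp_cscale)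
qed

end

interpretation mul: scalar_operation "(*) :: ('n::finite, 'a::comm_ring_1) mpol \<Rightarrow> _"
  by standard (simp_all add: distrib_left mult.left_commute cscale_def)

interpretation dif: scalar_operation "act :: ('n::finite, 'a::comm_ring_1) mpol \<Rightarrow> _"
  by standard (simp_all add: act_add_right act_const mult.commute flip: act_mult)

interpretation scl: operation "cscale :: 'a::comm_ring_1 \<Rightarrow> ('n::finite, 'a) mpol \<Rightarrow> _"
  by standard (rule smod.scale_right_distrib)

lemma scl_stable: "smod.subspace V \<Longrightarrow> scl.stable V"
  by (auto simp: scl.stable_def subgrp_def smod.subspace_0 smod.subspace_diff smod.subspace_scale)

section \<open>Transposing a homomorphism along the pairing\<close>

text \<open>Two graded modules that are each other's annihilators, with adjoint actions. It is
  instantiated twice, with the inverse system and the ideal in either order, so one construction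
  gives both transpositions.\<close>

locale apolar_pair = s: scalar_operation s + s': scalar_operation s'
  for s s' :: "('n::finite, 'k::field_char_0) mpol \<Rightarrow> ('n, 'k) mpol \<Rightarrow> ('n, 'k) mpol" +
  fixes V V' :: "('n, 'k) mpol set"
  assumes adj: "pair (s' c u) F = pair u (s c F)"
    and perp: "V' = {u. \<forall>F\<in>V. pair u F = 0}"
    and biperp: "V = {F. \<forall>u\<in>V'. pair u F = 0}"
    and stable: "s.stable V"
    and hpart_V: "F \<in> V \<Longrightarrow> hpart j F \<in> V"
    and hpart_V': "u \<in> V' \<Longrightarrow> hpart j u \<in> V'"
begin

lemma pair_zero: "u \<in> V' \<Longrightarrow> F \<in> V \<Longrightarrow> pair u F = 0"
  using perp by blast

lemma stable': "s'.stable V'"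
  unfolding s'.stable_def subgrp_def using s.stable_s[OF stable]
  by (subst (1 2 3 4 5 6) perp) (auto simp: pair_diff_left adj)

lemmas sV = s.stable_subgrp[OF stable] and sV' = s'.stable_subgrp[OF stable']

text \<open>Once nonempty, the solution set is a full coset of \<open>V'\<close>, the annihilator of
  \<open>V\<close>, so no representative has to be chosen. The minus sign makes the two graphs
  orthogonal over the dual numbers.\<close>

definition transpose :: "(('n, 'k) mpol \<Rightarrow> ('n, 'k) mpol set) \<Rightarrow> (('n, 'k) mpol \<Rightarrow> ('n, 'k) mpol set)"
  where "transpose f = (\<lambda>u\<in>V'. {w. \<forall>F\<in>V. \<forall>G\<in>f F. pair w F = - pair u G})"

context
  fixes f
  assumes f: "f \<in> mod_hom0 (submod s V) (quot s UNIV V)"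
begin

interpretation f: coset_homomorphism s V UNIV V f
  using f stable by unfold_locales (simp_all add: s.mod_hom0_iff)

lemma pair_f_eq:
  "u \<in> V' \<Longrightarrow> F \<in> V \<Longrightarrow> G \<in> f F \<Longrightarrow> H \<in> f F \<Longrightarrow> pair u G = pair u H"
  using f.mem_iff[of F H G] pair_zero[of u "G - H"] by (simp add: pair_diff_right)

lemma f_graded:
  "F \<in> V \<Longrightarrow> F \<in> hcomp j \<Longrightarrow> \<exists>G\<in>hcomp j. G \<in> f F"
  using f stable coset_self[OF sV] by (fastforce simp: s.mod_hom0_iff)

text \<open>\<open>f\<close> respects degrees, so a member of \<open>f F\<close> can be assembled
  from homogeneous members of the \<open>f (hpart i F)\<close>, and \<open>u\<close> sees only the
  one in degree \<open>j\<close>.\<close>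

lemma pair_f_hpart:
  assumes u: "u \<in> V'" "u \<in> hcomp j" and F: "F \<in> V" and G: "G \<in> f F"
    and H: "H \<in> f (hpart j F)"
  shows "pair u G = pair u H"
proof -
  obtain N where N: "(\<Sum>i\<le>N. hpart i F) = F" "\<And>i. i > N \<Longrightarrow> hpart i F = 0"
    using decompose_hparts[of F] by metis
  have "\<exists>a. a \<in> hcomp i \<and> a \<in> f (hpart i F)" for i
    using f_graded hpart_V[OF F] hpart_hcomp by blast
  then obtain a where a: "\<And>i. a i \<in> hcomp i" "\<And>i. a i \<in> f (hpart i F)"
    by metis
  have "(\<Sum>i\<le>N. a i) \<in> f F"
    using f.sum[of "{..N}" "\<lambda>i. hpart i F" a] a(2) hpart_V[OF F] by (simp add: N(1))
  then have "pair u G = pair u (\<Sum>i\<le>N. a i)"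
    using pair_f_eq[OF u(1) F G] by blast
  also have "\<dots> = (\<Sum>i\<le>N. if i = j then pair u (a j) else 0)"
    unfolding pair_sum_right
    by (intro sum.cong) (use pair_hcomp_neq[OF u(2) a(1)] in auto)
  also have "\<dots> = pair u (a j)"
  \<comment> \<open>Beyond the top degree of \<open>F\<close> the component is 0, so
    \<open>a j\<close> lies in \<open>f 0 = V\<close> and pairs to zero with
    \<open>u\<close>.\<close>
  proof (cases "j \<le> N")
    case False
    then have "a j \<in> V"
      using N(2)[of j] a(2)[of j] f.zero by simp
    then show ?thesis
      using False u(1) pair_zero by simp
  qed simp
  also have "\<dots> = pair u H"
    using pair_f_eq[OF u(1) hpart_V[OF F] a(2) H] .
  finally show ?thesis .
qed

text \<open>F \<mapsto> <u, f F> is a well-defined functional on \<open>V\<close> because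
  \<open>u\<close> kills \<open>V\<close>. It is extended to all polynomials and represented in
  degree \<open>j\<close>; by \<open>pair_f_hpart\<close> the values on degree \<open>j\<close>
  already determine it.\<close>

lemma transpose_ex_homogeneous:
  assumes u: "u \<in> V'" "u \<in> hcomp j"
  shows "\<exists>w\<in>hcomp j. \<forall>F\<in>V. \<forall>G\<in>f F. pair w F = - pair u G"
proof -
  define l where "l F = pair u (SOME G. G \<in> f F)" for F
  have l: "l F = pair u G" if "F \<in> V" "G \<in> f F" for F G
    unfolding l_def using that pair_f_eq[OF u(1) that(1) _ that(2)] someI[of
      "\<lambda>G. G \<in> f F" G] by blast
  have ex: "\<exists>G. G \<in> f F" if "F \<in> V" for F
    using f.ex that by metis
  have "l (x + y) = l x + l y" if xy: "x \<in> V" "y \<in> V" for x y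
  proof -
    obtain a b where ab: "a \<in> f x" "b \<in> f y"
      using ex xy by blast
    show ?thesis
      using l[OF subgrp_add[OF sV xy] f.add[OF xy ab]] l[OF xy(1) ab(1)] l[OF xy(2) ab(2)]
      by (simp add: pair_add_right)
  qed
  moreover have "l (cscale c x) = c * l x" if x: "x \<in> V" for c x
  proof -
    obtain a where a: "a \<in> f x"
      using ex x by blast
    have "cscale c a \<in> f (cscale c x)"
      using f.act[OF x a, of "const c"] by (simp add: s.s_const)
    then show ?thesis
      using l[OF s.stable_cscale[OF stable x]] l[OF x a] by (simp add: pair_cscale_right)
  qed
  ultimately obtain g where g: "functional g" "\<And>x. x \<in> V \<Longrightarrow> g x = l x"
    using functional_extension[OF s.stable_subspace[OF stable]] by metis
  let ?w = "- represent j g"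
  have "pair ?w F = - pair u G" if F: "F \<in> V" and G: "G \<in> f F" for F G
  proof -
    obtain H where H: "H \<in> f (hpart j F)"
      using ex hpart_V[OF F] by blast
    have "pair ?w F = - pair (hpart j F) (represent j g)"
      using pair_hpart_left[OF represent_hcomp] by (metis pair_commute pair_uminus_left)
    also have "\<dots> = - l (hpart j F)"
      by (simp add: pair_represent[OF g(1)] g(2) hpart_V[OF F])
    also have "\<dots> = - pair u G"
      using pair_f_hpart[OF u F G H] l[OF hpart_V[OF F] H] by simp
    finally show ?thesis .
  qed
  moreover have "?w \<in> hcomp j"
    using represent_hcomp[of j g] by (simp add: hcomp_iff)
  ultimately show ?thesis
    by blast
qed

lemma transpose_mem_iff:
  "u \<in> V' \<Longrightarrow> w \<in> transpose f u \<longleftrightarrow> (\<forall>F\<in>V. \<forall>G\<in>f F. pair w F = - pair u G)"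
  by (simp add: transpose_def)

lemma transpose_coset:
  assumes u: "u \<in> V'" and w: "w \<in> transpose f u"
  shows "transpose f u = coset V' w"
proof -
  have "z \<in> transpose f u \<longleftrightarrow> z - w \<in> V'" for z
  proof
    assume z: "z \<in> transpose f u"
    have "pair (z - w) F = 0" if F: "F \<in> V" for F
    proof -
      obtain G where "G \<in> f F"
        using f.ex F by metis
      with z w F show ?thesis
        by (simp add: transpose_mem_iff[OF u] pair_diff_left)
    qed
    then show "z - w \<in> V'"
      using perp by blast
  next
    assume "z - w \<in> V'"
    then have "pair z F = pair w F" if "F \<in> V" for F
      using pair_zero[of "z - w" F] that by (simp add: pair_diff_left)
    with w show "z \<in> transpose f u"
      by (simp add: transpose_mem_iff[OF u])
  qed
  then show ?thesis
    unfolding set_eq_iff mem_coset by blast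
qed

lemma transpose_ex:
  assumes u: "u \<in> V'"
  shows "\<exists>w. w \<in> transpose f u"
proof -
  obtain N where N: "(\<Sum>i\<le>N. hpart i u) = u"
    using decompose_hparts[of u] by metis
  have "\<exists>w. \<forall>F\<in>V. \<forall>G\<in>f F. pair w F = - pair (hpart i u) G" for i
    using transpose_ex_homogeneous[OF hpart_V'[OF u] hpart_hcomp] by blast
  then obtain w where w: "\<And>i F G. F \<in> V \<Longrightarrow> G \<in> f F \<Longrightarrow> pair (w i) F = - pair (hpart i u) G"
    by metis
  have "pair (\<Sum>i\<le>N. w i) F = - pair u G" if "F \<in> V" "G \<in> f F" for F G
  proof -
    have "pair (\<Sum>i\<le>N. w i) F = - pair (\<Sum>i\<le>N. hpart i u) G"
      by (simp add: pair_sum_left w[OF that] sum_negf)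
    then show ?thesis
      by (simp add: N)
  qed
  then show ?thesis
    using transpose_mem_iff[OF u] by blast
qed

lemma transpose_hom: "transpose f \<in> mod_hom0 (submod s' V') (quot s' UNIV V')"
  unfolding s'.mod_hom0_iff[OF stable' stable'] s'.coset_hom_def
proof (intro conjI ballI allI)
  show "transpose f \<in> extensional V'"
    by (simp add: transpose_def)
next
  fix u assume "u \<in> V'"
  then show "\<exists>w\<in>UNIV. transpose f u = coset V' w"
    using transpose_ex transpose_coset by blast
next
  fix u v a b assume uv: "u \<in> V'" "v \<in> V'" and ab: "a \<in> transpose f u" "b \<in> transpose f v"
  show "a + b \<in> transpose f (u + v)"
    using ab unfolding transpose_mem_iff[OF uv(1)] transpose_mem_iff[OF uv(2)]
      transpose_mem_iff[OF subgrp_add[OF sV' uv]]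
    by (simp add: pair_add_left)
next
  fix c u a assume u: "u \<in> V'" and a: "a \<in> transpose f u"
  \<comment> \<open>Adjointness moves \<open>c\<close> onto F, linearity of \<open>f\<close> passes
    it on to G, and a second use of adjointness moves it to \<open>u\<close>.\<close>
  have "pair (s' c a) F = - pair (s' c u) G" if "F \<in> V" "G \<in> f F" for F G
    using a f.act[OF that, of c] s.stable_s[OF stable that(1), of c]
    by (simp add: transpose_mem_iff[OF u] adj)
  then show "s' c a \<in> transpose f (s' c u)"
    using transpose_mem_iff[OF s'.stable_s[OF stable' u]] by blast
next
  fix j u assume "u \<in> V' \<inter> hcomp j"
  then show "\<exists>w\<in>UNIV \<inter> hcomp j. transpose f u = coset V' w"
    using transpose_ex_homogeneous[of u j] transpose_mem_iff[of u] transpose_coset[of u] by blast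
qed

end

end

section \<open>Restriction to one degree and passage to the conormal module\<close>

context scalar_operation
begin

lemma coset_hom_cscale: "coset_hom V W U f \<Longrightarrow> scl.coset_hom V W U f"
  unfolding coset_hom_def scl.coset_hom_def by (metis s_const)

context
  fixes V :: "('n, 'a) mpol set" and d :: nat
  assumes V: "stable V"
begin

abbreviation "RHom \<equiv> HomR0 (submod s V) (quot s UNIV V)"
abbreviation "KHom \<equiv> Homk (submod cscale (V \<inter> hcomp d)) (quot cscale (hcomp d) (V \<inter> hcomp d))"

lemma stable_piece: "scl.stable (V \<inter> hcomp d)"
  by (rule scl_stable) (rule smod.subspace_inter[OF stable_subspace[OF V] subspace_hcomp])

lemma KHom_iff:
  "g \<in> carr KHom \<longleftrightarrow> scl.coset_hom (V \<inter> hcomp d) (hcomp d) (V \<inter> hcomp d) g"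
  by (simp add: Homk_def scl.mod_hom_iff stable_piece)

lemma RHom_iff: "f \<in> carr RHom \<longleftrightarrow>
    coset_hom V UNIV V f \<and> (\<forall>j. \<forall>x\<in>V \<inter> hcomp j. \<exists>w\<in>hcomp j. f x = coset V w)"
  by (simp add: HomR0_def mod_hom0_iff V)

lemma restr_deg_apply:
  "f \<in> carr RHom \<Longrightarrow> v \<in> V \<Longrightarrow> v \<in> hcomp d \<Longrightarrow> restr_deg d V (carr RHom) f v = f v \<inter> hcomp d"
  by (simp add: restr_deg_def)

lemma restr_deg_KHom:
  assumes f: "f \<in> carr RHom"
  shows "restr_deg d V (carr RHom) f \<in> carr KHom"
proof -
  interpret f: coset_homomorphism s V UNIV V f
    using f V by unfold_locales (simp_all add: RHom_iff)
  let ?g = "restr_deg d V (carr RHom) f"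
  have g: "?g v = f v \<inter> hcomp d" if "v \<in> V" "v \<in> hcomp d" for v
    using restr_deg_apply[OF f that] .
  show ?thesis
    unfolding KHom_iff scl.coset_hom_def
  proof (intro conjI ballI allI)
    show "?g \<in> extensional (V \<inter> hcomp d)"
      using f by (simp add: restr_deg_def)
  next
    fix x assume x: "x \<in> V \<inter> hcomp d"
    then obtain w where w: "w \<in> hcomp d" "f x = coset V w"
      using f RHom_iff by blast
    with x have "?g x = coset (V \<inter> hcomp d) w"
      using coset_Int_hcomp[OF w(1)] g by simp
    with w show "\<exists>w\<in>hcomp d. ?g x = coset (V \<inter> hcomp d) w"
      by blast
  next
    fix x y a b assume "x \<in> V \<inter> hcomp d" "y \<in> V \<inter> hcomp d" "a \<in> ?g x" "b \<in> ?g y"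
    then show "a + b \<in> ?g (x + y)"
      using f.add[of x y a b] by (auto simp: g hcomp_add subgrp_add[OF f.sV])
  next
    fix c x a assume "x \<in> V \<inter> hcomp d" "a \<in> ?g x"
    then show "cscale c a \<in> ?g (cscale c x)"
      using f.act[of x a "const c"] by (auto simp: g s_const hcomp_cscale stable_cscale[OF V])
  qed
qed

lemma RHom_closed:
  assumes "f \<in> carr RHom"
  shows "g \<in> carr RHom \<Longrightarrow> padd RHom f g \<in> carr RHom" and "sact RHom c f \<in> carr RHom"
  using HomR0_closed[OF closed_submod[OF V] regular_quot[OF stable_UNIV V] assms] assms by blast+

text \<open>The restricted values are cosets of the degree \<open>d\<close> piece while
  \<open>inj\<close> compares cosets of \<open>V\<close>; with homogeneous representatives equality
  of the former implies equality of the latter.\<close>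

lemma restr_deg_mono:
  assumes inj: "\<And>f g. f \<in> carr RHom \<Longrightarrow> g \<in> carr RHom \<Longrightarrow>
      (\<And>v. v \<in> V \<inter> hcomp d \<Longrightarrow> f v = g v) \<Longrightarrow> f = g"
  shows "mod_mono (restr_deg d V (carr RHom)) RHom KHom"
proof -
  let ?r = "restr_deg d V (carr RHom)"
  have sV: "subgrp V"
    using V stable_subgrp by blast
  have rep: "\<exists>w\<in>hcomp d. f v = coset V w"
    if "f \<in> carr RHom" "v \<in> V \<inter> hcomp d" for f v
    using that RHom_iff by blast
  have ext: "?r f v = undefined" if "f \<in> carr RHom" "v \<notin> V \<inter> hcomp d" for f v
    using that by (auto simp: restr_deg_def)
  have "?r (padd RHom f g) = padd KHom (?r f) (?r g)"
    if f: "f \<in> carr RHom" and g: "g \<in> carr RHom" for f g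
  proof
    fix v
    show "?r (padd RHom f g) v = padd KHom (?r f) (?r g) v"
    proof (cases "v \<in> V \<inter> hcomp d")
      case False
      then show ?thesis
        using ext[OF RHom_closed(1)[OF f g] False] by (auto simp: Homk_def submod_def)
    next
      case True
      obtain a b where ab: "a \<in> hcomp d" "b \<in> hcomp d" "f v = coset V a" "g v = coset V b"
        using rep[OF f True] rep[OF g True] by blast
      have "padd RHom f g v = coset V (a + b)"
        using True ab by (simp add: HomR0_def submod_def quot_padd[OF sV])
      then have "?r (padd RHom f g) v = coset (V \<inter> hcomp d) (a + b)"
        using True restr_deg_apply[OF RHom_closed(1)[OF f g]] by (simp add: coset_Int_hcomp ab hcomp_add)
      also have "\<dots> = padd (quot cscale (hcomp d) (V \<inter> hcomp d)) (?r f v) (?r g v)"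
        using restr_deg_apply[OF f, of v] restr_deg_apply[OF g, of v] True
        by (simp add: ab coset_Int_hcomp) (simp add: quot_def coset_add[OF subgrp_hcomp[OF sV]])
      also have "\<dots> = padd KHom (?r f) (?r g) v"
        using True by (simp add: Homk_def submod_def)
      finally show ?thesis .
    qed
  qed
  moreover have "?r (sact RHom c f) = sact KHom c (?r f)" if f: "f \<in> carr RHom" for c f
  proof
    fix v
    show "?r (sact RHom c f) v = sact KHom c (?r f) v"
    proof (cases "v \<in> V \<inter> hcomp d")
      case False
      then show ?thesis
        using ext[OF RHom_closed(2)[OF f] False] by (auto simp: Homk_def submod_def)
    next
      case True
      obtain a where a: "a \<in> hcomp d" "f v = coset V a"
        using rep[OF f True] by blast
      have "sact RHom c f v = coset V (cscale c a)"
        using True a by (simp add: HomR0_def submod_def quot_sact[OF V] s_const)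
      then have "?r (sact RHom c f) v = coset (V \<inter> hcomp d) (cscale c a)"
        using True restr_deg_apply[OF RHom_closed(2)[OF f]] by (simp add: coset_Int_hcomp a hcomp_cscale)
      also have "\<dots> = sact (quot cscale (hcomp d) (V \<inter> hcomp d)) c (?r f v)"
        using restr_deg_apply[OF f, of v] True
        by (simp add: a coset_Int_hcomp) (simp add: quot_def scl.sact_coset[OF stable_piece])
      also have "\<dots> = sact KHom c (?r f) v"
        using True by (simp add: Homk_def submod_def)
      finally show ?thesis .
    qed
  qed
  moreover have "?r \<in> carr RHom \<rightarrow>\<^sub>E carr KHom"
    using restr_deg_KHom by (auto simp: PiE_iff restr_deg_def)
  moreover have "inj_on ?r (carr RHom)"
  proof (rule inj_onI)
    fix f g assume f: "f \<in> carr RHom" and g: "g \<in> carr RHom" and eq: "?r f = ?r g"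
    show "f = g"
    proof (rule inj[OF f g])
      fix v assume v: "v \<in> V \<inter> hcomp d"
      obtain a b where ab: "a \<in> hcomp d" "b \<in> hcomp d" "f v = coset V a" "g v = coset V b"
        using rep[OF f v] rep[OF g v] by blast
      have "coset (V \<inter> hcomp d) a = coset (V \<inter> hcomp d) b"
        using fun_cong[OF eq, of v] v restr_deg_apply[OF f] restr_deg_apply[OF g]
        by (simp add: ab coset_Int_hcomp)
      then have "a - b \<in> V"
        using coset_eq_iff[OF subgrp_hcomp[OF sV]] by blast
      then show "f v = g v"
        using ab coset_eq_iff[OF sV] by simp
    qed
  qed
  ultimately show ?thesis
    by (simp add: mod_mono_def mod_hom_def)
qed

end

text \<open>A homomorphism on \<open>V\<close> that is trivial on \<open>J\<close> is constant on
  cosets of \<open>J\<close> and therefore descends; by \<open>J0\<close> this applies to all of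
  them, which gives surjectivity.\<close>

lemma pull_quot_iso:
  assumes V: "stable V" and W: "stable W" and J: "stable J" and U: "stable U"
    and J0: "\<And>g v. g \<in> mod_hom0 (submod s V) (quot s W U) \<Longrightarrow> v \<in> J \<Longrightarrow> g v = U"
    and JV: "J \<subseteq> V"
  shows "mod_iso (pull_quot V J (carr (HomR0 (quot s V J) (quot s W U))))
    (HomR0 (quot s V J) (quot s W U)) (HomR0 (submod s V) (quot s W U))"
proof -
  let ?N = "quot s W U" and ?Q = "quot s V J"
  let ?H = "HomR0 ?Q ?N"
  let ?p = "pull_quot V J (carr ?H)"
  note sV = stable_subgrp[OF V] and sJ = stable_subgrp[OF J] and sU = stable_subgrp[OF U]
  have closed: "padd ?H f g \<in> carr ?H" "sact ?H c f \<in> carr ?H"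
    if "f \<in> carr ?H" "g \<in> carr ?H" for c f g
    using HomR0_closed[of ?Q ?N f g] regular_quot that V W U J by (auto simp: regular_gmod_def)
  have p: "?p f v = f (coset J v)" if "f \<in> carr ?H" "v \<in> V" for f v
    using that by (simp add: pull_quot_def)
  have px: "?p f \<in> extensional V" if "f \<in> carr ?H" for f
    using that by (simp add: pull_quot_def)
  have H: "f \<in> coset J ` V \<rightarrow>\<^sub>E coset U ` W"
    "\<And>x y. x \<in> V \<Longrightarrow> y \<in> V \<Longrightarrow> f (coset J (x + y)) = padd ?N (f (coset J x)) (f (coset J y))"
    "\<And>c x. x \<in> V \<Longrightarrow> f (coset J (s c x)) = sact ?N c (f (coset J x))"
    "\<And>j x. x \<in> V \<inter> hcomp j \<Longrightarrow> f (coset J x) \<in> gr ?N j"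
    if "f \<in> carr ?H" for f
  proof -
    have *: "f \<in> carr ?Q \<rightarrow>\<^sub>E carr ?N"
      "\<forall>x\<in>carr ?Q. \<forall>y\<in>carr ?Q. f (padd ?Q x y) = padd ?N (f x) (f y)"
      "\<forall>c. \<forall>x\<in>carr ?Q. f (sact ?Q c x) = sact ?N c (f x)"
      "\<forall>j. f ` gr ?Q j \<subseteq> gr ?N j"
      using that by (simp_all add: HomR0_def mod_hom0_def mod_hom_def)
    show "f \<in> coset J ` V \<rightarrow>\<^sub>E coset U ` W"
      using *(1) by (simp add: quot_carr)
    show "f (coset J (x + y)) = padd ?N (f (coset J x)) (f (coset J y))" if "x \<in> V" "y \<in> V" for x y
      using *(2) that by (simp add: quot_carr quot_padd[OF sJ])
    show "f (coset J (s c x)) = sact ?N c (f (coset J x))" if "x \<in> V" for c x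
      using *(3) that by (simp add: quot_carr quot_sact[OF J])
    show "f (coset J x) \<in> gr ?N j" if "x \<in> V \<inter> hcomp j" for x j
      using *(4) that by (force simp: quot_gr)
  qed
  have G: "g \<in> carr (HomR0 (submod s V) ?N) \<longleftrightarrow> g \<in> V \<rightarrow>\<^sub>E coset U ` W \<and>
      (\<forall>x\<in>V. \<forall>y\<in>V. g (x + y) = padd ?N (g x) (g y)) \<and>
      (\<forall>c. \<forall>x\<in>V. g (s c x) = sact ?N c (g x)) \<and> (\<forall>j. g ` (V \<inter> hcomp j) \<subseteq> gr ?N j)" for g
    by (simp add: HomR0_def mod_hom0_def mod_hom_def submod_def quot_carr)
  have pG: "?p f \<in> carr (HomR0 (submod s V) ?N)" if f: "f \<in> carr ?H" for f
    unfolding G using px[OF f] H[OF f] subgrp_add[OF sV] stable_s[OF V]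
    by (auto simp: p[OF f] PiE_iff)
  have "?p (padd ?H f g) = padd (HomR0 (submod s V) ?N) (?p f) (?p g)"
    if fg: "f \<in> carr ?H" "g \<in> carr ?H" for f g
  proof
    fix v
    show "?p (padd ?H f g) v = padd (HomR0 (submod s V) ?N) (?p f) (?p g) v"
      using closed(1)[OF fg] fg by (cases "v \<in> V") (auto simp: pull_quot_def HomR0_def submod_def quot_carr)
  qed
  moreover have "?p (sact ?H c f) = sact (HomR0 (submod s V) ?N) c (?p f)" if f: "f \<in> carr ?H" for c f
  proof
    fix v
    show "?p (sact ?H c f) v = sact (HomR0 (submod s V) ?N) c (?p f) v"
      using closed(2)[OF f f] f by (cases "v \<in> V") (auto simp: pull_quot_def HomR0_def submod_def quot_carr)
  qed
  moreover have "?p \<in> carr ?H \<rightarrow>\<^sub>E carr (HomR0 (submod s V) ?N)"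
    using pG by (simp add: PiE_iff pull_quot_def)
  moreover have "inj_on ?p (carr ?H)"
  proof (rule inj_onI)
    fix f g assume f: "f \<in> carr ?H" and g: "g \<in> carr ?H" and eq: "?p f = ?p g"
    show "f = g"
    proof (rule PiE_ext[OF H(1)[OF f] H(1)[OF g]])
      fix X assume "X \<in> coset J ` V"
      then show "f X = g X"
        using fun_cong[OF eq] p[OF f] p[OF g] by auto
    qed
  qed
  moreover have "\<exists>f\<in>carr ?H. g = ?p f" if g: "g \<in> carr (HomR0 (submod s V) ?N)" for g
  proof -
    have g0: "g \<in> mod_hom0 (submod s V) ?N"
      using g by (simp add: HomR0_def)
    interpret g: coset_homomorphism s V W U g
      using g0 V U by unfold_locales (simp_all add: mod_hom0_iff)
    have geq: "g x = g y" if xy: "x \<in> V" "y \<in> V" "x - y \<in> J" for x y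
    proof -
      obtain a b where ab: "a \<in> g x" "b \<in> g y"
        using g.ex xy by metis
      have "a - b \<in> U"
        using g.diff[OF xy(1,2) ab] J0[OF g0 xy(3)] by simp
      moreover have "g x = coset U a" "g y = coset U b"
        using coset_hom_coset[OF g.hom sU] xy ab by auto
      ultimately show ?thesis
        using coset_eq_iff[OF sU] by simp
    qed
    \<comment> \<open>A preimage of the coset is chosen arbitrarily; \<open>geq\<close> makes the
      value independent of it.\<close>
    define f where "f = (\<lambda>X\<in>coset J ` V. g (SOME v. v \<in> V \<and> coset J v = X))"
    have f: "f (coset J v) = g v" if "v \<in> V" for v
    proof -
      let ?w = "SOME w. w \<in> V \<and> coset J w = coset J v"
      have "?w \<in> V \<and> coset J ?w = coset J v"
        by (rule someI[of _ v]) (simp add: that)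
      then have "g ?w = g v"
        using geq that coset_eq_iff[OF sJ] by blast
      then show ?thesis
        using that by (simp add: f_def)
    qed
    have g': "g \<in> V \<rightarrow>\<^sub>E coset U ` W"
      "\<And>x y. x \<in> V \<Longrightarrow> y \<in> V \<Longrightarrow> g (x + y) = padd ?N (g x) (g y)"
      "\<And>c x. x \<in> V \<Longrightarrow> g (s c x) = sact ?N c (g x)"
        "\<And>j. g ` (V \<inter> hcomp j) \<subseteq> gr ?N j"
      using g unfolding G by simp_all
    have fP: "f \<in> coset J ` V \<rightarrow>\<^sub>E coset U ` W"
    proof (rule PiE_I)
      fix X assume "X \<in> coset J ` V"
      then show "f X \<in> coset U ` W"
        using f PiE_mem[OF g'(1)] by auto
    qed (simp add: f_def)
    have "f \<in> carr ?H"
      using fP g'(4)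
      by (auto simp: HomR0_def mod_hom0_def mod_hom_def quot_carr quot_gr quot_padd[OF sJ] quot_sact[OF J]
          f g'(2,3) subgrp_add[OF sV] stable_s[OF V] image_subset_iff)
    moreover have "g = ?p f"
      using g'(1) p[OF \<open>f \<in> carr ?H\<close>] f px[OF \<open>f \<in> carr ?H\<close>]
      by (intro extensionalityI[of _ V]) (auto simp: PiE_iff)
    ultimately show ?thesis
      by blast
  qed
  ultimately show ?thesis
    using pG unfolding mod_iso_def mod_hom_def bij_betw_def by blast
qed

end

text \<open>\<open>tangent_space\<close> changes only the carrier of the Hom space, so the
  operations agree and only the image of \<open>r\<close> matters.\<close>

lemma mod_iso_tangent_space:
  assumes "mod_mono r H (Homk (submod cscale V) (quot cscale (hcomp d) V))"
    and "r ` carr H = carr (tangent_space d X V)"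
  shows "mod_iso r H (tangent_space d X V)"
  using assms
  by (auto simp: mod_mono_def mod_iso_def bij_betw_def mod_hom_def tangent_space_def grass_tangent_def
      PiE_iff)

section \<open>Dual numbers and the tangent space of the Grassmannian\<close>

lemma dual_parts [simp]:
  "dre (0 :: 'a::comm_ring_1 dual) = 0" "deps (0 :: 'a dual) = 0"
  "dre (1 :: 'a dual) = 1" "deps (1 :: 'a dual) = 0"
  "dre (x + y) = dre x + dre (y :: 'a dual)" "deps (x + y) = deps x + deps y"
  "dre (x - y) = dre x - dre y" "deps (x - y) = deps x - deps y"
  "dre (- x) = - dre x" "deps (- x) = - deps x"
  "dre (x * y) = dre x * dre y" "deps (x * y) = dre x * deps y + deps x * dre y"
  by (simp_all add: zero_dual_def one_dual_def plus_dual_def minus_dual_def uminus_dual_def times_dual_def)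

lemma dual_sum [simp]:
  fixes f :: "'b \<Rightarrow> 'a::comm_ring_1 dual"
  shows "dre (sum f X) = (\<Sum>x\<in>X. dre (f x))" and "deps (sum f X) = (\<Sum>x\<in>X. deps (f x))"
  by (induction X rule: infinite_finite_induct) simp_all

lemma dual_of_nat [simp]:
  "dre (of_nat n :: 'a::comm_ring_1 dual) = of_nat n" "deps (of_nat n :: 'a dual) = 0"
  by (induction n) simp_all

lemma dual_eq_iff: "x = y \<longleftrightarrow> dre x = dre y \<and> deps x = deps y"
  by (cases x; cases y) simp

lemma lookup_re_part [simp]: "lookup (re_part P) m = dre (lookup P m)"
  by (auto simp: re_part_def map.rep_eq when_def)

lemma lookup_eps_part [simp]: "lookup (eps_part P) m = deps (lookup P m)"
  by (auto simp: eps_part_def map.rep_eq when_def)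

lemma poly_dual_eqI: "re_part P = re_part Q \<Longrightarrow> eps_part P = eps_part Q \<Longrightarrow> P = Q"
  by (rule poly_mapping_eqI) (metis dual_eq_iff lookup_re_part lookup_eps_part)

lemma parts_add: "re_part (P + Q) = re_part P + re_part Q" "eps_part (P + Q) = eps_part P + eps_part Q"
  by (rule poly_mapping_eqI, simp add: lookup_add)+

lemma parts_diff: "re_part (P - Q) = re_part P - re_part Q" "eps_part (P - Q) = eps_part P - eps_part Q"
  by (rule poly_mapping_eqI, simp add: lookup_minus)+

lemma parts_zero [simp]: "re_part 0 = 0" "eps_part 0 = 0"
  by (rule poly_mapping_eqI, simp)+

lemma parts_sum:
  "re_part (sum f X) = (\<Sum>x\<in>X. re_part (f x))" "eps_part (sum f X) = (\<Sum>x\<in>X. eps_part (f x))"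
  by (rule poly_mapping_eqI, simp add: lookup_sum)+

lemma parts_cscale: "re_part (cscale c P) = cscale (dre c) (re_part P)"
  "eps_part (cscale c P) = cscale (dre c) (eps_part P) + cscale (deps c) (re_part P)"
  by (rule poly_mapping_eqI, simp add: lookup_add)+

lemma parts_single:
  "re_part (single m 1) = single m 1" "eps_part (single m 1) = 0"
  by (rule poly_mapping_eqI, simp add: lookup_single when_def)+

lemma parts_hcomp:
  "P \<in> hcomp j \<longleftrightarrow> re_part P \<in> hcomp j \<and> eps_part P \<in> hcomp j"
  by (auto simp: hcomp_iff dual_eq_iff)

lemma parts_act:
  "re_part (act U P) = act (re_part U) (re_part P)"
  "eps_part (act U P) = act (re_part U) (eps_part P) + act (eps_part U) (re_part P)"
proof -
  have K: "finite (keys U)" "keys (re_part U) \<subseteq> keys U"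
    "keys (eps_part U) \<subseteq> keys U"
    by (auto simp: in_keys_iff)
  show "re_part (act U P) = act (re_part U) (re_part P)"
    by (rule poly_mapping_eqI) (simp add: lookup_act[OF K(1,2)] lookup_act[OF K(1) subset_refl])
  show "eps_part (act U P) = act (re_part U) (eps_part P) + act (eps_part U) (re_part P)"
    by (rule poly_mapping_eqI)
      (simp add: lookup_act[OF K(1,2)] lookup_act[OF K(1,3)] lookup_act[OF K(1) subset_refl] lookup_add
        distrib_right sum.distrib)
qed

lemma parts_pair:
  "dre (pair U P) = pair (re_part U) (re_part P)"
  "deps (pair U P) = pair (re_part U) (eps_part P) + pair (eps_part U) (re_part P)"
  by (simp_all add: pair_def flip: lookup_re_part lookup_eps_part lookup_add parts_act)

definition dmk :: "('n::finite, 'a::comm_ring_1) mpol \<Rightarrow> ('n, 'a) mpol \<Rightarrow> ('n, 'a dual) mpol"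
  where "dmk F G = Poly_Mapping.map (\<lambda>c. Dual c 0) F + Poly_Mapping.map (\<lambda>c. Dual 0 c) G"

lemma dmk_parts [simp]: "re_part (dmk F G) = F" "eps_part (dmk F G) = G"
  by (rule poly_mapping_eqI, simp add: dmk_def lookup_add map.rep_eq when_def)+

lemma dmk_collapse: "dmk (re_part P) (eps_part P) = P"
  by (rule poly_dual_eqI) simp_all

lemma dmk_add: "dmk F G + dmk F' G' = dmk (F + F') (G + G')"
  by (rule poly_dual_eqI) (simp_all add: parts_add)

lemma dmk_cscale: "cscale (Dual c 0) (dmk F G) = dmk (cscale c F) (cscale c G)"
  by (rule poly_dual_eqI) (simp_all add: parts_cscale)

lemma eps_cscale: "cscale (Dual 0 1) P = dmk 0 (re_part P)"
  by (rule poly_dual_eqI) (simp_all add: parts_cscale)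

lemma dmk_tangent_graph: "dmk F G \<in> tangent_graph V f \<longleftrightarrow> F \<in> V \<and> G \<in> f F"
  by (simp add: tangent_graph_def)

text \<open>Scaling F + eps G by a + b eps adds b F to the eps-part. As F lies in \<open>V\<close>
  and the values of \<open>f\<close> are cosets of \<open>V\<close>, this does not leave the graph;
  so linearity over k yields linearity over the dual numbers.\<close>

lemma subspace_tangent_graph:
  assumes "coset_homomorphism cscale V W V f"
  shows "smod.subspace (tangent_graph V f)"
proof -
  interpret f: coset_homomorphism cscale V W V f
    by (rule assms)
  show ?thesis
    unfolding smod.subspace_def
  proof (intro conjI ballI allI)
    show "0 \<in> tangent_graph V f"
      using subgrp_zero[OF f.sV] by (simp add: tangent_graph_def f.zero)
  next
    fix P Q assume "P \<in> tangent_graph V f" "Q \<in> tangent_graph V f"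
    then show "P + Q \<in> tangent_graph V f"
      by (simp add: tangent_graph_def parts_add f.add subgrp_add[OF f.sV])
  next
    fix c P assume P: "P \<in> tangent_graph V f"
    let ?F = "re_part P" and ?G = "eps_part P"
    have FG: "?F \<in> V" "?G \<in> f ?F"
      using P by (simp_all add: tangent_graph_def)
    have cF: "cscale (dre c) ?F \<in> V" "cscale (deps c) ?F \<in> V"
      using FG(1) by (rule scl.stable_s[OF f.V])+
    have "cscale (dre c) ?G + cscale (deps c) ?F \<in> f (cscale (dre c) ?F)"
      using f.mem_iff[OF cF(1) f.act[OF FG]] cF(2) by simp
    then show "cscale c P \<in> tangent_graph V f"
      by (simp add: tangent_graph_def parts_cscale cF)
  qed
qed

lemma grass_subset:
  assumes "M \<in> grass d t"
  shows "M \<subseteq> hcomp d"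
proof
  obtain N where N: "smod.subspace N" "{x + y |x y. x \<in> M \<and> y \<in> N} = hcomp d"
    using assms by (auto simp: grass_def)
  fix P assume "P \<in> M"
  then have "P + 0 \<in> {x + y |x y. x \<in> M \<and> y \<in> N}"
    using smod.subspace_0[OF N(1)] by blast
  then show "P \<in> hcomp d"
    by (simp add: N(2))
qed

section \<open>First-order deformations of a point of the Grassmannian\<close>

locale grass_point =
  fixes V :: "('n::finite, 'k::field) mpol set" and d t :: nat
  assumes subspace: "smod.subspace V" and sub: "V \<subseteq> hcomp d" and dim: "kvec.dim V = t"
begin

abbreviation "Tan \<equiv> carr (Homk (submod cscale V) (quot cscale (hcomp d) V))"

lemma stable: "scl.stable V"
  by (rule scl_stable) (rule subspace)

lemma subgrp: "subgrp V"
  using scl.stable_subgrp stable by blast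

lemma Tan_iff: "f \<in> Tan \<longleftrightarrow> scl.coset_hom V (hcomp d) V f"
  by (simp add: Homk_def scl.mod_hom_iff[OF stable stable])

lemma Tan_homomorphism: "f \<in> Tan \<Longrightarrow> coset_homomorphism cscale V (hcomp d) V f"
  by unfold_locales (simp_all add: stable Tan_iff)

lemma tangent_graph_subspace: "f \<in> Tan \<Longrightarrow> smod.subspace (tangent_graph V f)"
  by (rule subspace_tangent_graph[OF Tan_homomorphism])

lemma re_tangent_graph:
  assumes "f \<in> Tan"
  shows "re_part ` tangent_graph V f = V"
proof -
  interpret f: coset_homomorphism cscale V "hcomp d" V f
    by (rule Tan_homomorphism) (rule assms)
  show ?thesis
  proof
    show "V \<subseteq> re_part ` tangent_graph V f"
    proof
      fix F assume F: "F \<in> V"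
      then obtain G where "G \<in> f F"
        using f.ex by metis
      then have "dmk F G \<in> tangent_graph V f"
        using F by (simp add: dmk_tangent_graph)
      then have "re_part (dmk F G) \<in> re_part ` tangent_graph V f"
        by (rule imageI)
      then show "F \<in> re_part ` tangent_graph V f"
        by simp
    qed
  qed (auto simp: tangent_graph_def)
qed

text \<open>A basis element b of \<open>V\<close> lifts to b + eps g(b) with g(b) in
  \<open>f b\<close>. In a relation among the lifts the real parts of the coefficients vanish first;
  then the eps-part is again a relation among the b.\<close>

lemma tangent_graph_basis:
  assumes f: "f \<in> Tan"
  shows "\<exists>B. is_basis t B (tangent_graph V f)"
proof -
  interpret f: coset_homomorphism cscale V "hcomp d" V f
    by (rule Tan_homomorphism) (rule f)
  obtain B where B: "B \<subseteq> V" "smod.independent B" "V \<subseteq> smod.span B" "card B = kvec.dim V"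
    by (rule kvec.basis_exists)
  have fin: "finite B"
    using B sub independent_hcomp_finite by blast
  have "\<forall>b\<in>B. \<exists>G. G \<in> f b"
    using f.ex B(1) by (metis subsetD)
  then obtain g where g: "\<And>b. b \<in> B \<Longrightarrow> g b \<in> f b"
    by metis
  define p where "p b = dmk b (g b)" for b
  have inj: "inj_on p B"
    by (rule inj_on_inverseI[of _ re_part]) (simp add: p_def)
  have pM: "p b \<in> tangent_graph V f" if "b \<in> B" for b
    using that g B(1) by (auto simp: p_def dmk_tangent_graph)
  have ind0: "\<forall>v\<in>B. u v = 0" if "(\<Sum>v\<in>B. cscale (u v) v) = 0" for u
    by (intro ballI smod.independentD[OF B(2) fin subset_refl that])
  have "smod.independent (p ` B)"
    unfolding smod.dependent_finite[OF finite_imageI[OF fin]]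
  proof (rule notI, elim exE conjE bexE)
    fix u P assume P: "P \<in> p ` B" "u P \<noteq> 0" and "(\<Sum>P\<in>p ` B. cscale (u P) P) = 0"
    then obtain b where b: "b \<in> B" "P = p b"
      by blast
    from \<open>(\<Sum>P\<in>p ` B. cscale (u P) P) = 0\<close> have 0:
      "(\<Sum>b\<in>B. cscale (u (p b)) (p b)) = 0"
      using inj by (simp add: sum.reindex)
    have "(\<Sum>b\<in>B. cscale (dre (u (p b))) b) = 0"
      using arg_cong[OF 0, of re_part] by (simp add: parts_sum parts_cscale p_def)
    then have re: "\<And>b. b \<in> B \<Longrightarrow> dre (u (p b)) = 0"
      using ind0[of "\<lambda>b. dre (u (p b))"] by simp
    have "(\<Sum>b\<in>B. cscale (deps (u (p b))) b) = eps_part (\<Sum>b\<in>B. cscale (u (p b)) (p b))"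
      unfolding parts_sum parts_cscale by (intro sum.cong) (simp_all add: re, simp add: p_def)
    then have "(\<Sum>b\<in>B. cscale (deps (u (p b))) b) = 0"
      by (simp add: 0)
    then have "deps (u (p b)) = 0"
      using ind0[of "\<lambda>b. deps (u (p b))"] b by simp
    with re[OF b(1)] P(2) b(2) show False
      by (simp add: dual_eq_iff)
  qed
  moreover have "smod.span (p ` B) = tangent_graph V f"
  proof
    show "smod.span (p ` B) \<subseteq> tangent_graph V f"
      by (rule smod.span_minimal) (use pM tangent_graph_subspace[OF f] in auto)
    show "tangent_graph V f \<subseteq> smod.span (p ` B)"
    proof
      fix P assume P: "P \<in> tangent_graph V f"
      have comb: "\<exists>c. F = (\<Sum>b\<in>B. cscale (c b) b)" if "F \<in> V" for F
      proof -
        have "F \<in> smod.span B"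
          using that B(3) by blast
        then show ?thesis
          unfolding smod.span_finite[OF fin] by blast
      qed
      obtain c where c: "re_part P = (\<Sum>b\<in>B. cscale (c b) b)"
        using comb P by (auto simp: tangent_graph_def)
      \<comment> \<open>\<open>Q\<close> has the real part of \<open>P\<close>, so
        \<open>P - Q\<close> is eps times an element of \<open>V\<close>; after multiplication by
        eps the lifts and the basis elements are indistinguishable.\<close>
      define Q where "Q = (\<Sum>b\<in>B. cscale (Dual (c b) 0) (p b))"
      have Qs: "Q \<in> smod.span (p ` B)"
        unfolding Q_def by (intro smod.span_sum smod.span_scale smod.span_base imageI)
      have "Q \<in> tangent_graph V f"
        unfolding Q_def using tangent_graph_subspace[OF f] pM
        by (intro smod.subspace_sum smod.subspace_scale) auto
      then have PQ: "P - Q \<in> tangent_graph V f"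
        using P tangent_graph_subspace[OF f] smod.subspace_diff by blast
      have re: "re_part (P - Q) = 0"
        by (simp add: parts_diff c Q_def parts_sum parts_cscale p_def)
      then have "eps_part (P - Q) \<in> V"
        using PQ by (simp add: tangent_graph_def f.zero)
      then obtain e where e: "eps_part (P - Q) = (\<Sum>b\<in>B. cscale (e b) b)"
        using comb by blast
      have "P - Q = (\<Sum>b\<in>B. cscale (Dual 0 (e b)) (p b))"
        by (rule poly_dual_eqI) (simp_all add: re e parts_sum parts_cscale p_def)
      then have "P - Q \<in> smod.span (p ` B)"
        by (metis (no_types, lifting) imageI smod.span_base smod.span_scale smod.span_sum)
      then show "P \<in> smod.span (p ` B)"
        using Qs smod.span_add by fastforce
    qed
  qed
  ultimately have "is_basis t (p ` B) (tangent_graph V f)"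
    using fin inj B(4) dim by (simp add: is_basis_def card_image)
  then show ?thesis ..
qed

text \<open>The undeformed W + eps W is a complement of every such graph, where \<open>W\<close> is
  any complement of \<open>V\<close> in degree \<open>d\<close>.\<close>

lemma tangent_graph_grass:
  assumes f: "f \<in> Tan"
  shows "tangent_graph V f \<in> grass d t"
proof -
  interpret f: coset_homomorphism cscale V "hcomp d" V f
    by (rule Tan_homomorphism) (rule f)
  obtain BU B where B: "finite BU" "finite B" "BU \<inter> B = {}" "smod.independent (BU \<union> B)"
    "smod.span BU = V" "smod.span (BU \<union> B) = hcomp d"
    by (rule basis_pair_exists[OF subspace subspace_hcomp sub subset_refl])
  define W where "W = smod.span B"
  have W: "smod.subspace W"
    by (simp add: W_def)
  have "W \<subseteq> hcomp d"
    unfolding W_def B(6)[symmetric] by (rule smod.span_mono) simp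
  have VW: "F = 0" if "F \<in> V" "F \<in> W" for F
    using span_Int_zero[OF B(1-4)] that B(5) by (simp add: W_def)
  have decomp: "\<exists>v w. v \<in> V \<and> w \<in> W \<and> F = v + w" if "F \<in> hcomp d" for F
    using that unfolding B(6)[symmetric] smod.span_Un B(5) W_def by blast
  define N where "N = {P. re_part P \<in> W \<and> eps_part P \<in> W}"
  have N: "smod.subspace N"
    using W by (auto simp: N_def smod.subspace_def parts_add parts_cscale)
  have "tangent_graph V f \<inter> N = {0}"
  proof
    show "tangent_graph V f \<inter> N \<subseteq> {0}"
    proof
      fix P assume "P \<in> tangent_graph V f \<inter> N"
      then have P: "re_part P \<in> V" "eps_part P \<in> f (re_part P)" "re_part P \<in> W" "eps_part P \<in> W"
        by (simp_all add: tangent_graph_def N_def)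
      have re: "re_part P = 0"
        using VW P by blast
      have "eps_part P = 0"
        using P VW by (simp add: re f.zero)
      with re show "P \<in> {0}"
        by (auto intro: poly_dual_eqI)
    qed
    show "{0} \<subseteq> tangent_graph V f \<inter> N"
      using N tangent_graph_subspace[OF f] by (simp add: smod.subspace_0)
  qed
  moreover have "{x + y |x y. x \<in> tangent_graph V f \<and> y \<in> N} = hcomp d"
  proof
    have "f F \<subseteq> hcomp d" if F: "F \<in> V" for F
    proof -
      obtain w where "w \<in> hcomp d" "f F = coset V w"
        using f.hom F by (auto simp: scl.coset_hom_def)
      then show ?thesis
        using sub hcomp_add by (fastforce simp: coset_def)
    qed
    then have "tangent_graph V f \<subseteq> hcomp d"
      using sub unfolding tangent_graph_def parts_hcomp subset_iff by blast
    moreover have "N \<subseteq> hcomp d"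
      using \<open>W \<subseteq> hcomp d\<close> by (auto simp: N_def parts_hcomp)
    ultimately show "{x + y |x y. x \<in> tangent_graph V f \<and> y \<in> N} \<subseteq> hcomp d"
      using hcomp_add by fast
    show "hcomp d \<subseteq> {x + y |x y. x \<in> tangent_graph V f \<and> y \<in> N}"
    proof
      fix P :: "('n, 'k dual) mpol" assume P: "P \<in> hcomp d"
      then obtain v w where vw: "v \<in> V" "w \<in> W" "re_part P = v + w"
        using decomp parts_hcomp by blast
      obtain g where g: "g \<in> f v" "g \<in> hcomp d"
        using f.hom vw(1) coset_self[OF subgrp] by (metis scl.coset_hom_def)
      have "eps_part P - g \<in> hcomp d"
        using P g parts_hcomp hcomp_diff by blast
      then obtain v' w' where vw': "v' \<in> V" "w' \<in> W" "eps_part P - g = v' + w'"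
        using decomp by blast
      have "g + v' \<in> f v"
        using f.mem_iff[OF vw(1) g(1)] vw'(1) by simp
      then have "dmk v (g + v') \<in> tangent_graph V f"
        using vw(1) by (simp add: dmk_tangent_graph)
      moreover have "dmk w w' \<in> N"
        using vw vw' by (simp add: N_def)
      moreover have "P = dmk v (g + v') + dmk w w'"
        by (rule poly_dual_eqI) (use vw(3) vw'(3) in \<open>simp_all add: parts_add algebra_simps\<close>)
      ultimately show "P \<in> {x + y |x y. x \<in> tangent_graph V f \<and> y \<in> N}"
        by blast
    qed
  qed
  ultimately show ?thesis
    unfolding grass_def using tangent_graph_basis[OF f] N by blast
qed

lemma tangent_graph_inj: "inj_on (tangent_graph V) Tan"
proof (rule inj_onI)
  fix f g assume f: "f \<in> Tan" and g: "g \<in> Tan" and eq: "tangent_graph V f = tangent_graph V g"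
  show "f = g"
  proof (rule extensionalityI[of _ V])
    show "f \<in> extensional V" "g \<in> extensional V"
      using f g unfolding Tan_iff scl.coset_hom_def by blast+
    fix F assume "F \<in> V"
    then have "G \<in> f F \<longleftrightarrow> G \<in> g F" for G
      using dmk_tangent_graph[of F G V f] dmk_tangent_graph[of F G V g] eq by simp
    then show "f F = g F"
      by blast
  qed
qed

text \<open>The map sends F to the eps-parts of its lifts in \<open>M\<close>. These form one coset
  of \<open>V\<close> because \<open>M\<close> contains eps G exactly for G in \<open>V\<close>
  (\<open>in1\<close>, \<open>in2\<close>); for \<open>in2\<close> it matters that \<open>M\<close>
  is a direct summand.\<close>

lemma grass_tangent_graph:
  assumes M: "M \<in> grass d t" and re: "re_part ` M = V"
  obtains f where "f \<in> Tan" "M = tangent_graph V f"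
proof -
  obtain B where "is_basis t B M"
    using M by (auto simp: grass_def)
  then have sM: "smod.subspace M"
    by (auto simp: is_basis_def)
  obtain N where N: "smod.subspace N" "M \<inter> N = {0}" "{x + y |x y. x \<in> M \<and> y \<in> N} = hcomp d"
    using M by (auto simp: grass_def)
  have Mh: "M \<subseteq> hcomp d"
    by (rule grass_subset[OF M])
  have in1: "dmk 0 F \<in> M" if F: "F \<in> V" for F
  proof -
    obtain P where "P \<in> M" "re_part P = F"
      using F re by blast
    then show ?thesis
      using smod.subspace_scale[OF sM, of P "Dual 0 1"] by (simp add: eps_cscale)
  qed
  \<comment> \<open>decompose any lift of \<open>G\<close> along \<open>M \<oplus> N\<close>; multiplying by \<open>\<epsilon>\<close> kills the \<open>N\<close>-component\<close>
  have in2: "G \<in> V" if G: "dmk 0 G \<in> M" for G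
  proof -
    have "G \<in> hcomp d"
      using G Mh parts_hcomp by (metis dmk_parts(2) subsetD)
    then have "dmk G 0 \<in> {x + y |x y. x \<in> M \<and> y \<in> N}"
      unfolding N(3) by (simp add: parts_hcomp)
    then obtain x y where xy: "x \<in> M" "y \<in> N" "dmk G 0 = x + y"
      by blast
    have "cscale (Dual 0 1) y = dmk 0 G - cscale (Dual 0 1) x"
      using arg_cong[OF xy(3), of re_part]
      by (intro poly_dual_eqI) (simp_all add: parts_diff parts_cscale parts_add)
    then have "cscale (Dual 0 1) y \<in> M"
      using smod.subspace_diff[OF sM G smod.subspace_scale[OF sM xy(1)]] by simp
    then have "cscale (Dual 0 1) y \<in> M \<inter> N"
      using smod.subspace_scale[OF N(1) xy(2)] by blast
    then have "dmk 0 (re_part y) = 0"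
      using N(2) by (simp add: eps_cscale)
    then have "re_part y = 0"
      by (metis dmk_parts(2) parts_zero(2))
    then have "G = re_part x"
      using arg_cong[OF xy(3), of re_part] by (simp add: parts_add)
    then show ?thesis
      using re xy(1) by blast
  qed
  define f where "f = (\<lambda>F\<in>V. {G. dmk F G \<in> M})"
  have f: "f F = {G. dmk F G \<in> M}" if "F \<in> V" for F
    using that by (simp add: f_def)
  have "scl.coset_hom V (hcomp d) V f"
    unfolding scl.coset_hom_def
  proof (intro conjI ballI allI)
    show "f \<in> extensional V"
      by (simp add: f_def)
  next
    fix F assume F: "F \<in> V"
    then obtain P where P: "P \<in> M" "re_part P = F"
      using re by blast
    have "G \<in> f F \<longleftrightarrow> G - eps_part P \<in> V" for G
    proof -
      have e: "dmk F G - P = dmk 0 (G - eps_part P)"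
        by (rule poly_dual_eqI) (simp_all add: parts_diff P(2))
      have "dmk F G \<in> M \<longleftrightarrow> dmk F G - P \<in> M"
        using smod.subspace_diff[OF sM _ P(1), of "dmk F G"] smod.subspace_add[OF sM _ P(1), of "dmk F G - P"]
        by auto
      then show ?thesis
        using in1 in2 e by (auto simp: f[OF F])
    qed
    then have "f F = coset V (eps_part P)"
      unfolding set_eq_iff mem_coset by blast
    moreover have "eps_part P \<in> hcomp d"
      using Mh P parts_hcomp by blast
    ultimately show "\<exists>w\<in>hcomp d. f F = coset V w"
      by blast
  next
    fix F F' G G' assume FF: "F \<in> V" "F' \<in> V" and "G \<in> f F" "G' \<in> f F'"
    then show "G + G' \<in> f (F + F')"
      using smod.subspace_add[OF sM, of "dmk F G" "dmk F' G'"]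
      by (simp add: f subgrp_add[OF subgrp] dmk_add)
  next
    fix c F G assume "F \<in> V" "G \<in> f F"
    then show "cscale c G \<in> f (cscale c F)"
      using smod.subspace_scale[OF sM, of "dmk F G" "Dual c 0"] smod.subspace_scale[OF subspace, of F c]
      by (simp add: f dmk_cscale)
  qed
  then have "f \<in> Tan"
    by (simp add: Tan_iff)
  moreover have "M = tangent_graph V f"
  proof -
    have "P \<in> M \<longleftrightarrow> P \<in> tangent_graph V f" for P
    proof -
      have "re_part P \<in> V" if "P \<in> M"
        using that re by blast
      then show ?thesis
        by (auto simp: tangent_graph_def f dmk_collapse)
    qed
    then show ?thesis
      by blast
  qed
  ultimately show thesis
    by (rule that)
qed

lemma tangent_graph_bij: "bij_betw (tangent_graph V) Tan (tangent_vectors (grass d t) V)"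
  unfolding bij_betw_def
proof (intro conjI tangent_graph_inj subset_antisym subsetI)
  fix M assume "M \<in> tangent_graph V ` Tan"
  then show "M \<in> tangent_vectors (grass d t) V"
    using tangent_graph_grass re_tangent_graph by (auto simp: tangent_vectors_def)
next
  fix M assume "M \<in> tangent_vectors (grass d t) V"
  then have "M \<in> grass d t" "re_part ` M = V"
    by (auto simp: tangent_vectors_def)
  then obtain f where "f \<in> Tan" "M = tangent_graph V f"
    by (rule grass_tangent_graph)
  then show "M \<in> tangent_graph V ` Tan"
    by blast
qed

text \<open>A relation among the reductions becomes, after multiplication by eps, a relation among
  the elements of \<open>B\<close>. So a basis reduces to a basis of the same size.\<close>

lemma re_basis:
  fixes B M :: "('n, 'k dual) mpol set"
  assumes "is_basis t B M"
  shows "finite (re_part ` B)" "smod.independent (re_part ` B)" "card (re_part ` B) = t"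
    "smod.span (re_part ` B) = re_part ` M"
proof -
  have B: "finite B" "card B = t" "smod.independent B" "smod.span B = M"
    using assms by (simp_all add: is_basis_def)
  have ind: "\<forall>P\<in>B. c P = 0" if "(\<Sum>P\<in>B. cscale (c P) (re_part P)) = 0" for c
  proof -
    have z: "(\<Sum>P\<in>B. cscale (Dual 0 (c P)) P) = 0"
      by (rule poly_dual_eqI) (use that in \<open>simp_all add: parts_sum parts_cscale\<close>)
    have "Dual 0 (c P) = 0" if "P \<in> B" for P
      by (rule smod.independentD[OF B(3,1) subset_refl z that])
    then show ?thesis
      by (simp add: dual_eq_iff)
  qed
  have inj: "inj_on re_part B"
  proof (rule inj_onI, rule ccontr)
    fix P Q assume PQ: "P \<in> B" "Q \<in> B" "re_part P = re_part Q" "P \<noteq> Q"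
    let ?c = "\<lambda>R. (if R = P then 1 else 0) - (if R = Q then 1 else 0 :: 'k)"
    have "(\<Sum>R\<in>B. cscale (?c R) (re_part R)) = 0"
      using B(1) PQ
      by (simp add: smod.scale_left_diff_distrib sum_subtractf if_distrib[of "\<lambda>c. cscale c _"] sum.delta
          cong: if_cong)
    with ind[of ?c] PQ show False
      by auto
  qed
  show "finite (re_part ` B)" "card (re_part ` B) = t"
    using B inj by (simp_all add: card_image)
  show "smod.independent (re_part ` B)"
    unfolding smod.dependent_finite[OF finite_imageI[OF B(1)]]
    using ind[of "\<lambda>P. u (re_part P)" for u] inj by (auto simp: sum.reindex)
  show "smod.span (re_part ` B) = re_part ` M"
  proof
    show "smod.span (re_part ` B) \<subseteq> re_part ` M"
    proof
      fix F assume "F \<in> smod.span (re_part ` B)"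
      then obtain c where c: "F = (\<Sum>v\<in>re_part ` B. cscale (c v) v)"
        unfolding smod.span_finite[OF finite_imageI[OF B(1)]] by blast
      define P where "P = (\<Sum>Q\<in>B. cscale (Dual (c (re_part Q)) 0) Q)"
      have "P \<in> M"
        unfolding B(4)[symmetric] P_def by (intro smod.span_sum smod.span_scale smod.span_base)
      moreover have "re_part P = F"
        unfolding c P_def using inj by (simp add: parts_sum parts_cscale sum.reindex)
      ultimately show "F \<in> re_part ` M"
        by blast
    qed
    show "re_part ` M \<subseteq> smod.span (re_part ` B)"
    proof
      fix F assume "F \<in> re_part ` M"
      then obtain P where P: "P \<in> smod.span B" "F = re_part P"
        using B(4) by blast
      then obtain c where "P = (\<Sum>Q\<in>B. cscale (c Q) Q)"
        unfolding smod.span_finite[OF B(1)] by blast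
      then have "F = (\<Sum>Q\<in>B. cscale (dre (c Q)) (re_part Q))"
        by (simp add: P(2) parts_sum parts_cscale)
      then show "F \<in> smod.span (re_part ` B)"
        by (metis (no_types, lifting) imageI smod.span_base smod.span_scale smod.span_sum)
    qed
  qed
qed

lemma grass_re_eq:
  assumes M: "M \<in> grass d t" and re: "re_part ` M \<subseteq> V"
  shows "re_part ` M = V"
proof -
  obtain B where B: "is_basis t B M"
    using M by (auto simp: grass_def)
  note rb = re_basis[OF B]
  have "kvec.dim (re_part ` M) = t"
    using kvec.dim_span_eq_card_independent[OF rb(2)] rb by simp
  moreover have "smod.subspace (re_part ` M)"
    by (subst rb(4)[symmetric]) (rule smod.subspace_span)
  ultimately show ?thesis
    using subspace_eq_if_dim_eq[OF _ subspace re sub] dim by simp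
qed

end

lemma perp_iff:
  fixes M :: "('n::finite, 'a::comm_ring_1) mpol set"
  assumes "M \<subseteq> hcomp d"
  shows "u \<in> perp d M \<longleftrightarrow> u \<in> hcomp d \<and> (\<forall>F\<in>M. pair u F = 0)"
proof -
  have "act u F = 0 \<longleftrightarrow> pair u F = 0" if "u \<in> hcomp d" "F \<in> M" for F
    using act_hcomp_same[of u d F] that assms
    by (auto simp: const_def) (simp add: pair_def)
  then show ?thesis
    by (auto simp: perp_def)
qed

section \<open>Annihilators of first-order deformations\<close>

locale dual_grass_points = L: grass_point L d t + K: grass_point K d t'
  for L K :: "('n::finite, 'k::field) mpol set" and d t t' +
  assumes L_def: "L = {F \<in> hcomp d. \<forall>u\<in>K. pair u F = 0}"
    and K_def: "K = {u \<in> hcomp d. \<forall>F\<in>L. pair u F = 0}"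
begin

lemma pair_zero: "u \<in> K \<Longrightarrow> F \<in> L \<Longrightarrow> pair u F = 0"
  using K_def by blast

lemma graph_hcomp: "f \<in> L.Tan \<Longrightarrow> tangent_graph L f \<subseteq> hcomp d"
  by (rule grass_subset[OF L.tangent_graph_grass])

text \<open>For U = u + eps w and P = F + eps G the pairing has real part <u, F> and eps-part <u, G>
  + <w, F>; \<open>compat\<close> is the vanishing of the latter.\<close>

lemma perp_tangent_graph:
  assumes f: "f \<in> L.Tan" and g: "g \<in> K.Tan"
    and compat: "\<And>u w F G. u \<in> K \<Longrightarrow> w \<in> g u \<Longrightarrow> F \<in> L \<Longrightarrow> G \<in> f F \<Longrightarrow> pair w F = - pair u G"
  shows "perp d (tangent_graph L f) = tangent_graph K g"
proof -
  interpret f: coset_homomorphism cscale L "hcomp d" L f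
    by (rule L.Tan_homomorphism) (rule f)
  interpret g: coset_homomorphism cscale K "hcomp d" K g
    by (rule K.Tan_homomorphism) (rule g)
  have dual0: "x = 0 \<longleftrightarrow> dre x = 0 \<and> deps x = 0" for x :: "'k dual"
    by (simp add: dual_eq_iff)
  have "U \<in> perp d (tangent_graph L f) \<longleftrightarrow> U \<in> tangent_graph K g" for U
  proof
    assume "U \<in> perp d (tangent_graph L f)"
    then have Uh: "U \<in> hcomp d" and U: "\<And>P. P \<in> tangent_graph L f \<Longrightarrow> pair U P = 0"
      using perp_iff[OF graph_hcomp[OF f]] by blast+
    have U2: "pair (re_part U) F = 0" "pair (re_part U) G + pair (eps_part U) F = 0"
      if "F \<in> L" "G \<in> f F" for F G
      using U[of "dmk F G"] that by (simp_all add: dmk_tangent_graph dual0 parts_pair)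
    have "pair (re_part U) F = 0" if "F \<in> L" for F
      using U2(1)[OF that] f.ex that by metis
    then have reK: "re_part U \<in> K"
      using Uh by (simp add: K_def parts_hcomp)
    obtain w where w: "w \<in> hcomp d" "w \<in> g (re_part U)"
      using g.ex reK by metis
    \<comment> \<open>\<open>eps_part U\<close> and the value \<open>w\<close> of \<open>g\<close>
      satisfy the same equations, so their difference annihilates \<open>L\<close>.\<close>
    have "pair (eps_part U - w) F = 0" if F: "F \<in> L" for F
    proof -
      obtain G where G: "G \<in> f F"
        using f.ex F by metis
      show ?thesis
        using U2(2)[OF F G] compat[OF reK w(2) F G] by (simp add: pair_diff_left add.commute)
    qed
    moreover have "eps_part U - w \<in> hcomp d"
      using Uh w(1) by (simp add: parts_hcomp hcomp_diff)
    ultimately have "eps_part U - w \<in> K"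
      by (subst K_def) simp
    then have "eps_part U \<in> g (re_part U)"
      using g.mem_iff[OF reK w(2)] by blast
    with reK show "U \<in> tangent_graph K g"
      by (simp add: tangent_graph_def)
  next
    assume U: "U \<in> tangent_graph K g"
    then have reK: "re_part U \<in> K" and eps: "eps_part U \<in> g (re_part U)"
      by (simp_all add: tangent_graph_def)
    obtain w where w: "w \<in> hcomp d" "w \<in> g (re_part U)"
      using g.ex reK by metis
    have "eps_part U - w \<in> K"
      using g.mem_iff[OF reK w(2)] eps by blast
    then have "w + (eps_part U - w) \<in> hcomp d"
      using K.sub w(1) hcomp_add by blast
    then have "U \<in> hcomp d"
      using reK K.sub by (auto simp: parts_hcomp)
    moreover have "pair U P = 0" if "P \<in> tangent_graph L f" for P
      using that compat[OF reK eps, of "re_part P" "eps_part P"] pair_zero[OF reK]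
      by (simp add: tangent_graph_def dual0 parts_pair)
    ultimately show "U \<in> perp d (tangent_graph L f)"
      using perp_iff[OF graph_hcomp[OF f]] by blast
  qed
  then show ?thesis
    by blast
qed

text \<open>That \<open>M\<close> reduces to \<open>L\<close> has to be derived: every element of
  \<open>K\<close> lifts to one annihilating \<open>M\<close>, so the reduction of \<open>M\<close>
  lies in \<open>L\<close>, and equality follows by comparing dimensions.\<close>

lemma perp_eq_graph_imp:
  assumes M: "M \<in> grass d t" and g: "g \<in> K.Tan" and eq: "perp d M = tangent_graph K g"
  obtains f where "f \<in> L.Tan" "M = tangent_graph L f"
proof -
  interpret g: coset_homomorphism cscale K "hcomp d" K g
    by (rule K.Tan_homomorphism) (rule g)
  have Mh: "M \<subseteq> hcomp d"
    by (rule grass_subset[OF M])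
  have "re_part ` M \<subseteq> L"
  proof (rule image_subsetI)
    fix P assume P: "P \<in> M"
    have "pair u (re_part P) = 0" if u: "u \<in> K" for u
    proof -
      obtain v where "v \<in> g u"
        using g.ex u by metis
      then have "dmk u v \<in> perp d M"
        using u by (simp add: eq dmk_tangent_graph)
      then have "pair (dmk u v) P = 0"
        using perp_iff[OF Mh] P by blast
      then show ?thesis
        using parts_pair(1)[of "dmk u v" P] by simp
    qed
    moreover have "re_part P \<in> hcomp d"
      using P Mh parts_hcomp by blast
    ultimately show "re_part P \<in> L"
      by (simp add: L_def)
  qed
  then have "re_part ` M = L"
    by (rule L.grass_re_eq[OF M])
  with M show thesis
    using L.grass_tangent_graph that by blast
qed

end

section \<open>Minors and tangent vectors of rank loci\<close>

text \<open>Schur complement: since the r-minor is a unit, Cramer's rule expresses the new column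
  through the old ones on the chosen rows, with coefficients \<open>l\<close> independent of the
  extra row \<open>x\<close>. Subtracting this combination leaves a single entry in the last
  column.\<close>

lemma bordered_minor:
  fixes E :: "nat \<Rightarrow> 'r \<Rightarrow> 'a::comm_ring_1" and \<rho> :: "nat \<Rightarrow> 'r"
    and v :: "'r \<Rightarrow> 'a"
  assumes unit: "e * det (mat r r (\<lambda>(p, q). E q (\<rho> p))) = 1"
  obtains l where "\<And>p. p < r \<Longrightarrow> v (\<rho> p) = (\<Sum>q<r. l q * E q (\<rho> p))"
    and "\<And>x. det (mat (Suc r) (Suc r) (\<lambda>(p, q). (E(r := v)) q ((\<rho>(r := x)) p)))
      = det (mat r r (\<lambda>(p, q). E q (\<rho> p))) * (v x - (\<Sum>q<r. l q * E q x))"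
proof -
  define A where "A = mat r r (\<lambda>(p, q). E q (\<rho> p))"
  have A: "A \<in> carrier_mat r r"
    by (simp add: A_def)
  note adj = adj_mat[OF A]
  \<comment> \<open>\<open>e\<close> times the adjugate is the inverse of \<open>A\<close>; it is
    applied to \<open>v\<close> on the chosen rows.\<close>
  define l where "l q = e * (\<Sum>p<r. adj_mat A $$ (q, p) * v (\<rho> p))" for q
  have l: "v (\<rho> p) = (\<Sum>q<r. l q * E q (\<rho> p))" if p: "p < r" for p
  proof -
    have prod: "(\<Sum>q<r. A $$ (p, q) * adj_mat A $$ (q, s)) = (if p = s then det A else 0)" if "s < r" for s
      using arg_cong[OF adj(2), of "\<lambda>M. M $$ (p, s)"] p that A adj(1)
      by (auto simp: scalar_prod_def atLeast0LessThan)
    have "(\<Sum>q<r. l q * E q (\<rho> p)) = (\<Sum>q<r. \<Sum>s<r. e * (A $$ (p, q) * adj_mat A $$ (q, s)) * v (\<rho> s))"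
      using p by (auto simp: l_def A_def sum_distrib_left sum_distrib_right mult_ac intro!: sum.cong)
    also have "\<dots> = (\<Sum>s<r. e * (\<Sum>q<r. A $$ (p, q) * adj_mat A $$ (q, s)) * v (\<rho> s))"
      by (subst sum.swap) (simp add: sum_distrib_left sum_distrib_right)
    also have "\<dots> = (\<Sum>s<r. if p = s then e * det A * v (\<rho> s) else 0)"
      by (intro sum.cong) (auto simp: prod)
    also have "\<dots> = v (\<rho> p)"
      using p unit by (simp add: A_def)
    finally show ?thesis ..
  qed
  have "det (mat (Suc r) (Suc r) (\<lambda>(p, q). (E(r := v)) q ((\<rho>(r := x)) p)))
      = det A * (v x - (\<Sum>q<r. l q * E q x))" for x
  proof -
    let ?X = "mat (Suc r) (Suc r) (\<lambda>(p, q). (E(r := v)) q ((\<rho>(r := x)) p))"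
    \<comment> \<open>Right multiplication by this unitriangular matrix subtracts the combination
      \<open>l\<close> from the last column.\<close>
    let ?U = "mat (Suc r) (Suc r) (\<lambda>(i, j). if i = j then 1 else if j = r then - l i else 0)"
    define Y where "Y = ?X * ?U"
    have Y: "Y \<in> carrier_mat (Suc r) (Suc r)"
      unfolding Y_def by (rule mult_carrier_mat[of _ _ "Suc r"]) auto
    have Yi: "Y $$ (p, q) = (if q < r then E q ((\<rho>(r := x)) p)
        else v ((\<rho>(r := x)) p) - (\<Sum>s<r. l s * E s ((\<rho>(r := x)) p)))"
      if "p \<le> r" "q \<le> r" for p q
    proof -
      have "Y $$ (p, q) = (\<Sum>s<Suc r. (E(r := v)) s ((\<rho>(r := x)) p) * (if s = q then 1 else if q = r then - l s else 0))"
        using that by (simp add: Y_def scalar_prod_def atLeast0LessThan)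
      also have "\<dots> = (if q < r then E q ((\<rho>(r := x)) p)
        else v ((\<rho>(r := x)) p) - (\<Sum>s<r. l s * E s ((\<rho>(r := x)) p)))"
      proof (cases "q < r")
        case True
        then have "(\<Sum>s<r. (E(r := v)) s ((\<rho>(r := x)) p) * (if s = q then 1 else if q = r then - l s else 0))
            = (\<Sum>s<r. if s = q then E q ((\<rho>(r := x)) p) else 0)"
          by (intro sum.cong) auto
        with True show ?thesis
          by simp
      next
        case False
        then have "q = r"
          using that by simp
        then have "(\<Sum>s<r. (E(r := v)) s ((\<rho>(r := x)) p) * (if s = q then 1 else if q = r then - l s else 0))
            = - (\<Sum>s<r. l s * E s ((\<rho>(r := x)) p))"
          unfolding sum_negf[symmetric] by (intro sum.cong) auto
        with \<open>q = r\<close> show ?thesis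
          by simp
      qed
      finally show ?thesis .
    qed
    have "det ?U = 1"
    proof -
      have "det ?U = prod_list (diag_mat ?U)"
        by (rule det_upper_triangular[of _ "Suc r"]) auto
      also have "\<dots> = 1"
          by (simp add: prod_list_diag_prod)
      finally show ?thesis .
    qed
    then have "det ?X = det Y"
      unfolding Y_def by (subst det_mult[of _ "Suc r"]) auto
    also have "\<dots> = (\<Sum>i<Suc r. Y $$ (i, r) * cofactor Y i r)"
      by (rule laplace_expansion_column[OF Y]) simp
    also have "\<dots> = Y $$ (r, r) * cofactor Y r r"
      by (simp add: Yi l[symmetric])
    also have "mat_delete Y r r = A"
      by (rule eq_matI) (use Y in \<open>auto simp: mat_delete_def A_def Yi\<close>)
    then have "cofactor Y r r = det A"
      by (simp add: cofactor_def)
    finally show ?thesis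
      by (simp add: Yi mult.commute)
  qed
  with l that show thesis
    by (simp add: A_def)
qed

text \<open>Induction on the number of columns. The new column agrees on the chosen rows with a
  combination of the old ones; a row where they differ borders the minor to a nonzero one, and
  without such a row the columns would be dependent.\<close>

lemma independent_imp_minor:
  fixes E :: "nat \<Rightarrow> 'r \<Rightarrow> 'k::field"
  assumes "\<And>c. (\<And>x. x \<in> X \<Longrightarrow> (\<Sum>q<r. c q * E q x) = 0) \<Longrightarrow> \<forall>q<r. c q = 0"
  shows "\<exists>\<rho>. \<rho> ` {..<r} \<subseteq> X \<and> inj_on \<rho> {..<r} \<and> det (mat r r (\<lambda>(p, q). E q (\<rho> p))) \<noteq> 0"
  using assms
proof (induction r)
  case 0
  then show ?case
    by simp
next
  case (Suc r)
  have "\<forall>q<r. c q = 0" if c: "\<And>x. x \<in> X \<Longrightarrow> (\<Sum>q<r. c q * E q x) = 0" for c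
  proof (intro allI impI)
    fix q assume "q < r"
    have "\<forall>q<Suc r. (c(r := 0)) q = 0"
      by (rule Suc.prems) (use c in \<open>auto cong: sum.cong_simp\<close>)
    from spec[OF this, of q] \<open>q < r\<close> show "c q = 0"
      by (simp split: if_splits)
  qed
  then obtain \<rho> where \<rho>: "\<rho> ` {..<r} \<subseteq> X" "inj_on \<rho> {..<r}"
    and nz: "det (mat r r (\<lambda>(p, q). E q (\<rho> p))) \<noteq> 0"
    using Suc.IH by blast
  obtain l where l: "\<And>p. p < r \<Longrightarrow> E r (\<rho> p) = (\<Sum>q<r. l q * E q (\<rho> p))"
    and d: "\<And>x. det (mat (Suc r) (Suc r) (\<lambda>(p, q). (E(r := E r)) q ((\<rho>(r := x)) p)))
      = det (mat r r (\<lambda>(p, q). E q (\<rho> p))) * (E r x - (\<Sum>q<r. l q * E q x))"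
    using bordered_minor[of "inverse (det (mat r r (\<lambda>(p, q). E q (\<rho> p))))" r E \<rho>
      "E r"] nz by auto
  have "\<exists>x\<in>X. E r x \<noteq> (\<Sum>q<r. l q * E q x)"
  proof (rule ccontr)
    assume "\<not> ?thesis"
    then have "(\<Sum>q<Suc r. ((\<lambda>q. - l q)(r := 1)) q * E q x) = 0" if "x \<in> X" for x
      using that by (simp add: sum_negf)
    then show False
      using Suc.prems[of "(\<lambda>q. - l q)(r := 1)"] by auto
  qed
  then obtain x where x: "x \<in> X" "E r x \<noteq> (\<Sum>q<r. l q * E q x)"
    by blast
  have "x \<notin> \<rho> ` {..<r}"
    using x l by auto
  then have "(\<rho>(r := x)) ` {..<Suc r} \<subseteq> X \<and> inj_on (\<rho>(r := x)) {..<Suc r}"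
    using \<rho> x by (auto simp: lessThan_Suc inj_on_def)
  moreover have "det (mat (Suc r) (Suc r) (\<lambda>(p, q). E q ((\<rho>(r := x)) p))) \<noteq> 0"
    using d[of x] nz x(2) by simp
  ultimately show ?case
    by blast
qed

text \<open>The matrix factors through \<open>r\<close> columns. To keep the factors square the
  first one is padded by a zero column, so its determinant vanishes.\<close>

lemma dependent_columns_det:
  fixes E F :: "nat \<Rightarrow> 'r \<Rightarrow> 'a::comm_ring_1"
  assumes F: "\<And>j x. j < Suc r \<Longrightarrow> F j x = (\<Sum>q<r. L q j * E q x)"
  shows "det (mat (Suc r) (Suc r) (\<lambda>(p, j). F j (\<rho> p))) = 0"
proof -
  let ?E = "mat (Suc r) (Suc r) (\<lambda>(p, q). if q < r then E q (\<rho> p) else 0)"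
  let ?L = "mat (Suc r) (Suc r) (\<lambda>(q, j). L q j)"
  have "mat (Suc r) (Suc r) (\<lambda>(p, j). F j (\<rho> p)) = ?E * ?L"
    by (rule eq_matI) (simp_all add: scalar_prod_def atLeast0LessThan F mult.commute)
  then have "det (mat (Suc r) (Suc r) (\<lambda>(p, j). F j (\<rho> p))) = det ?E * det ?L"
    by (simp add: det_mult[of _ "Suc r"])
  also have "det ?E = (\<Sum>i<Suc r. ?E $$ (i, r) * cofactor ?E i r)"
    by (rule laplace_expansion_column[of _ "Suc r"]) auto
  also have "\<dots> = 0"
    by (rule sum.neutral) simp
  finally show ?thesis
    by simp
qed

lemma dre_det: "dre (det (A :: 'a::comm_ring_1 dual mat)) = det (map_mat dre A)"
proof -
  interpret comm_ring_hom "dre :: 'a dual \<Rightarrow> 'a"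
    by unfold_locales simp_all
  show ?thesis
    by simp
qed

text \<open>The inverse of a + b eps is 1/a - (b/a^2) eps.\<close>

lemma dual_unit:
  fixes x :: "'k::field dual"
  assumes "dre x \<noteq> 0"
  obtains e where "e * x = 1"
  using assms that[of "Dual (1 / dre x) (- deps x / (dre x)^2)"]
  by (simp add: dual_eq_iff field_simps power2_eq_square)

text \<open>
  The columns \<open>col c\<close>, \<open>c \<in> C\<close>, form the matrix of a map over the dual numbers whose reduction has
  image \<open>X\<close> of rank \<open>r\<close>.  The rank stays \<open>r\<close> to first order iff every combination of the
  columns that vanishes modulo \<open>\<epsilon>\<close> has its \<open>\<epsilon>\<close>-part in \<open>X\<close>.
\<close>

locale dual_columns =
  fixes C :: "'c set" and col :: "'c \<Rightarrow> ('n::finite, 'k::field dual) mpol" and i r :: nat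
  assumes col_hcomp: "c \<in> C \<Longrightarrow> col c \<in> hcomp i"
    and dim: "kvec.dim (smod.span ((re_part \<circ> col) ` C)) = r"
begin

abbreviation "X \<equiv> smod.span ((re_part \<circ> col) ` C)"

abbreviation minor_mat :: "nat \<Rightarrow> (nat \<Rightarrow> 'n \<Rightarrow>\<^sub>0 nat) \<Rightarrow> (nat \<Rightarrow> 'c) \<Rightarrow> 'k dual mat"
  where "minor_mat s \<rho> \<gamma> \<equiv> mat s s (\<lambda>(p, q). lookup (col (\<gamma> q)) (\<rho> p))"

definition cminors :: "nat \<Rightarrow> 'k dual set"
  where "cminors s = {det (minor_mat s rows cols) |rows cols.
    inj_on rows {..<s} \<and> rows ` {..<s} \<subseteq> monoms i \<and> inj_on cols {..<s} \<and> cols ` {..<s} \<subseteq> C}"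

lemma basis_columns:
  obtains \<gamma> where "\<gamma> ` {..<r} \<subseteq> C" "inj_on \<gamma> {..<r}"
    "\<forall>c. (\<Sum>q<r. cscale (c q) (re_part (col (\<gamma> q)))) = 0 \<longrightarrow> (\<forall>q<r. c q = 0)"
    "\<forall>F\<in>X. \<exists>c. F = (\<Sum>q<r. cscale (c q) (re_part (col (\<gamma> q))))"
proof -
  obtain B where B: "B \<subseteq> (re_part \<circ> col) ` C" "smod.independent B"
    "(re_part \<circ> col) ` C \<subseteq> smod.span B"
    by (rule kvec.maximal_independent_subset)
  have span: "smod.span B = X"
  proof
    show "smod.span B \<subseteq> X"
      by (rule smod.span_mono) (rule B)
    show "X \<subseteq> smod.span B"
      by (rule smod.span_minimal) (use B in auto)
  qed
  have "B \<subseteq> hcomp i"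
    using B(1) col_hcomp parts_hcomp by force
  then have fin: "finite B"
    using B(2) independent_hcomp_finite by blast
  have card: "card B = r"
    using kvec.dim_span_eq_card_independent[OF B(2)] dim by (simp add: span)
  obtain b where b: "b ` {..<r} = B" "inj_on b {..<r}"
    "\<forall>c. lincomb r c b = 0 \<longrightarrow> (\<forall>q<r. c q = 0)"
      "\<forall>F\<in>smod.span B. \<exists>c. F = lincomb r c b"
    by (rule enumerate_basis[OF fin B(2) card])
  have "\<forall>q\<in>{..<r}. \<exists>c\<in>C. re_part (col c) = b q"
    using b(1) B(1) by fastforce
  then obtain \<gamma> where \<gamma>: "\<And>q. q < r \<Longrightarrow> \<gamma> q \<in> C"
    "\<And>q. q < r \<Longrightarrow> re_part (col (\<gamma> q)) = b q"
    by (metis lessThan_iff)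
  have comb: "(\<Sum>q<r. cscale (c q) (re_part (col (\<gamma> q)))) = lincomb r c b" for c
    by (simp add: \<gamma>(2))
  show thesis
  proof (rule that[of \<gamma>])
    show "\<gamma> ` {..<r} \<subseteq> C"
      using \<gamma> by auto
    show "inj_on \<gamma> {..<r}"
      by (rule inj_on_imageI2[of "re_part \<circ> col"]) (use b(2) \<gamma>(2) in \<open>simp add: inj_on_def\<close>)
  qed (use b span comb in simp_all)
qed

text \<open>The reduced columns are independent, so some r-minor is nonzero modulo eps, which makes
  it a unit over the dual numbers.\<close>

lemma unit_minor:
  assumes \<gamma>: "\<gamma> ` {..<r} \<subseteq> C"
    and ind: "\<forall>c. (\<Sum>q<r. cscale (c q) (re_part (col (\<gamma> q)))) = 0 \<longrightarrow> (\<forall>q<r. c q = 0)"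
  obtains \<rho> e where "\<rho> ` {..<r} \<subseteq> monoms i" "inj_on \<rho> {..<r}"
    "e * det (minor_mat r \<rho> \<gamma>) = 1"
proof -
  let ?E = "\<lambda>q m. lookup (re_part (col (\<gamma> q))) m"
  have "\<forall>q<r. c q = 0"
    if c: "\<And>m. m \<in> monoms i \<Longrightarrow> (\<Sum>q<r. c q * ?E q m) = 0" for c
  proof (rule mp[OF spec[OF ind]], rule poly_mapping_eqI)
    fix m
    show "lookup (\<Sum>q<r. cscale (c q) (re_part (col (\<gamma> q)))) m = lookup 0 m"
    proof (cases "m \<in> monoms i")
      case True
      then show ?thesis
        using c[of m] by (simp add: lookup_sum)
    next
      case False
      have "re_part (col (\<gamma> q)) \<in> hcomp i" if "q < r" for q
        using \<gamma> that col_hcomp parts_hcomp by blast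
      with False show ?thesis
        by (simp add: lookup_sum hcomp_iff monoms_def)
    qed
  qed
  then obtain \<rho> where \<rho>: "\<rho> ` {..<r} \<subseteq> monoms i" "inj_on \<rho> {..<r}"
    and nz: "det (mat r r (\<lambda>(p, q). ?E q (\<rho> p))) \<noteq> 0"
    using independent_imp_minor[where X = "monoms i" and r = r and E = ?E] by blast
  have m: "map_mat dre (minor_mat r \<rho> \<gamma>) = mat r r (\<lambda>(p, q). ?E q (\<rho> p))"
    by (rule eq_matI) auto
  have "dre (det (minor_mat r \<rho> \<gamma>)) \<noteq> 0"
    using nz unfolding dre_det m .
  then obtain e where "e * det (minor_mat r \<rho> \<gamma>) = 1"
    by (rule dual_unit)
  with \<rho> that show thesis
    by blast
qed

lemma one_in_minors: "1 \<in> ideal_span (cminors r)"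
proof -
  obtain \<gamma> where \<gamma>: "\<gamma> ` {..<r} \<subseteq> C" "inj_on \<gamma> {..<r}"
    and ind: "\<forall>c. (\<Sum>q<r. cscale (c q) (re_part (col (\<gamma> q)))) = 0 \<longrightarrow> (\<forall>q<r. c q = 0)"
    and gen: "\<forall>F\<in>X. \<exists>c. F = (\<Sum>q<r. cscale (c q) (re_part (col (\<gamma> q))))"
    by (rule basis_columns)
  obtain \<rho> e where \<rho>: "\<rho> ` {..<r} \<subseteq> monoms i" "inj_on \<rho> {..<r}"
    and e: "e * det (minor_mat r \<rho> \<gamma>) = 1"
    using unit_minor[OF \<gamma>(1) ind] by blast
  have "det (minor_mat r \<rho> \<gamma>) \<in> cminors r"
    using \<gamma> \<rho> by (auto simp: cminors_def)
  then show ?thesis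
    using e Modules.module.span_scale[OF module_mult Modules.module.span_base[OF module_mult]] by metis
qed

lemma combination_subspace:
  fixes E :: "nat \<Rightarrow> ('m::finite, 'a::comm_ring_1) mpol"
  shows "smod.subspace (range (\<lambda>c. \<Sum>q<s. cscale (c q) (E q)))"
  unfolding smod.subspace_def
proof (intro conjI ballI allI)
  show "0 \<in> range (\<lambda>c. \<Sum>q<s. cscale (c q) (E q))"
    by (rule range_eqI[of _ _ "\<lambda>_. 0"]) simp
next
  fix x y assume "x \<in> range (\<lambda>c. \<Sum>q<s. cscale (c q) (E q))"
    "y \<in> range (\<lambda>c. \<Sum>q<s. cscale (c q) (E q))"
  then obtain a b where "x = lincomb s a E" "y = lincomb s b E"
    by blast
  then show "x + y \<in> range (\<lambda>c. \<Sum>q<s. cscale (c q) (E q))"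
    by (intro range_eqI[of _ _ "\<lambda>q. a q + b q"]) (simp add: smod.scale_left_distrib sum.distrib)
next
  fix u x assume "x \<in> range (\<lambda>c. \<Sum>q<s. cscale (c q) (E q))"
  then obtain a where "x = lincomb s a E"
    by blast
  then show "cscale u x \<in> range (\<lambda>c. \<Sum>q<s. cscale (c q) (E q))"
    by (intro range_eqI[of _ _ "\<lambda>q. u * a q"]) (simp add: smod.scale_sum_right)
qed

text \<open>Both sides say that every column lies in the span \<open>?R\<close> of \<open>r\<close>
  columns whose reductions form a basis of \<open>X\<close>. From vanishing minors this follows by
  bordering a unit r-minor; from the condition on eps-parts, because any discrepancy is absorbed by
  coefficients that are multiples of eps.\<close>

lemma minors_vanish_iff:
  "cminors (Suc r) \<subseteq> {0} \<longleftrightarrow> (\<forall>Q\<in>smod.span (col ` C). re_part Q = 0 \<longrightarrow> eps_part Q \<in> X)"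
proof -
  obtain \<gamma> where \<gamma>: "\<gamma> ` {..<r} \<subseteq> C" "inj_on \<gamma> {..<r}"
    and ind: "\<forall>c. (\<Sum>q<r. cscale (c q) (re_part (col (\<gamma> q)))) = 0 \<longrightarrow> (\<forall>q<r. c q = 0)"
    and gen: "\<forall>F\<in>X. \<exists>c. F = (\<Sum>q<r. cscale (c q) (re_part (col (\<gamma> q))))"
    by (rule basis_columns)
  obtain \<rho> e where \<rho>: "\<rho> ` {..<r} \<subseteq> monoms i" "inj_on \<rho> {..<r}"
    and e: "e * det (minor_mat r \<rho> \<gamma>) = 1"
    using unit_minor[OF \<gamma>(1) ind] by blast
  let ?R = "range (\<lambda>c. \<Sum>q<r. cscale (c q) (col (\<gamma> q)))"
  show ?thesis
  proof
    assume van: "cminors (Suc r) \<subseteq> {0}"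
    have "col c \<in> ?R" if c: "c \<in> C" for c
    proof (cases "c \<in> \<gamma> ` {..<r}")
      case True
      then obtain q where q: "q < r" "c = \<gamma> q"
        by auto
      then show ?thesis
        by (intro range_eqI[of _ _ "\<lambda>p. if p = q then 1 else 0"])
          (simp add: if_distrib[of "\<lambda>c. cscale c _"] sum.delta cong: if_cong)
    next
      case False
      obtain l where l: "\<And>p. p < r \<Longrightarrow> lookup (col c) (\<rho> p)
            = (\<Sum>q<r. l q * lookup (col (\<gamma> q)) (\<rho> p))"
        and d: "\<And>x. det (mat (Suc r) (Suc r) (\<lambda>(p, q).
            ((\<lambda>q. lookup (col (\<gamma> q)))(r := lookup (col c))) q ((\<rho>(r := x)) p)))
          = det (minor_mat r \<rho> \<gamma>)
            * (lookup (col c) x - (\<Sum>q<r. l q * lookup (col (\<gamma> q)) x))"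
        using bordered_minor[of e r "\<lambda>q. lookup (col (\<gamma> q))" \<rho> "lookup (col c)"] e by blast
      have "lookup (col c) x = (\<Sum>q<r. l q * lookup (col (\<gamma> q)) x)" for x
      proof (cases "x \<in> monoms i")
        case x: True
        show ?thesis
        proof (cases "x \<in> \<rho> ` {..<r}")
          case True
          then show ?thesis
            using l by auto
        next
          \<comment> \<open>Row \<open>x\<close> and column \<open>c\<close> border the unit minor.
            The bordered minor is among those assumed to vanish, and cancelling the unit gives the
            entry at \<open>x\<close>.\<close>
          case x': False
          have "det (minor_mat (Suc r) (\<rho>(r := x)) (\<gamma>(r := c)))
              \<in> cminors (Suc r)"
            unfolding cminors_def using \<rho> \<gamma> x x' False c
            by (intro CollectI exI[of _ "\<rho>(r := x)"] exI[of _
              "\<gamma>(r := c)"]) (auto simp: lessThan_Suc inj_on_def)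
          moreover have "(\<lambda>(p, q). ((\<lambda>q. lookup (col (\<gamma> q)))(r := lookup (col c))) q ((\<rho>(r := x)) p))
              = (\<lambda>(p, q). lookup (col ((\<gamma>(r := c)) q)) ((\<rho>(r := x)) p))"
            by (auto simp: fun_eq_iff)
          ultimately have "det (minor_mat r \<rho> \<gamma>)
            * (lookup (col c) x - (\<Sum>q<r. l q * lookup (col (\<gamma> q)) x)) = 0"
            using van d[of x] by auto
          then have "e * det (minor_mat r \<rho> \<gamma>)
            * (lookup (col c) x - (\<Sum>q<r. l q * lookup (col (\<gamma> q)) x)) = 0"
            by (simp add: mult.assoc)
          then show ?thesis
            by (simp add: e)
        qed
      next
        case False
        have "col (\<gamma> q) \<in> hcomp i" if "q < r" for q
          using \<gamma> that col_hcomp by blast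
        with False col_hcomp[OF c] show ?thesis
          by (simp add: hcomp_iff monoms_def)
      qed
      then have "col c = (\<Sum>q<r. cscale (l q) (col (\<gamma> q)))"
        by (intro poly_mapping_eqI) (simp add: lookup_sum)
      then show ?thesis
        by - (rule range_eqI[where x = l])
    qed
    then have "smod.span (col ` C) \<subseteq> ?R"
      by (intro smod.span_minimal combination_subspace) auto
    show "\<forall>Q\<in>smod.span (col ` C). re_part Q = 0 \<longrightarrow> eps_part Q \<in> X"
    proof (intro ballI impI)
      fix Q assume "Q \<in> smod.span (col ` C)" and re: "re_part Q = 0"
      then obtain m where m: "Q = (\<Sum>q<r. cscale (m q) (col (\<gamma> q)))"
        using \<open>smod.span (col ` C) \<subseteq> ?R\<close> by blast
      \<comment> \<open>\<open>Q\<close> vanishes modulo eps and the reduced columns are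
        independent, so all coefficients are multiples of eps and only the reductions enter the
        eps-part.\<close>
      have "\<forall>q<r. dre (m q) = 0"
        by (rule mp[OF spec[OF ind]]) (use re in \<open>simp add: m parts_sum parts_cscale\<close>)
      then have "eps_part Q = (\<Sum>q<r. cscale (deps (m q)) (re_part (col (\<gamma> q))))"
        unfolding m parts_sum parts_cscale by (intro sum.cong) auto
      also have "\<dots> \<in> X"
        using \<gamma>(1) by (intro smod.span_sum smod.span_scale smod.span_base) auto
      finally show "eps_part Q \<in> X" .
    qed
  next
    assume eps: "\<forall>Q\<in>smod.span (col ` C). re_part Q = 0 \<longrightarrow> eps_part Q \<in> X"
    have "col c \<in> ?R" if c: "c \<in> C" for c
    proof -
      have "re_part (col c) \<in> X"
        using c by (intro smod.span_base) auto
      then obtain l where l: "re_part (col c) = (\<Sum>q<r. cscale (l q) (re_part (col (\<gamma> q))))"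
        using gen by blast
      \<comment> \<open>The column minus a lift of its reduction vanishes modulo eps, so the
        hypothesis puts its eps-part in \<open>X\<close>.\<close>
      define Q where "Q = col c - (\<Sum>q<r. cscale (Dual (l q) 0) (col (\<gamma> q)))"
      have re: "re_part Q = 0"
        by (simp add: Q_def parts_diff parts_sum parts_cscale l)
      have "Q \<in> smod.span (col ` C)"
        unfolding Q_def using c \<gamma>(1)
        by (intro smod.span_diff smod.span_sum smod.span_scale smod.span_base) auto
      then obtain m where m: "eps_part Q = (\<Sum>q<r. cscale (m q) (re_part (col (\<gamma> q))))"
        using eps re gen by blast
      have "Q = (\<Sum>q<r. cscale (Dual 0 (m q)) (col (\<gamma> q)))"
        by (rule poly_dual_eqI) (simp_all add: re m parts_sum parts_cscale)
      then have "col c = (\<Sum>q<r. cscale (Dual (l q) 0) (col (\<gamma> q))) + (\<Sum>q<r. cscale (Dual 0 (m q)) (col (\<gamma> q)))"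
        by (simp add: Q_def algebra_simps)
      also have "\<dots> = (\<Sum>q<r. cscale (Dual (l q) 0 + Dual 0 (m q)) (col (\<gamma> q)))"
        by (simp add: smod.scale_left_distrib sum.distrib)
      finally show ?thesis
        by - (rule range_eqI)
    qed
    then have "\<forall>c\<in>C. \<exists>l. col c = (\<Sum>q<r. cscale (l q) (col (\<gamma> q)))"
      by blast
    then obtain L where L: "\<And>c. c \<in> C \<Longrightarrow> col c = (\<Sum>q<r. cscale (L c q) (col (\<gamma> q)))"
      by metis
    have "det (minor_mat (Suc r) rows cols) = 0"
      if cols: "cols ` {..<Suc r} \<subseteq> C" for rows cols
    proof (rule dependent_columns_det)
      fix j x assume "j < Suc r"
      then have "cols j \<in> C"
        using cols by blast
      then have "lookup (col (cols j)) x
          = lookup (\<Sum>q<r. cscale (L (cols j) q) (col (\<gamma> q))) x"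
        using L by metis
      then show "lookup (col (cols j)) x
          = (\<Sum>q<r. L (cols j) q * lookup (col (\<gamma> q)) x)"
        by (simp add: lookup_sum)
    qed
    then show "cminors (Suc r) \<subseteq> {0}"
      unfolding cminors_def by blast
  qed
qed

end

section \<open>Level ideals and their inverse systems\<close>

lemma parts_hpart: "re_part (hpart j P) = hpart j (re_part P)" "eps_part (hpart j P) = hpart j (eps_part P)"
  by (rule poly_mapping_eqI, simp add: lookup_hpart)+

lemma pair_hpart_swap: "pair (hpart j u) F = pair u (hpart j F)"
  by (metis hpart_hcomp pair_hpart_left pair_hpart_right)

lemma subgrp_hparts_mem:
  assumes "subgrp V" "\<And>j. hpart j F \<in> V"
  shows "F \<in> V"
proof -
  obtain N where "(\<Sum>j\<le>N. hpart j F) = F"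
    using decompose_hparts[of F] by metis
  then show ?thesis
    using subgrp_sum[OF assms(1), of "{..N}" "\<lambda>j. hpart j F"] assms(2) by simp
qed

lemma coset_homs_eqI:
  assumes f: "coset_homomorphism s V W U f" and g: "coset_homomorphism s V W U g"
    and hp: "\<And>j x. x \<in> V \<Longrightarrow> hpart j x \<in> V"
    and eq: "\<And>j x. x \<in> V \<Longrightarrow> x \<in> hcomp j \<Longrightarrow> f x = g x"
  shows "f = g"
proof -
  interpret f: coset_homomorphism s V W U f
    by (rule f)
  interpret g: coset_homomorphism s V W U g
    by (rule g)
  show ?thesis
  proof (rule extensionalityI[of _ V])
    show "f \<in> extensional V" "g \<in> extensional V"
      using f.hom g.hom by (simp_all add: f.coset_hom_def)
    fix x assume x: "x \<in> V"
    obtain N where N: "(\<Sum>j\<le>N. hpart j x) = x"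
      using decompose_hparts[of x] by metis
    have "\<exists>a. a \<in> f (hpart j x)" for j
      using f.ex hp[OF x] by metis
    then obtain a where a: "\<And>j. a j \<in> f (hpart j x)"
      by metis
    have "sum a {..N} \<in> f x"
      using f.sum[of "{..N}" "\<lambda>j. hpart j x" a] a hp[OF x] N by simp
    moreover have "sum a {..N} \<in> g x"
      using g.sum[of "{..N}" "\<lambda>j. hpart j x" a] a hp[OF x] N eq[OF hp[OF x] hpart_hcomp] by simp
    ultimately show "f x = g x"
      using f.coset_hom_coset[OF f.hom f.sU x] f.coset_hom_coset[OF g.hom g.sU x] by metis
  qed
qed

lemma ideal_span_induct [consumes 1, case_names base step]:
  assumes "u \<in> ideal_span G" "P 0" "\<And>c x y. x \<in> G \<Longrightarrow> P y \<Longrightarrow> P (c * x + y)"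
  shows "P u"
  by (rule Modules.module.span_induct_alt[OF module_mult assms(1)]) (use assms in blast)+

section \<open>The ideal of a level algebra: socle and top degree\<close>

locale level_ideal =
  fixes I :: "('n::finite, 'k::field_char_0) mpol set" and d t :: nat
  assumes level: "level_quotient I d t"
begin

lemma ideal_generators: obtains G where "G \<subseteq> (\<Union>j. hcomp j)" "I = ideal_span G"
  using level unfolding level_quotient_def homogeneous_ideal_def by blast

lemma stable_I: "mul.stable I"
proof -
  obtain G where "I = ideal_span G"
    by (rule ideal_generators)
  then show ?thesis
    using Modules.module.span_zero[OF module_mult] Modules.module.span_diff[OF module_mult]
      Modules.module.span_scale[OF module_mult]
    by (auto simp: mul.stable_def subgrp_def)
qed

lemmas sI = mul.stable_subgrp[OF stable_I]

lemma I_mult: "u \<in> I \<Longrightarrow> v * u \<in> I"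
  by (rule mul.stable_s[OF stable_I])

lemma hpart_I: "u \<in> I \<Longrightarrow> hpart j u \<in> I"
proof -
  obtain G where G: "G \<subseteq> (\<Union>j. hcomp j)" "I = ideal_span G"
    by (rule ideal_generators)
  have GI: "G \<subseteq> I"
    unfolding G(2) using Modules.module.span_superset[OF module_mult] .
  assume "u \<in> I"
  then have "u \<in> ideal_span G"
    by (simp add: G(2))
  then show "hpart j u \<in> I"
  proof (induction rule: ideal_span_induct)
    case base
    then show ?case
      using subgrp_zero[OF sI] by simp
  next
    case (step c x y)
    obtain e where e: "x \<in> hcomp e"
      using step G by blast
    obtain N where N: "(\<Sum>i\<le>N. hpart i c) = c"
      using decompose_hparts[of c] by metis
    have "hpart j (c * x) = (\<Sum>i\<le>N. hpart j (hpart i c * x))"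
      by (subst (1) N[symmetric]) (simp add: sum_distrib_right hpart_sum)
    also have "\<dots> \<in> I"
    proof (rule subgrp_sum[OF sI])
      fix i
      have "x \<in> I"
        using step GI by blast
      then show "hpart j (hpart i c * x) \<in> I"
        using hpart_of_hcomp[OF mult_hcomp[OF hpart_hcomp[of i c] e], of j] I_mult subgrp_zero[OF sI]
        by simp
    qed
    finally show ?case
      using step by (simp add: hpart_add subgrp_add[OF sI])
  qed
qed

lemma high_degree: "j > d \<Longrightarrow> u \<in> hcomp j \<Longrightarrow> u \<in> I"
proof -
  assume "j > d" "u \<in> hcomp j"
  then have "coset I u = I"
    using level by (auto simp: level_quotient_def mul.quot_gr)
  then show "u \<in> I"
    using coset_self[OF sI, of u] by simp
qed

lemma one_notin: "1 \<notin> I"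
proof
  assume "1 \<in> I"
  then have "u \<in> I" for u
    using I_mult[of 1 u] by simp
  then have "coset I u = I" for u
    using coset_of_mem[OF sI] by blast
  then have "gr (quot (*) UNIV I) d = {I}"
    by (auto simp: mul.quot_gr intro!: image_eqI[of _ _ 0])
  then show False
    using level by (simp add: level_quotient_def)
qed

text \<open>The coset of \<open>u\<close> lies in the socle, so \<open>u\<close> is congruent modulo
  \<open>I\<close> to a form of degree \<open>d\<close>; taking components of degree
  \<open>j < d\<close> in the homogeneous ideal \<open>I\<close> leaves \<open>u\<close>
  itself.\<close>

lemma socle_degree:
  assumes u: "u \<in> hcomp j" "j < d" and x: "\<And>i. var i * u \<in> I"
  shows "u \<in> I"
proof -
  have "coset I u \<in> socle I"
    using coset_of_mem[OF sI x] by (simp add: socle_def mul.quot_carr mul.quot_sact[OF stable_I])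
  then have "coset I u \<in> coset I ` hcomp d"
    using level by (simp add: level_quotient_def mul.quot_gr)
  then obtain w where w: "w \<in> hcomp d" "coset I u = coset I w"
    by blast
  then have "hpart j (u - w) \<in> I"
    using coset_eq_iff[OF sI] hpart_I by blast
  then show ?thesis
    using u w by (simp add: hpart_diff hpart_of_hcomp)
qed

text \<open>\<open>socle_degree\<close> iterated \<open>d - j\<close> times. In this form levelness
  is used on the side of the ideal.\<close>

lemma ideal_from_top_degree:
  assumes "u \<in> hcomp j" "j \<le> d" "\<And>m. m \<in> monoms (d - j) \<Longrightarrow> single m 1 * u \<in> I"
  shows "u \<in> I"
  using assms
proof (induction "d - j" arbitrary: j u)
  case 0
  then have "single 0 1 * u \<in> I"
    by (intro 0(4)) (simp add: monoms_def)
  then show ?case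
    by simp
next
  case (Suc e)
  show ?case
  proof (rule socle_degree[OF Suc.prems(1)])
    show "j < d"
      using Suc by simp
    fix i :: 'n
    have "(var i :: ('n, 'k) mpol) \<in> hcomp 1"
      unfolding var_def by (rule single_hcomp) simp
    then have "var i * u \<in> hcomp (j + 1)"
      using mult_hcomp Suc.prems(1) by (metis add.commute)
    then show "var i * u \<in> I"
    proof (rule Suc.hyps(1)[rotated])
      show "e = d - (j + 1)" "j + 1 \<le> d"
        using Suc.hyps(2) by simp_all
      fix m :: "'n \<Rightarrow>\<^sub>0 nat" assume "m \<in> monoms (d - (j + 1))"
      then have "m + single i 1 \<in> monoms (d - j)"
        using Suc.hyps(2) by (simp add: monoms_def)
      then have "single (m + single i 1) 1 * u \<in> I"
        by (rule Suc.prems(3))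
      then show "single m 1 * (var i * u) \<in> I"
        by (simp add: var_def mult_single flip: mult.assoc)
    qed
  qed
qed

section \<open>Macaulay duality between the ideal and its inverse system\<close>

definition Iinv :: "('n, 'k) mpol set"
  where "Iinv = inverse_system I"

text \<open>Up to nonzero factors the coefficients of u.F are the constant terms of (x^m u).F, and
  \<open>I\<close> is an ideal; so the pairing alone detects u.F = 0.\<close>

lemma Iinv_iff: "F \<in> Iinv \<longleftrightarrow> (\<forall>u\<in>I. pair u F = 0)"
proof
  assume "F \<in> Iinv"
  then show "\<forall>u\<in>I. pair u F = 0"
    by (simp add: Iinv_def inverse_system_def pair_def)
next
  assume F: "\<forall>u\<in>I. pair u F = 0"
  have "act u F = 0" if "u \<in> I" for u
  proof (rule pair_nondegenerate)
    fix m
    show "pair (single m 1) (act u F) = 0"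
      using F I_mult[OF that] by (simp flip: pair_mult)
  qed
  then show "F \<in> Iinv"
    by (simp add: Iinv_def inverse_system_def)
qed

text \<open>Double annihilator. A functional that vanishes on \<open>I\<close> but not on some
  component of \<open>u\<close> is represented by a form of that degree, and homogeneity of
  \<open>I\<close> puts this form into the inverse system.\<close>

lemma I_iff: "u \<in> I \<longleftrightarrow> (\<forall>F\<in>Iinv. pair u F = 0)"
proof
  assume "u \<in> I"
  then show "\<forall>F\<in>Iinv. pair u F = 0"
    using Iinv_iff by blast
next
  assume u: "\<forall>F\<in>Iinv. pair u F = 0"
  have "hpart j u \<in> I" for j
  proof (rule ccontr)
    assume "hpart j u \<notin> I"
    then obtain g where g: "functional g" "\<And>x. x \<in> I \<Longrightarrow> g x = 0" "g (hpart j u) = 1"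
      using functional_separates[OF mul.stable_subspace[OF stable_I]] by metis
    let ?F = "represent j g"
    have pr: "pair v ?F = g (hpart j v)" for v
      using pair_hpart_left[OF represent_hcomp] pair_represent[OF g(1) hpart_hcomp] by metis
    have "?F \<in> Iinv"
      unfolding Iinv_iff using g(2) hpart_I by (simp add: pr)
    then have "pair u ?F = 0"
      using u by blast
    then show False
      using pr[of u] g(3) by simp
  qed
  then show "u \<in> I"
    using subgrp_hparts_mem[OF sI] by blast
qed

lemma stable_Iinv: "dif.stable Iinv"
proof -
  have "act u (act v F) = 0" if "F \<in> Iinv" "u \<in> I" for u v F
    using that dif.s_commute[of u v F] by (simp add: Iinv_def inverse_system_def)
  then show ?thesis
    by (auto simp: dif.stable_def subgrp_def Iinv_def inverse_system_def act_diff_right)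
qed

lemmas sV = dif.stable_subgrp[OF stable_Iinv]

lemma hpart_Iinv: "F \<in> Iinv \<Longrightarrow> hpart j F \<in> Iinv"
  using hpart_I by (simp add: Iinv_iff flip: pair_hpart_swap)

lemma Iinv_high:
  "F \<in> Iinv \<Longrightarrow> F \<in> hcomp j \<Longrightarrow> j > d \<Longrightarrow> F = 0"
proof (rule pair_nondegenerate)
  fix m assume F: "F \<in> Iinv" "F \<in> hcomp j" "j > d"
  show "pair (single m 1) F = 0"
  proof (cases "mdeg m = j")
    case True
    then have "single m 1 \<in> I"
      by (intro high_degree[OF F(3)] single_hcomp)
    with F show ?thesis
      by (simp add: Iinv_iff)
  next
    case False
    then show ?thesis
      using pair_hcomp_neq[OF single_hcomp[OF refl] F(2)] by blast
  qed
qed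

text \<open>A proper homogeneous ideal contains no element with a constant term. This settles degree
  0, where the stratum imposes no condition.\<close>

lemma constants_Iinv: "F \<in> hcomp 0 \<Longrightarrow> F \<in> Iinv"
proof -
  assume F: "F \<in> hcomp 0"
  have "pair u F = 0" if u: "u \<in> I" for u
  proof -
    let ?c = "lookup u 0"
    have "hpart 0 u = const ?c"
      by (rule poly_mapping_eqI) (auto simp: lookup_hpart const_def lookup_single when_def)
    then have cI: "const ?c \<in> I"
      using hpart_I[OF u, of 0] by simp
    have "?c = 0"
    proof (rule ccontr)
      assume "?c \<noteq> 0"
      then have "const (1 / ?c) * const ?c = (1 :: ('n, 'k) mpol)"
        by (simp add: const_def mult_single)
      with I_mult[OF cI, of "const (1 / ?c)"] one_notin show False
        by simp
    qed
    then have "hpart 0 u = 0"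
      using \<open>hpart 0 u = const ?c\<close> by (simp add: const_def)
    then show ?thesis
      using pair_hpart_left[OF F, of u] by simp
  qed
  then show "F \<in> Iinv"
    by (simp add: Iinv_iff)
qed

lemma apolar_Iinv: "apolar_pair act (*) Iinv I"
proof unfold_locales
  show "pair (c * u) F = pair u (act c F)" for c u F :: "('n, 'k) mpol"
    by (simp only: mult.commute[of c u] pair_mult)
  show "I = {u. \<forall>F\<in>Iinv. pair u F = 0}" "Iinv = {F. \<forall>u\<in>I. pair u F = 0}"
    using I_iff Iinv_iff by blast+
qed (use stable_Iinv hpart_Iinv hpart_I in blast)+

lemma apolar_I: "apolar_pair (*) act I Iinv"
proof unfold_locales
  show "pair (act c u) F = pair u (c * F)" for c u F :: "('n, 'k) mpol"
    by (simp only: pair_commute[of "act c u" F] pair_mult[symmetric] mult.commute[of F c] pair_commute[of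
      "c * F" u])
  show "Iinv = {F. \<forall>u\<in>I. pair F u = 0}"
    by (subst pair_commute) (use Iinv_iff in blast)
  show "I = {u. \<forall>F\<in>Iinv. pair F u = 0}"
    by (subst pair_commute) (use I_iff in blast)
qed (use stable_I hpart_Iinv hpart_I in blast)+

abbreviation "L \<equiv> Iinv \<inter> hcomp d"
abbreviation "K \<equiv> I \<inter> hcomp d"

lemma Iinv_piece: "Iinv \<inter> hcomp j = {F \<in> hcomp j. \<forall>u\<in>I \<inter> hcomp j. pair u F = 0}"
proof -
  have "F \<in> Iinv" if "F \<in> hcomp j" "\<forall>u\<in>I \<inter> hcomp j. pair u F = 0" for F
    unfolding Iinv_iff
  proof
    fix u assume "u \<in> I"
    then have "pair (hpart j u) F = 0"
      using that(2) hpart_I by simp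
    then show "pair u F = 0"
      using pair_hpart_left[OF that(1)] by simp
  qed
  then show ?thesis
    by (auto simp: Iinv_iff)
qed

lemma I_piece: "I \<inter> hcomp j = {u \<in> hcomp j. \<forall>F\<in>Iinv \<inter> hcomp j. pair u F = 0}"
proof -
  have "u \<in> I" if "u \<in> hcomp j" "\<forall>F\<in>Iinv \<inter> hcomp j. pair u F = 0" for u
    unfolding I_iff
  proof
    fix F assume "F \<in> Iinv"
    then have "pair u (hpart j F) = 0"
      using that(2) hpart_Iinv by simp
    then show "pair u F = 0"
      using pair_hpart_right[OF that(1)] by simp
  qed
  then show ?thesis
    using I_iff by blast
qed

lemma subspace_I_piece: "smod.subspace (I \<inter> hcomp j)"
  by (rule smod.subspace_inter[OF mul.stable_subspace[OF stable_I] subspace_hcomp])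

lemma subspace_Iinv_piece: "smod.subspace (Iinv \<inter> hcomp j)"
  by (rule smod.subspace_inter[OF dif.stable_subspace[OF stable_Iinv] subspace_hcomp])

text \<open>The dual of \<open>ideal_from_top_degree\<close>. A form outside the span is separated
  from it by some \<open>u\<close> of degree \<open>j\<close>; then every x^m u of degree
  \<open>d\<close> annihilates \<open>L\<close>, so \<open>u\<close> lies in \<open>I\<close> and
  has to annihilate the form as well.\<close>

lemma Iinv_generated:
  assumes F: "F \<in> Iinv" "F \<in> hcomp j" and j: "j \<le> d"
  shows "F \<in> smod.span {act (single m 1) G |m G. m \<in> monoms (d - j) \<and> G \<in> L}" (is
    "F \<in> smod.span ?S")
proof (rule ccontr)
  assume "F \<notin> smod.span ?S"
  from functional_separates[OF smod.subspace_span this]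
  obtain g where g: "functional g" "\<And>x. x \<in> smod.span ?S \<Longrightarrow> g x = 0" "g F = 1"
    by blast
  define u where "u = represent j g"
  have u: "u \<in> hcomp j" "\<And>G. G \<in> hcomp j \<Longrightarrow> pair u G = g G"
    using represent_hcomp pair_represent[OF g(1)] by (auto simp: u_def pair_commute)
  have "u \<in> I"
  proof (rule ideal_from_top_degree[OF u(1) j])
    fix m :: "'n \<Rightarrow>\<^sub>0 nat" assume m: "m \<in> monoms (d - j)"
    then have mh: "single m 1 \<in> hcomp (d - j)"
      by (intro single_hcomp) (simp add: monoms_def)
    have "pair (single m 1 * u) G = 0" if G: "G \<in> L" for G
    proof -
      have "act (single m 1) G \<in> hcomp j"
        using act_hcomp(1)[OF mh, of G d] G j by simp
      moreover have "act (single m 1) G \<in> smod.span ?S"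
        using m G by (intro smod.span_base) blast
      ultimately show ?thesis
        using u(2) g(2) by (simp add: mult.commute[of _ u] pair_mult)
    qed
    moreover have "single m 1 * u \<in> hcomp d"
      using mult_hcomp[OF mh u(1)] j by simp
    ultimately show "single m 1 * u \<in> I"
      using I_piece[of d] by blast
  qed
  then have "pair u F = 0"
    using F(1) Iinv_iff by blast
  with u(2)[OF F(2)] g(3) show False
    by simp
qed

lemma scl_stable_I: "scl.stable I"
  by (rule scl_stable[OF mul.stable_subspace[OF stable_I]])

section \<open>Hilbert function and dimensions of graded pieces\<close>

lemma hilbert_fun_eq:
  "hilbert_fun I j = kvec.dim (hcomp j :: ('n, 'k) mpol set) - kvec.dim (I \<inter> hcomp j)"
  unfolding hilbert_fun_def
  by (rule kdim_quotient[where p = "coset I", OF subspace_I_piece subspace_hcomp _ subset_refl])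
    (auto simp: deg_part_def quot_def coset_add[OF sI] scl.sact_coset[OF scl_stable_I] coset_eq_iff[OF sI] hcomp_diff)

text \<open>The codimension of I_j is the dimension of its annihilator. For \<open>j \<le> d\<close>
  generation in degree \<open>d\<close> makes this number the rank of phi_j at the given
  point.\<close>

lemma hilbert_fun_dim: "hilbert_fun I j = kvec.dim (Iinv \<inter> hcomp j)"
  unfolding hilbert_fun_eq Iinv_piece by (rule dim_annihilator[OF subspace_I_piece, symmetric]) simp

lemma dim_L: "kvec.dim L = t"
  using level hilbert_fun_dim[of d] by (simp add: level_quotient_def)

lemma kdim_hcomp:
  "kdim (submod cscale (hcomp d :: ('n, 'k) mpol set)) = kvec.dim (hcomp d :: ('n, 'k) mpol set)"
proof -
  have "kvec.dim {0 :: ('n, 'k) mpol} = 0"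
    using kvec.dim_eq_card[of "{}" "{0}"] by (simp add: smod.span_empty smod.independent_empty)
  moreover have "kdim (submod cscale (hcomp d :: ('n, 'k) mpol set))
      = kvec.dim (hcomp d :: ('n, 'k) mpol set) - kvec.dim {0 :: ('n, 'k) mpol}"
    by (rule kdim_quotient[where p = "\<lambda>x. x", OF smod.subspace_single_0 subspace_hcomp _ subset_refl])
      (auto simp: submod_def)
  ultimately show ?thesis
    by simp
qed

lemma dim_K: "kvec.dim K = kdim (submod cscale (hcomp d :: ('n, 'k) mpol set)) - t"
proof -
  have "kvec.dim K \<le> kvec.dim (hcomp d :: ('n, 'k) mpol set)"
    by (rule basis_pair_exists[OF subspace_I_piece subspace_hcomp, of d d]) auto
  moreover have "t = hilbert_fun I d"
    using level by (simp add: level_quotient_def)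
  ultimately show ?thesis
    unfolding kdim_hcomp using hilbert_fun_eq[of d] by linarith
qed

sublocale P: dual_grass_points L K d t "kdim (submod cscale (hcomp d :: ('n, 'k) mpol set)) - t"
  by unfold_locales (rule subspace_Iinv_piece Int_lower2 dim_L subspace_I_piece dim_K Iinv_piece I_piece)+

section \<open>Homomorphisms are determined in degree d\<close>

lemma hom_ideal_homomorphism: "f \<in> carr (hom_ideal I) \<Longrightarrow> coset_homomorphism (*) I UNIV I f"
  using mul.RHom_iff[OF stable_I] by unfold_locales (auto simp: stable_I hom_ideal_def)

lemma hom_inv_homomorphism:
  "f \<in> carr (hom_inv Iinv) \<Longrightarrow> coset_homomorphism act Iinv UNIV Iinv f"
  using dif.RHom_iff[OF stable_Iinv] by unfold_locales (auto simp: stable_Iinv hom_inv_def)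

text \<open>Multiplication by monomials moves the discrepancy of two values up to degree
  \<open>d\<close>, where it lies in \<open>I\<close>, and \<open>ideal_from_top_degree\<close>
  brings this back down. Above degree \<open>d\<close> the quotient R/I is zero.\<close>

lemma hom_ideal_determined:
  assumes f: "f \<in> carr (hom_ideal I)" and g: "g \<in> carr (hom_ideal I)"
    and eq: "\<And>v. v \<in> K \<Longrightarrow> f v = g v"
  shows "f = g"
proof (rule coset_homs_eqI[OF hom_ideal_homomorphism[OF f] hom_ideal_homomorphism[OF g] hpart_I])
  interpret f: coset_homomorphism "(*)" I UNIV I f
    by (rule hom_ideal_homomorphism[OF f])
  interpret g: coset_homomorphism "(*)" I UNIV I g
    by (rule hom_ideal_homomorphism[OF g])
  fix j u assume u: "u \<in> I" "u \<in> hcomp j"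
  obtain a b where ab: "a \<in> hcomp j" "f u = coset I a" "b \<in> hcomp j" "g u = coset I b"
    using f g u unfolding hom_ideal_def mul.RHom_iff[OF stable_I] by (metis IntI)
  have ab': "a \<in> f u" "b \<in> g u"
    using ab coset_self[OF sI] by simp_all
  have "a - b \<in> I"
  proof (cases "j > d")
    case True
    then show ?thesis
      by (rule high_degree[OF _ hcomp_diff[OF ab(1,3)]])
  next
    case False
    show ?thesis
    proof (rule ideal_from_top_degree[OF hcomp_diff[OF ab(1,3)]])
      show "j \<le> d"
        using False by simp
      fix m :: "'n \<Rightarrow>\<^sub>0 nat" assume m: "m \<in> monoms (d - j)"
      let ?x = "single m 1 :: ('n, 'k) mpol"
      have "?x \<in> hcomp (d - j)"
        using m by (intro single_hcomp) (simp add: monoms_def)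
      then have xu: "?x * u \<in> K"
        using mult_hcomp[OF _ u(2), of ?x "d - j"] False u I_mult by simp
      have "?x * a \<in> f (?x * u)"
        by (rule f.act[OF u(1) ab'(1)])
      moreover have "?x * b \<in> f (?x * u)"
        unfolding eq[OF xu] by (rule g.act[OF u(1) ab'(2)])
      ultimately have "?x * a - ?x * b \<in> I"
        using f.mem_iff xu by blast
      then show "?x * (a - b) \<in> I"
        by (simp add: right_diff_distrib)
    qed
  qed
  then show "f u = g u"
    using ab coset_eq_iff[OF sI] by simp
qed

text \<open>The elements at which both maps have a common representative form a subspace containing
  u.G for all G in \<open>L\<close>, and these elements span the inverse system in each degree up to
  \<open>d\<close>.\<close>

lemma hom_inv_determined:
  assumes f: "f \<in> carr (hom_inv Iinv)" and g: "g \<in> carr (hom_inv Iinv)"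
    and eq: "\<And>v. v \<in> L \<Longrightarrow> f v = g v"
  shows "f = g"
proof (rule coset_homs_eqI[OF hom_inv_homomorphism[OF f] hom_inv_homomorphism[OF g] hpart_Iinv])
  interpret f: coset_homomorphism act Iinv UNIV Iinv f
    by (rule hom_inv_homomorphism[OF f])
  interpret g: coset_homomorphism act Iinv UNIV Iinv g
    by (rule hom_inv_homomorphism[OF g])
  let ?E = "{F \<in> Iinv. \<exists>a. a \<in> f F \<and> a \<in> g F}"
  have sub: "smod.subspace ?E"
    unfolding smod.subspace_def
  proof (intro conjI ballI allI)
    show "0 \<in> ?E"
      using subgrp_zero[OF sV] by (auto simp: f.zero g.zero)
    show "x + y \<in> ?E" if "x \<in> ?E" "y \<in> ?E" for x y
      using that f.add g.add subgrp_add[OF sV] by blast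
    show "cscale c x \<in> ?E" if "x \<in> ?E" for c x
      using that f.act[of x _ "const c"] g.act[of x _ "const c"] dif.stable_cscale[OF stable_Iinv]
      by (auto simp: act_const)
  qed
  fix j F assume F: "F \<in> Iinv" "F \<in> hcomp j"
  have "F \<in> ?E"
  proof (cases "j \<le> d")
    case True
    have "act u G \<in> ?E" if G: "G \<in> L" for u G
    proof -
      obtain a where "a \<in> f G"
        using f.ex G by (metis IntE)
      then show ?thesis
        using G eq[OF G] f.act[of G a u] g.act[of G a u] dif.stable_s[OF stable_Iinv] by auto
    qed
    then have "smod.span {act (single m 1) G |m G. m \<in> monoms (d - j) \<and> G \<in> L} \<subseteq> ?E"
      by (intro smod.span_minimal sub) auto
    then show ?thesis
      using Iinv_generated[OF F True] by blast
  next
    case False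
    then show ?thesis
      using Iinv_high[OF F] smod.subspace_0[OF sub] by simp
  qed
  then obtain a where "a \<in> f F" "a \<in> g F"
    by blast
  then show "f F = g F"
    using dif.coset_hom_coset[OF f.hom sV F(1), of a] dif.coset_hom_coset[OF g.hom sV F(1), of a] by simp
qed

text \<open>For v in \<open>I\<close> and G in \<open>f F\<close> the element v.G represents the
  value at v.F = 0, so it lies in the inverse system and is killed by \<open>I\<close> again. Both
  Hom spaces have the same elements, which gives an equality and not just an isomorphism.\<close>

lemma hom_inv_square:
  "hom_inv Iinv = hom_inv_sub Iinv (inverse_system (ideal_square I))"
proof -
  let ?W = "inverse_system (ideal_square I)"
  have sq: "G \<in> ?W" if "\<And>v. v \<in> I \<Longrightarrow> act v G \<in> Iinv" for G
  proof -
    have "act u G = 0" if "u \<in> ideal_square I" for u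
      using that unfolding ideal_square_def
    proof (induction rule: ideal_span_induct)
      case (step c x y)
      then obtain u v where "u \<in> I" "v \<in> I" "x = u * v"
        by blast
      then have "act x G = 0"
        using \<open>\<And>v. v \<in> I \<Longrightarrow> act v G \<in> Iinv\<close>[of v]
          by (simp add: act_mult Iinv_def inverse_system_def)
      with step show ?case
        by (simp add: act_add_left act_mult)
    qed simp
    then show ?thesis
      by (simp add: inverse_system_def)
  qed
  have "f \<in> mod_hom0 (submod act Iinv) (quot act UNIV Iinv) \<longleftrightarrow> f \<in> mod_hom0 (submod act Iinv) (quot act ?W Iinv)" for f
  proof
    assume f: "f \<in> mod_hom0 (submod act Iinv) (quot act UNIV Iinv)"
    then have f': "dif.coset_hom Iinv UNIV Iinv f"
      "\<forall>j. \<forall>x\<in>Iinv \<inter> hcomp j. \<exists>w\<in>hcomp j. f x = coset Iinv w"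
      by (simp_all add: dif.mod_hom0_iff[OF stable_Iinv stable_Iinv])
    interpret f: coset_homomorphism act Iinv UNIV Iinv f
      using f' stable_Iinv by unfold_locales simp_all
    have W: "G \<in> ?W" if F: "F \<in> Iinv" and G: "G \<in> f F" for F G
    proof (rule sq)
      fix v assume "v \<in> I"
      then have "act v F = 0"
        using F by (simp add: Iinv_def inverse_system_def)
      then show "act v G \<in> Iinv"
        using f.act[OF F G, of v] by (simp add: f.zero)
    qed
    have ex: "\<exists>w\<in>?W \<inter> X. f x = coset Iinv w"
      if "x \<in> Iinv" "\<exists>w\<in>X. f x = coset Iinv w" for x X
      using that W coset_self[OF sV] by blast
    have "\<forall>x\<in>Iinv. \<exists>w\<in>?W. f x = coset Iinv w"
      using ex[of _ UNIV] f'(1) by (simp add: dif.coset_hom_def)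
    moreover have "\<forall>j. \<forall>x\<in>Iinv \<inter> hcomp j. \<exists>w\<in>?W \<inter> hcomp j. f x = coset Iinv w"
      using ex f'(2) by (metis IntD1)
    ultimately show "f \<in> mod_hom0 (submod act Iinv) (quot act ?W Iinv)"
      using f'(1) unfolding dif.mod_hom0_iff[OF stable_Iinv stable_Iinv] dif.coset_hom_def by blast
  next
    assume "f \<in> mod_hom0 (submod act Iinv) (quot act ?W Iinv)"
    then show "f \<in> mod_hom0 (submod act Iinv) (quot act UNIV Iinv)"
      unfolding dif.mod_hom0_iff[OF stable_Iinv stable_Iinv] dif.coset_hom_def by blast
  qed
  then have "mod_hom0 (submod act Iinv) (quot act UNIV Iinv) = mod_hom0 (submod act Iinv) (quot act ?W Iinv)"
    by blast
  then show ?thesis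
    by (simp add: hom_inv_def hom_inv_sub_def HomR0_def) (simp add: quot_def)
qed

text \<open>For u and v in \<open>I\<close> the value at u v is u times the value at v, hence zero
  in R/I; so every homomorphism kills the square of \<open>I\<close>.\<close>

lemma conormal_iso:
  "mod_iso (pull_quot I (ideal_square I) (carr (hom_conormal I (ideal_square I))))
    (hom_conormal I (ideal_square I)) (hom_ideal I)"
  unfolding hom_conormal_def hom_ideal_def
proof (rule mul.pull_quot_iso[OF stable_I mul.stable_UNIV _ stable_I])
  show "mul.stable (ideal_square I)"
    unfolding ideal_square_def mul.stable_def subgrp_def
    using Modules.module.span_zero[OF module_mult] Modules.module.span_diff[OF module_mult]
      Modules.module.span_scale[OF module_mult]
    by blast
  show "ideal_square I \<subseteq> I"
  proof
    fix u assume "u \<in> ideal_square I"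
    then show "u \<in> I"
      unfolding ideal_square_def
    proof (induction rule: ideal_span_induct)
      case (step c x y)
      then show ?case
        using I_mult subgrp_add[OF sI] by blast
    qed (rule subgrp_zero[OF sI])
  qed
next
  fix g v assume g: "g \<in> mod_hom0 (submod (*) I) (quot (*) UNIV I)" and v: "v \<in> ideal_square I"
  interpret g: coset_homomorphism "(*)" I UNIV I g
    using g stable_I by unfold_locales (simp_all add: mul.mod_hom0_iff)
  from v have "v \<in> I \<and> g v = I"
    unfolding ideal_square_def
  proof (induction rule: ideal_span_induct)
    case base
    then show ?case
      by (simp add: g.zero subgrp_zero[OF sI])
  next
    case (step c x y)
    then obtain u v where uv: "u \<in> I" "v \<in> I" "x = u * v"
      by blast
    obtain w where w: "w \<in> g v"
      using g.ex uv(2) by metis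
    have x: "c * x \<in> I"
      using uv I_mult by blast
    have "(c * u) * w \<in> g (c * x)"
      using g.act[OF uv(2) w, of "c * u"] by (simp add: uv(3) mult.assoc)
    moreover have "(c * u) * w \<in> I"
      using I_mult[OF uv(1), of "c * w"] by (simp add: mult_ac)
    moreover have "0 \<in> g y"
      using step subgrp_zero[OF sI] by simp
    ultimately have "(c * u) * w + 0 \<in> g (c * x + y)"
      using g.add[OF x] step by blast
    then show ?case
      using mul.coset_hom_coset[OF g.hom sI, of "c * x + y" "(c * u) * w"] step x subgrp_add[OF sI]
        coset_of_mem[OF sI \<open>(c * u) * w \<in> I\<close>] by simp
  qed
  then show "g v = I" ..
qed

end

section \<open>The tangent space of the level stratum\<close>

lemma hpart_cscale: "hpart j (cscale c F) = cscale c (hpart j F)"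
  by (rule poly_mapping_eqI) (simp add: lookup_hpart)

lemma act_one: "act 1 F = F"
  using act_const[of 1 F] by (simp add: const_def)

context level_ideal
begin

text \<open>Intended as the graph, over the dual numbers, of the R-linear map that extends the given
  deformation to the whole inverse system.\<close>

definition generated :: "('n, 'k dual) mpol set \<Rightarrow> ('n, 'k dual) mpol set"
  where "generated M = smod.span {act (single m 1) P |m P. P \<in> M}"

text \<open>The image of phi_i at \<open>M\<close>, that is, the column span of its matrix.\<close>

definition generated_part :: "nat \<Rightarrow> ('n, 'k dual) mpol set \<Rightarrow> ('n, 'k dual) mpol set"
  where "generated_part i M = smod.span {act (single m 1) P |m P. m \<in> monoms (d - i) \<and> P \<in> M}"

lemma monomial_act_hcomp:
  assumes "m \<in> monoms (d - i)" "P \<in> hcomp d" "i \<le> d"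
  shows "act (single m 1) P \<in> hcomp i"
proof -
  have "single m 1 \<in> hcomp (d - i)"
    using assms(1) by (intro single_hcomp) (simp add: monoms_def)
  from act_hcomp(1)[OF this assms(2)] assms(3) show ?thesis
    by simp
qed

lemma generated_part_hcomp:
  "M \<subseteq> hcomp d \<Longrightarrow> i \<le> d \<Longrightarrow> generated_part i M \<subseteq> hcomp i"
  unfolding generated_part_def by (rule smod.span_minimal) (auto simp: subspace_hcomp intro: monomial_act_hcomp)

abbreviation column :: "('n \<Rightarrow>\<^sub>0 nat) \<times> ('n, 'k dual) mpol \<Rightarrow> ('n, 'k dual) mpol"
  where "column c \<equiv> act (single (fst c) 1) (snd c)"

lemma span_columns:
  assumes "is_basis t B M"
  shows "smod.span (column ` (monoms (d - i) \<times> B)) = generated_part i M"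
proof
  have B: "smod.span B = M"
    using assms by (simp add: is_basis_def)
  then have "B \<subseteq> M"
    using smod.span_superset by blast
  show "smod.span (column ` (monoms (d - i) \<times> B)) \<subseteq> generated_part i M"
    unfolding generated_part_def
  proof (rule smod.span_mono, rule image_subsetI)
    fix c :: "('n \<Rightarrow>\<^sub>0 nat) \<times> ('n, 'k dual) mpol"
    assume "c \<in> monoms (d - i) \<times> B"
    then show "column c \<in> {act (single m 1) P |m P. m \<in> monoms (d - i) \<and> P \<in> M}"
      using \<open>B \<subseteq> M\<close> by (intro CollectI exI[of _ "fst c"] exI[of _ "snd c"]) auto
  qed
  have "act (single m 1) P \<in> smod.span (column ` (monoms (d - i) \<times> B))"
    if m: "m \<in> monoms (d - i)" and P: "P \<in> smod.span B" for m P
    using P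
  proof (induction rule: smod.span_induct_alt)
    case base
    then show ?case
      by (simp add: smod.span_zero)
  next
    case (step c x y)
    have "act (single m 1) x \<in> column ` (monoms (d - i) \<times> B)"
      using m step by (intro image_eqI[of _ _ "(m, x)"]) auto
    with step show ?case
      by (simp add: act_add_right act_cscale_right smod.span_add smod.span_scale smod.span_base)
  qed
  then show "generated_part i M \<subseteq> smod.span (column ` (monoms (d - i) \<times> B))"
    unfolding generated_part_def by (intro smod.span_minimal) (auto simp: B)
qed

text \<open>The inverse system of a level quotient is generated in degree \<open>d\<close>, so the
  reduction of phi_i fills its degree \<open>i\<close> piece. This fixes the rank at the point as
  h_i.\<close>

lemma span_reduced_columns:
  assumes B: "is_basis t B M" and re: "re_part ` M = L" and i: "i \<le> d"
  shows "smod.span ((re_part \<circ> column) ` (monoms (d - i) \<times> B)) = Iinv \<inter> hcomp i" (is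
    "?X = _")
proof
  have MB: "smod.span B = M"
    using B by (simp add: is_basis_def)
  have "re_part P \<in> L" if "P \<in> B" for P
    using that re smod.span_superset[of B] MB by blast
  then show "?X \<subseteq> Iinv \<inter> hcomp i"
    using dif.stable_s[OF stable_Iinv]
    by (intro smod.span_minimal subspace_Iinv_piece)
      (auto simp: parts_act parts_single intro: monomial_act_hcomp[OF _ _ i])
  have "act (single m 1) G \<in> ?X" if m: "m \<in> monoms (d - i)" and G: "G \<in> L" for m G
  proof -
    have "G \<in> smod.span (re_part ` B)"
      using G P.L.re_basis(4)[OF B] re by simp
    then show ?thesis
    proof (induction rule: smod.span_induct_alt)
      case base
      then show ?case
        by (simp add: smod.span_zero)
    next
      case (step c x y)
      then obtain P where P: "P \<in> B" "x = re_part P"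
        by blast
      then have "act (single m 1) x \<in> (re_part \<circ> column) ` (monoms (d - i) \<times> B)"
        using m by (intro image_eqI[of _ _ "(m, P)"]) (auto simp: parts_act parts_single)
      with step show ?case
        by (simp add: act_add_right act_cscale_right smod.span_add smod.span_scale smod.span_base)
    qed
  qed
  then have "smod.span {act (single m 1) G |m G. m \<in> monoms (d - i) \<and> G \<in> L} \<subseteq> ?X"
    by (intro smod.span_minimal) auto
  then show "Iinv \<inter> hcomp i \<subseteq> ?X"
    using Iinv_generated[OF _ _ i] by blast
qed

text \<open>The rank at the point is already h_i, so the h_i-minors generate the unit ideal and only
  the vanishing of the larger minors is left. The resulting criterion does not mention a basis,
  which disposes of the choice of \<open>B\<close>.\<close>

lemma rank_stratum_iff:
  assumes M: "M \<in> grass d t" and re: "re_part ` M = L" and i: "i \<le> d"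
  shows "M \<in> rank_stratum d t i (hilbert_fun I i) \<longleftrightarrow>
    (\<forall>Q\<in>generated_part i M. re_part Q = 0 \<longrightarrow> eps_part Q \<in> Iinv)"
proof -
  have key: "(minors d i (hilbert_fun I i + 1) B \<subseteq> {0} \<longleftrightarrow>
      (\<forall>Q\<in>generated_part i M. re_part Q = 0 \<longrightarrow> eps_part Q \<in> Iinv)) \<and>
      1 \<in> ideal_span (minors d i (hilbert_fun I i) B)" if B: "is_basis t B M" for B
  proof -
    have Bd: "B \<subseteq> hcomp d"
      using B grass_subset[OF M] smod.span_superset[of B] by (auto simp: is_basis_def)
    interpret dual_columns "monoms (d - i) \<times> B" column i "hilbert_fun I i"
    proof
      show "column c \<in> hcomp i" if "c \<in> monoms (d - i) \<times> B" for c
        using that subsetD[OF Bd] by (auto intro: monomial_act_hcomp[OF _ _ i])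
      show "kvec.dim (smod.span ((re_part \<circ> column) ` (monoms (d - i) \<times> B))) = hilbert_fun I i"
        unfolding span_reduced_columns[OF B re i] hilbert_fun_dim ..
    qed
    have minors: "minors d i s B = cminors s" for s
      by (simp add: minors_def cminors_def)
    have "eps_part Q \<in> Iinv \<inter> hcomp i \<longleftrightarrow> eps_part Q \<in> Iinv"
      if "Q \<in> generated_part i M" for Q
      using generated_part_hcomp[OF grass_subset[OF M] i] that parts_hcomp by blast
    then show ?thesis
      using minors_vanish_iff one_in_minors
      unfolding minors span_columns[OF B] span_reduced_columns[OF B re i] by simp
  qed
  obtain B where "is_basis t B M"
    using M by (auto simp: grass_def)
  then show ?thesis
    using key M unfolding rank_stratum_def rank_locus_def by blast
qed

lemma level_stratum_iff:
  assumes M: "M \<in> grass d t" and re: "re_part ` M = L"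
  shows "M \<in> level_stratum d t (hilbert_fun I) \<longleftrightarrow>
    (\<forall>i\<in>{1..<d}. \<forall>Q\<in>generated_part i M. re_part Q = 0 \<longrightarrow> eps_part Q \<in> Iinv)"
  using M rank_stratum_iff[OF M re] by (simp add: level_stratum_def)

lemma generated_subspace: "smod.subspace (generated M)"
  by (simp add: generated_def)

lemma generated_base: "P \<in> M \<Longrightarrow> act W P \<in> generated M"
proof -
  assume P: "P \<in> M"
  have "act (\<Sum>m\<in>keys W. single m (lookup W m)) P \<in> generated M"
    unfolding act_sum_left generated_def
    by (subst single_eq_cscale, subst act_cscale_left) (use P in \<open>intro smod.span_sum smod.span_scale smod.span_base, blast\<close>)
  then show ?thesis
    by (simp flip: poly_sum_monoms[OF finite_keys subset_refl])
qed

lemma generated_act: "Q \<in> generated M \<Longrightarrow> act U Q \<in> generated M"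
  unfolding generated_def
proof (induction rule: smod.span_induct_alt)
  case base
  then show ?case
    by (simp add: smod.span_zero)
next
  case (step c x y)
  then obtain m P where "P \<in> M" "x = act (single m 1) P"
    by blast
  then have "act U x \<in> generated M"
    using generated_base by (simp flip: act_mult)
  with step show ?case
    by (simp add: generated_def act_add_right act_cscale_right smod.span_add smod.span_scale)
qed

text \<open>The rank conditions come degree by degree while \<open>generated M\<close> mixes
  degrees; this lemma mediates. Above degree \<open>d\<close> nothing is generated.\<close>

lemma hpart_generated:
  assumes M: "M \<subseteq> hcomp d" and Q: "Q \<in> generated M"
  shows "if i \<le> d then hpart i Q \<in> generated_part i M else hpart i Q = 0"
  using Q unfolding generated_def
proof (induction rule: smod.span_induct_alt)
  case base
  then show ?case
    by (simp add: generated_part_def smod.span_zero)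
next
  case (step c x y)
  then obtain m P where x: "P \<in> M" "x = act (single m 1) P"
    by blast
  have P: "P \<in> hcomp d"
    using x M by blast
  have "if i \<le> d then hpart i x \<in> generated_part i M else hpart i x = 0"
  proof (cases "mdeg m \<le> d")
    case True
    have xh: "x \<in> hcomp (d - mdeg m)"
      unfolding x by (rule act_hcomp(1)[OF single_hcomp[OF refl] P])
    have "x \<in> generated_part i M" if "d - mdeg m = i"
      unfolding generated_part_def using that True x
      by (intro smod.span_base CollectI exI[of _ m] exI[of _ P]) (auto simp: monoms_def)
    then show ?thesis
      using hpart_of_hcomp[OF xh, of i] by (auto simp: generated_part_def smod.span_zero)
  next
    case False
    then have "x = 0"
      unfolding x using act_hcomp(2)[OF single_hcomp[OF refl] P] by simp
    then show ?thesis
      by (simp add: generated_part_def smod.span_zero)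
  qed
  with step show ?case
    by (cases "i \<le> d")
      (simp_all add: hpart_add hpart_cscale generated_part_def smod.span_add smod.span_scale)
qed

lemma generated_part_subset: "generated_part i M \<subseteq> generated M"
  unfolding generated_def generated_part_def by (rule smod.span_mono) blast

lemma re_generated:
  assumes re: "re_part ` M = L" and F: "F \<in> Iinv"
  obtains Q where "Q \<in> generated M" "re_part Q = F"
proof -
  have sub: "smod.subspace (re_part ` generated M)"
    unfolding smod.subspace_def
  proof (intro conjI ballI allI)
    show "0 \<in> re_part ` generated M"
      using smod.subspace_0[OF generated_subspace] by (metis image_eqI parts_zero(1))
    show "x + y \<in> re_part ` generated M"
      if "x \<in> re_part ` generated M" "y \<in> re_part ` generated M" for x y
      using that smod.subspace_add[OF generated_subspace] by (auto simp flip: parts_add(1))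
    show "cscale c x \<in> re_part ` generated M" if x: "x \<in> re_part ` generated M" for c x
    proof -
      obtain Q where Q: "Q \<in> generated M" "x = re_part Q"
        using x by blast
      then have "cscale (Dual c 0) Q \<in> generated M"
        using smod.subspace_scale[OF generated_subspace] by blast
      moreover have "re_part (cscale (Dual c 0) Q) = cscale c x"
        by (simp add: Q(2) parts_cscale)
      ultimately show ?thesis
        by (metis imageI)
    qed
  qed
  have "F \<in> re_part ` generated M"
  proof (rule subgrp_hparts_mem)
    show "subgrp (re_part ` generated M)"
      by (rule scl.stable_subgrp[OF scl_stable[OF sub]])
    fix j
    show "hpart j F \<in> re_part ` generated M"
    proof (cases "j \<le> d")
      case True
      have "act (single m 1) G \<in> re_part ` generated M" if G: "G \<in> L" for m G
      proof -
        have "G \<in> re_part ` M"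
          unfolding re by (rule G)
        then obtain P where P: "P \<in> M" "re_part P = G"
          by blast
        have "re_part (act (single m 1) P) = act (single m 1) G"
          by (simp add: parts_act parts_single P(2))
        then show ?thesis
          using imageI[OF generated_base[OF P(1), of "single m 1"], of re_part] by simp
      qed
      then have "smod.span {act (single m 1) G |m G. m \<in> monoms (d - j) \<and> G \<in> L} \<subseteq> re_part ` generated M"
        by (intro smod.span_minimal sub) auto
      then show ?thesis
        using Iinv_generated[OF hpart_Iinv[OF F] hpart_hcomp True] by blast
    next
      case False
      then have "hpart j F = 0"
        using Iinv_high[OF hpart_Iinv[OF F] hpart_hcomp] by simp
      then show ?thesis
        using smod.subspace_0[OF sub] by simp
    qed
  qed
  then show thesis
    using that by blast
qed

section \<open>Homomorphisms and tangent vectors of the stratum\<close>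

abbreviation "restr_inv \<equiv> restr_deg d Iinv (carr (hom_inv Iinv))"
abbreviation "restr_ideal \<equiv> restr_deg d I (carr (hom_ideal I))"

lemma restr_inv: "f \<in> carr (hom_inv Iinv) \<Longrightarrow> restr_inv f \<in> P.L.Tan"
  "f \<in> carr (hom_inv Iinv) \<Longrightarrow> v \<in> L \<Longrightarrow> restr_inv f v = f v \<inter> hcomp d"
  using dif.restr_deg_KHom[OF stable_Iinv] dif.restr_deg_apply[OF stable_Iinv] by (simp_all add: hom_inv_def)

lemma restr_ideal: "f \<in> carr (hom_ideal I) \<Longrightarrow> restr_ideal f \<in> P.K.Tan"
  "f \<in> carr (hom_ideal I) \<Longrightarrow> v \<in> K \<Longrightarrow> restr_ideal f v = f v \<inter> hcomp d"
  using mul.restr_deg_KHom[OF stable_I] mul.restr_deg_apply[OF stable_I] by (simp_all add: hom_ideal_def)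

text \<open>The graph \<open>T\<close> of \<open>f\<close> is a subspace over the dual numbers
  containing all monomial multiples of \<open>?M\<close>, hence all that they generate. An element
  of \<open>T\<close> without real part has its eps-part in \<open>f 0\<close>, the inverse
  system.\<close>

lemma restr_inv_level_stratum:
  assumes f: "f \<in> carr (hom_inv Iinv)"
  shows "tangent_graph L (restr_inv f) \<in> level_stratum d t (hilbert_fun I)"
proof -
  interpret f: coset_homomorphism act Iinv UNIV Iinv f
    by (rule hom_inv_homomorphism[OF f])
  let ?M = "tangent_graph L (restr_inv f)"
  define T where "T = tangent_graph Iinv f"
  have T: "smod.subspace T"
    unfolding T_def using dif.coset_hom_cscale[OF f.hom] dif.stable_subspace[OF stable_Iinv]
    by (intro subspace_tangent_graph[where W = UNIV]) (unfold_locales, simp_all add: scl_stable)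
  have gen: "act (single m 1) P \<in> T" if "P \<in> ?M" for m P
    using that f.act[of "re_part P" "eps_part P"] dif.stable_s[OF stable_Iinv]
    by (auto simp: T_def tangent_graph_def restr_inv(2)[OF f] parts_act parts_single)
  have "eps_part Q \<in> Iinv" if "Q \<in> generated_part i ?M" "re_part Q = 0" for i Q
  proof -
    have "generated_part i ?M \<subseteq> T"
      unfolding generated_part_def by (rule smod.span_minimal) (use gen T in auto)
    then have "Q \<in> T"
      using that by blast
    then show ?thesis
      using that(2) by (simp add: T_def tangent_graph_def f.zero)
  qed
  then show ?thesis
    using level_stratum_iff[OF P.L.tangent_graph_grass P.L.re_tangent_graph] restr_inv(1)[OF f] by blast
qed

text \<open>A lift of F to \<open>generated ?M\<close> supplies a value of the extension at F, and
  the rank conditions make it unique modulo the inverse system.\<close>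

lemma level_stratum_restr_inv:
  assumes p: "p \<in> P.L.Tan" and strat: "tangent_graph L p \<in> level_stratum d t (hilbert_fun I)"
  obtains f where "f \<in> carr (hom_inv Iinv)" "restr_inv f = p"
proof -
  interpret p: coset_homomorphism cscale L "hcomp d" L p
    by (rule P.L.Tan_homomorphism[OF p])
  let ?M = "tangent_graph L p"
  note re = P.L.re_tangent_graph[OF p] and Mh = P.graph_hcomp[OF p]
  have part: "eps_part Q \<in> Iinv"
    if Q: "Q \<in> generated_part i ?M" "re_part Q = 0" and i: "i \<le> d" for i Q
  proof -
    \<comment> \<open>Only 0 < i < d is governed by the stratum. In degree \<open>d\<close> nothing
      beyond \<open>?M\<close> is generated, and in degree 0 the inverse system contains all
      constants.\<close>
    consider "i \<in> {1..<d}" | "i = d" | "i = 0"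
      using i by force
    then show ?thesis
    proof cases
      case 1
      then show ?thesis
        using level_stratum_iff[OF P.L.tangent_graph_grass[OF p] re] strat Q by blast
    next
      case 2
      have "generated_part d ?M \<subseteq> ?M"
        unfolding generated_part_def using P.L.tangent_graph_subspace[OF p]
        by (intro smod.span_minimal) (auto simp: monoms_def act_one)
      then have "Q \<in> ?M"
        using Q 2 by blast
      then show ?thesis
        using Q(2) by (simp add: tangent_graph_def p.zero)
    next
      case 3
      then show ?thesis
        using generated_part_hcomp[OF Mh i] Q constants_Iinv parts_hcomp by blast
    qed
  qed
  \<comment> \<open>Well-definedness: two lifts of the same F differ by such a
    \<open>Q\<close>.\<close>
  have wd: "eps_part Q \<in> Iinv" if Q: "Q \<in> generated ?M" "re_part Q = 0" for Q
  proof (rule subgrp_hparts_mem[OF sV])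
    fix i
    have "re_part (hpart i Q) = 0"
      by (simp add: parts_hpart Q(2))
    then have "eps_part (hpart i Q) \<in> Iinv"
      using hpart_generated[OF Mh Q(1), of i] part[of "hpart i Q" i] subgrp_zero[OF sV]
      by (cases "i \<le> d") simp_all
    then show "hpart i (eps_part Q) \<in> Iinv"
      by (simp add: parts_hpart)
  qed
  define f where "f = (\<lambda>F\<in>Iinv. {G. \<exists>Q\<in>generated ?M. re_part Q = F \<and> G - eps_part Q \<in> Iinv})"
  have fmem: "G \<in> f F \<longleftrightarrow> (\<exists>Q\<in>generated ?M. re_part Q = F \<and> G - eps_part Q \<in> Iinv)" if "F \<in> Iinv" for F G
    using that by (simp add: f_def)
  have fcoset: "f F = coset Iinv (eps_part Q)"
    if F: "F \<in> Iinv" and Q: "Q \<in> generated ?M" "re_part Q = F" for F Q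
  proof -
    have "G \<in> f F \<longleftrightarrow> G - eps_part Q \<in> Iinv" for G
    proof
      assume "G \<in> f F"
      then obtain Q' where Q': "Q' \<in> generated ?M" "re_part Q' = F" "G - eps_part Q' \<in> Iinv"
        using fmem[OF F] by blast
      have "re_part (Q' - Q) = 0"
        using Q(2) Q'(2) by (simp add: parts_diff)
      then have "eps_part (Q' - Q) \<in> Iinv"
        by (rule wd[OF smod.subspace_diff[OF generated_subspace Q'(1) Q(1)]])
      from subgrp_add[OF sV Q'(3) this] show "G - eps_part Q \<in> Iinv"
        by (simp add: parts_diff)
    qed (use fmem[OF F] Q in blast)
    then show ?thesis
      unfolding set_eq_iff mem_coset by blast
  qed
  have hom: "dif.coset_hom Iinv UNIV Iinv f"
    unfolding dif.coset_hom_def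
  proof (intro conjI ballI allI)
    show "f \<in> extensional Iinv"
      by (simp add: f_def)
  next
    fix F assume F: "F \<in> Iinv"
    obtain Q where "Q \<in> generated ?M" "re_part Q = F"
      by (rule re_generated[OF re F])
    then show "\<exists>w\<in>UNIV. f F = coset Iinv w"
      using fcoset[OF F] by blast
  next
    fix F F' G G' assume F: "F \<in> Iinv" "F' \<in> Iinv" and G: "G \<in> f F" "G' \<in> f F'"
    obtain Q Q' where Q: "Q \<in> generated ?M" "re_part Q = F" "G - eps_part Q \<in> Iinv"
      "Q' \<in> generated ?M" "re_part Q' = F'" "G' - eps_part Q' \<in> Iinv"
      using G F fmem by metis
    have "Q + Q' \<in> generated ?M" "re_part (Q + Q') = F + F'"
      using Q smod.subspace_add[OF generated_subspace] by (simp_all add: parts_add)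
    moreover have "(G + G') - eps_part (Q + Q') \<in> Iinv"
      using subgrp_add[OF sV Q(3,6)] by (simp add: parts_add algebra_simps)
    ultimately show "G + G' \<in> f (F + F')"
      using fmem subgrp_add[OF sV F] by blast
  next
    fix c F G assume F: "F \<in> Iinv" and G: "G \<in> f F"
    obtain Q where Q: "Q \<in> generated ?M" "re_part Q = F" "G - eps_part Q \<in> Iinv"
      using G fmem[OF F] by blast
    \<comment> \<open>An operator over k is lifted with eps-part 0, so it acts on real and eps-parts
      separately.\<close>
    have "act (dmk c 0) Q \<in> generated ?M"
      by (rule generated_act[OF Q(1)])
    moreover have "re_part (act (dmk c 0) Q) = act c F"
      by (simp add: parts_act Q(2))
    moreover have "act c G - eps_part (act (dmk c 0) Q) \<in> Iinv"
      using dif.stable_s[OF stable_Iinv Q(3), of c] by (simp add: parts_act act_diff_right)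
    ultimately show "act c G \<in> f (act c F)"
      using fmem[OF dif.stable_s[OF stable_Iinv F]] by blast
  qed
  moreover have "\<exists>w\<in>hcomp j. f F = coset Iinv w" if F: "F \<in> Iinv \<inter> hcomp j" for j F
  proof -
    obtain Q where Q: "Q \<in> generated ?M" "re_part Q = F"
      using re_generated[OF re] F by blast
    \<comment> \<open>The degree \<open>j\<close> component of a lift of a degree \<open>j\<close>
      form is again a lift, which supplies a homogeneous value.\<close>
    have "hpart j Q \<in> generated ?M"
      using hpart_generated[OF Mh Q(1), of j] generated_part_subset smod.subspace_0[OF generated_subspace]
      by (cases "j \<le> d") auto
    moreover have "re_part (hpart j Q) = F"
      using F Q(2) hpart_of_hcomp[of F j j] by (simp add: parts_hpart)
    moreover have "eps_part (hpart j Q) \<in> hcomp j"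
      by (simp add: parts_hpart)
    ultimately show ?thesis
      using fcoset F by blast
  qed
  ultimately have fH: "f \<in> carr (hom_inv Iinv)"
    unfolding hom_inv_def dif.RHom_iff[OF stable_Iinv] by blast
  interpret r: coset_homomorphism cscale L "hcomp d" L "restr_inv f"
    by (rule P.L.Tan_homomorphism[OF restr_inv(1)[OF fH]])
  have "restr_inv f = p"
  proof (rule extensionalityI[of _ L])
    show "restr_inv f \<in> extensional L" "p \<in> extensional L"
      using r.hom p.hom by (simp_all add: scl.coset_hom_def)
    fix F assume F: "F \<in> L"
    obtain G where G: "G \<in> hcomp d" "G \<in> p F"
      using p.ex F by metis
    then have "dmk F G \<in> ?M"
      using F by (simp add: dmk_tangent_graph)
    then have "act 1 (dmk F G) \<in> generated ?M"
      by (rule generated_base)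
    then have "dmk F G \<in> generated ?M"
      by (simp add: act_one)
    then have "f F = coset Iinv G"
      using fcoset[of F "dmk F G"] F by simp
    then have "G \<in> restr_inv f F"
      using restr_inv(2)[OF fH F] G(1) coset_self[OF sV] by simp
    then show "restr_inv f F = p F"
      using scl.coset_hom_coset[OF r.hom P.L.subgrp F] scl.coset_hom_coset[OF p.hom P.L.subgrp F G(2)] by simp
  qed
  with fH that show thesis
    by blast
qed

text \<open>The adjointness relation restricts to degree \<open>d\<close>, where it says that
  annihilating the deformation of \<open>L\<close> gives that of \<open>K\<close>.\<close>

lemma perp_restr:
  assumes f: "f \<in> carr (hom_inv Iinv)" and g: "g \<in> carr (hom_ideal I)"
    and fg: "\<And>u w F G. u \<in> I \<Longrightarrow> w \<in> g u \<Longrightarrow> F \<in> Iinv \<Longrightarrow> G \<in> f F \<Longrightarrow> pair w F = - pair u G"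
  shows "perp d (tangent_graph L (restr_inv f)) = tangent_graph K (restr_ideal g)"
  by (rule P.perp_tangent_graph[OF restr_inv(1)[OF f] restr_ideal(1)[OF g]])
    (use fg in \<open>auto simp: restr_inv(2)[OF f] restr_ideal(2)[OF g]\<close>)

lemma transpose_inv:
  assumes f: "f \<in> carr (hom_inv Iinv)"
  obtains g where "g \<in> carr (hom_ideal I)"
    "perp d (tangent_graph L (restr_inv f)) = tangent_graph K (restr_ideal g)"
proof -
  interpret A: apolar_pair act "(*)" Iinv I
    by (rule apolar_Iinv)
  have f0: "f \<in> mod_hom0 (submod act Iinv) (quot act UNIV Iinv)"
    using f by (simp add: hom_inv_def HomR0_def)
  have g: "A.transpose f \<in> carr (hom_ideal I)"
    using A.transpose_hom[OF f0] by (simp add: hom_ideal_def HomR0_def)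
  show thesis
    by (rule that[OF g], rule perp_restr[OF f g]) (use A.transpose_mem_iff[OF f0] in blast)
qed

text \<open>Because the pairing is symmetric, transposing \<open>g\<close> yields the same relation
  between the two maps as transposing a homomorphism on the inverse system.\<close>

lemma transpose_ideal:
  assumes g: "g \<in> carr (hom_ideal I)"
  obtains f where "f \<in> carr (hom_inv Iinv)"
    "perp d (tangent_graph L (restr_inv f)) = tangent_graph K (restr_ideal g)"
proof -
  interpret A: apolar_pair "(*)" act I Iinv
    by (rule apolar_I)
  have g0: "g \<in> mod_hom0 (submod (*) I) (quot (*) UNIV I)"
    using g by (simp add: hom_ideal_def HomR0_def)
  have f: "A.transpose g \<in> carr (hom_inv Iinv)"
    using A.transpose_hom[OF g0] by (simp add: hom_inv_def HomR0_def)
  have compat: "pair w F = - pair u G"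
    if "u \<in> I" "w \<in> g u" "F \<in> Iinv" "G \<in> A.transpose g F" for u w F G
  proof -
    have "pair G u = - pair F w"
      using that A.transpose_mem_iff[OF g0] by blast
    then show ?thesis
      by (simp add: pair_commute[of w F] pair_commute[of u G])
  qed
  show thesis
    by (rule that[OF f], rule perp_restr[OF f g]) (rule compat)
qed

lemma restr_inv_mono: "mod_mono restr_inv (hom_inv Iinv) (Homk (submod cscale L) (quot cscale (hcomp d) L))"
  using dif.restr_deg_mono[OF stable_Iinv, of d] hom_inv_determined by (simp add: hom_inv_def)

lemma restr_ideal_mono: "mod_mono restr_ideal (hom_ideal I) (Homk (submod cscale K) (quot cscale (hcomp d) K))"
  using mul.restr_deg_mono[OF stable_I, of d] hom_ideal_determined by (simp add: hom_ideal_def)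

lemma tangent_space_inv:
  "mod_iso restr_inv (hom_inv Iinv) (tangent_space d (level_stratum d t (hilbert_fun I)) L)"
proof (rule mod_iso_tangent_space[OF restr_inv_mono])
  have "carr (tangent_space d (level_stratum d t (hilbert_fun I)) L)
      = {p \<in> P.L.Tan. tangent_graph L p \<in> level_stratum d t (hilbert_fun I)}"
    using P.L.re_tangent_graph by (auto simp: tangent_space_def grass_tangent_def tangent_vectors_def)
  also have "\<dots> = restr_inv ` carr (hom_inv Iinv)"
    using restr_inv(1) restr_inv_level_stratum by (auto elim: level_stratum_restr_inv)
  finally show "restr_inv ` carr (hom_inv Iinv) = carr (tangent_space d (level_stratum d t (hilbert_fun I)) L)" ..
qed

text \<open>No minors are computed on this side. The stratum consists of annihilators here, so a
  tangent vector comes from some \<open>M\<close>, whose tangent vector extends to \<open>f\<close>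
  and is then transposed; conversely \<open>g\<close> is transposed first.\<close>

lemma tangent_space_ideal:
  "mod_iso restr_ideal (hom_ideal I) (tangent_space d (perp d ` level_stratum d t (hilbert_fun I)) K)"
proof (rule mod_iso_tangent_space[OF restr_ideal_mono])
  let ?LS = "level_stratum d t (hilbert_fun I)"
  have "carr (tangent_space d (perp d ` ?LS) K) = {q \<in> P.K.Tan. tangent_graph K q \<in> perp d ` ?LS}"
    using P.K.re_tangent_graph by (auto simp: tangent_space_def grass_tangent_def tangent_vectors_def)
  also have "\<dots> = restr_ideal ` carr (hom_ideal I)"
  proof (intro subset_antisym subsetI)
    fix q assume "q \<in> {q \<in> P.K.Tan. tangent_graph K q \<in> perp d ` ?LS}"
    then obtain M where q: "q \<in> P.K.Tan" and M: "M \<in> ?LS" "perp d M = tangent_graph K q"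
      by blast
    have "M \<in> grass d t"
      using M(1) by (simp add: level_stratum_def)
    then obtain p where p: "p \<in> P.L.Tan" "M = tangent_graph L p"
      using P.perp_eq_graph_imp q M(2) by blast
    then obtain f where f: "f \<in> carr (hom_inv Iinv)" "restr_inv f = p"
      using level_stratum_restr_inv M(1) by blast
    obtain g where g: "g \<in> carr (hom_ideal I)" "perp d M = tangent_graph K (restr_ideal g)"
      using transpose_inv[OF f(1)] f(2) p(2) by blast
    \<comment> \<open>Both tangent vectors have the graph \<open>perp d M\<close>, and the graph
      determines the vector.\<close>
    then have "q = restr_ideal g"
      using P.K.tangent_graph_inj q restr_ideal(1)[OF g(1)] M(2) by (simp add: inj_on_def)
    with g show "q \<in> restr_ideal ` carr (hom_ideal I)"
      by blast
  next
    fix q assume "q \<in> restr_ideal ` carr (hom_ideal I)"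
    then obtain g where g: "g \<in> carr (hom_ideal I)" "q = restr_ideal g"
      by blast
    obtain f where f: "f \<in> carr (hom_inv Iinv)"
      "perp d (tangent_graph L (restr_inv f)) = tangent_graph K (restr_ideal g)"
      by (rule transpose_ideal[OF g(1)])
    show "q \<in> {q \<in> P.K.Tan. tangent_graph K q \<in> perp d ` ?LS}"
      using restr_inv_level_stratum[OF f(1)] restr_ideal(1)[OF g(1)] f(2) g(2) by blast
  qed
  finally show "restr_ideal ` carr (hom_ideal I) = carr (tangent_space d (perp d ` ?LS) K)" ..
qed

end

theorem theorem2p1:
  fixes I Iinv Lam Ideg :: "('n::finite, 'k::{alg_closed_field, field_char_0}) mpol set"
    and d t :: nat and h :: "nat \<Rightarrow> nat"
  assumes level: "level_quotient I d t"
    and hilb: "h = hilbert_fun I"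
    and Iinv: "Iinv = inverse_system I"
    and Lam: "Lam = Iinv \<inter> hcomp d"
    and Ideg: "Ideg = I \<inter> hcomp d"
  shows
    \<comment> \<open>restriction to degree \<open>d\<close> gives injections\<close>
    "(mod_mono (restr_deg d I (carr (hom_ideal I))) (hom_ideal I)
        (Homk (submod cscale Ideg) (quot cscale (hcomp d) Ideg)) \<and>
      mod_mono (restr_deg d Iinv (carr (hom_inv Iinv))) (hom_inv Iinv)
        (Homk (submod cscale Lam) (quot cscale (hcomp d) Lam))) \<and>
     \<comment> \<open>canonical identifications of the tangent spaces of the two Grassmannians\<close>
     (bij_betw (tangent_graph Lam)
        (carr (Homk (submod cscale Lam) (quot cscale (hcomp d) Lam)))
        (tangent_vectors (grass d t) Lam) \<and>
      bij_betw (tangent_graph Ideg)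
        (carr (Homk (submod cscale Ideg) (quot cscale (hcomp d) Ideg)))
        (tangent_vectors
          (grass d (kdim (submod cscale (hcomp d :: ('n, 'k) mpol set)) - t)) Ideg)) \<and>
     \<comment> \<open>(A)\<close>
     (mod_iso (restr_deg d Iinv (carr (hom_inv Iinv))) (hom_inv Iinv)
        (tangent_space d (level_stratum d t h) Lam) \<and>
      hom_inv Iinv = hom_inv_sub Iinv (inverse_system (ideal_square I))) \<and>
     \<comment> \<open>(B)\<close>
     (mod_iso (restr_deg d I (carr (hom_ideal I))) (hom_ideal I)
        (tangent_space d (perp d ` level_stratum d t h) Ideg) \<and>
      mod_iso (pull_quot I (ideal_square I) (carr (hom_conormal I (ideal_square I))))
        (hom_conormal I (ideal_square I)) (hom_ideal I))"
proof -
  interpret J: level_ideal I d t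
    by standard (rule level)
  have eqs: "Iinv = J.Iinv" "Lam = J.Iinv \<inter> hcomp d"
    by (simp_all add: Lam Iinv J.Iinv_def)
  show ?thesis
    unfolding eqs hilb Ideg
    by (intro conjI J.restr_ideal_mono J.restr_inv_mono J.P.L.tangent_graph_bij J.P.K.tangent_graph_bij
        J.tangent_space_inv J.hom_inv_square J.tangent_space_ideal J.conormal_iso)
qed

end
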